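(* Let $\Omega=\mathbb{T}^d$ or $\mathbb{R}^d$, $\mathfrak{H}=L^2(\Omega)$, let $\gamma\in\mathcal{D}(\mathfrak{H})$ be faithful with finite entropy, and let $V$ be a bounded, real-valued, radially symmetric function on $\Omega$. Assume that the two-body operator on $\mathfrak{H}\otimes\mathfrak{H}$ $$X=-\mathrm{i}\left[V-(V*\rho_\gamma)\otimes\mathbf 1,\ (\log\gamma)\otimes\mathbf 1\right]$$ is bounded, where the first $V$ is the multiplication operator by $V(x-y)$ and $\rho_\gamma(x)=\gamma(x,x)$. Let $I_m=(i_1,\dots,i_m)$ and $J_m=(j_1,\dots,j_m)$ be sequences of integers in $\{1,\dots,N\}$ with $i_\nu\ne j_\nu$ for all $1\le\nu\le m$. Then $$\mathrm{Tr}_{\mathfrak{H}^{\otimes N}}\left(\gamma^{\otimes N}X_{i_1j_1}X_{i_2j_2}\cdots X_{i_mj_m}\right)=0$$ provided that one of the following holds: (1) there exists an index $i_\nu\notin\{i_1,\dots,i_{\nu-1},i_{\nu+1},\dots,i_m\}\cup\{j_1,\dots,j_m\}$; (2) there exists an index $j_\nu\notin\{j_1,\dots,j_{\nu-1},j_{\nu+1},\dots,j_m\}\cup\{i_1,\dots,i_m\}$.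
   Context: $\mathcal{D}(\mathfrak{H})$: density operators (self-adjoint, nonnegative, trace one). Faithful: $\mathrm{Ker}\,\gamma=0$. Finite entropy: $\gamma\log\gamma=(\log\gamma)\gamma$ is trace class. $X_{ij}$ denotes the operator $X$ on $\mathfrak{H}^{\otimes N}$ with the first tensor factor of $X$ acting on the $i$-th factor and the second on the $j$-th factor. *)

theory Defs
  imports "HOL-Analysis.Analysis"
begin

section \<open>The Hilbert space of square-integrable functions\<close>

text \<open>
  Vectors of \<open>L\<^sup>2(M)\<close> are represented by square-integrable measurable functions, and equality
  of vectors is equality almost everywhere (\<open>vec_eq\<close>). An operator acts on representatives;
  every \<open>bounded_op\<close> respects \<open>vec_eq\<close> because it is linear and bounded.
\<close>

definition L2 :: "'a measure \<Rightarrow> ('a \<Rightarrow> complex) set" where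
  "L2 M = {f \<in> borel_measurable M. integrable M (\<lambda>x. (cmod (f x))\<^sup>2)}"

definition vec_eq :: "'a measure \<Rightarrow> ('a \<Rightarrow> complex) \<Rightarrow> ('a \<Rightarrow> complex) \<Rightarrow> bool" where
  "vec_eq M f g \<longleftrightarrow> (AE x in M. f x = g x)"

definition l2_inner :: "'a measure \<Rightarrow> ('a \<Rightarrow> complex) \<Rightarrow> ('a \<Rightarrow> complex) \<Rightarrow> complex" where
  "l2_inner M f g = (\<integral>x. cnj (f x) * g x \<partial>M)"

definition l2_norm :: "'a measure \<Rightarrow> ('a \<Rightarrow> complex) \<Rightarrow> real" where
  "l2_norm M f = sqrt (\<integral>x. (cmod (f x))\<^sup>2 \<partial>M)"

definition orthonormal_basis :: "'a measure \<Rightarrow> ('a \<Rightarrow> complex) set \<Rightarrow> bool" where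
  "orthonormal_basis M E \<longleftrightarrow>
     E \<subseteq> L2 M \<and>
     (\<forall>e\<in>E. \<forall>e'\<in>E. l2_inner M e e' = (if e = e' then 1 else 0)) \<and>
     (\<forall>f\<in>L2 M. (\<forall>e\<in>E. l2_inner M e f = 0) \<longrightarrow> vec_eq M f (\<lambda>_. 0))"


section \<open>Bounded operators and the trace\<close>

type_synonym 'a operator = "('a \<Rightarrow> complex) \<Rightarrow> ('a \<Rightarrow> complex)"

definition bounded_op :: "'a measure \<Rightarrow> 'a operator \<Rightarrow> bool" where
  "bounded_op M T \<longleftrightarrow>
     (\<forall>f\<in>L2 M. T f \<in> L2 M) \<and>
     (\<forall>f\<in>L2 M. \<forall>g\<in>L2 M. vec_eq M (T (\<lambda>x. f x + g x)) (\<lambda>x. T f x + T g x)) \<and>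
     (\<forall>f\<in>L2 M. \<forall>c. vec_eq M (T (\<lambda>x. c * f x)) (\<lambda>x. c * T f x)) \<and>
     (\<exists>C. \<forall>f\<in>L2 M. l2_norm M (T f) \<le> C * l2_norm M f)"

definition selfadjoint_op :: "'a measure \<Rightarrow> 'a operator \<Rightarrow> bool" where
  "selfadjoint_op M T \<longleftrightarrow> (\<forall>f\<in>L2 M. \<forall>g\<in>L2 M. l2_inner M f (T g) = l2_inner M (T f) g)"

definition nonneg_op :: "'a measure \<Rightarrow> 'a operator \<Rightarrow> bool" where
  "nonneg_op M T \<longleftrightarrow> (\<forall>f\<in>L2 M. 0 \<le> Re (l2_inner M f (T f)))"

text \<open>
  \<open>has_trace M T z\<close>: in every orthonormal basis the diagonal of \<open>T\<close> is absolutely summable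
  with sum \<open>z\<close>. In particular it fails for every \<open>z\<close> when \<open>T\<close> is not trace class.
\<close>

definition has_trace :: "'a measure \<Rightarrow> 'a operator \<Rightarrow> complex \<Rightarrow> bool" where
  "has_trace M T z \<longleftrightarrow>
     (\<forall>E. orthonormal_basis M E \<longrightarrow> ((\<lambda>e. l2_inner M e (T e)) has_sum z) E)"

text \<open>Here \<open>S\<close> is the absolute value \<open>|T|\<close>, the nonnegative square root of \<open>T\<^sup>*T\<close>.\<close>

definition trace_class :: "'a measure \<Rightarrow> 'a operator \<Rightarrow> bool" where
  "trace_class M T \<longleftrightarrow>
     bounded_op M T \<and>
     (\<exists>S. bounded_op M S \<and> selfadjoint_op M S \<and> nonneg_op M S \<and>
          (\<forall>f\<in>L2 M. \<forall>g\<in>L2 M. l2_inner M (S f) (S g) = l2_inner M (T f) (T g)) \<and>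
          (\<exists>E. orthonormal_basis M E \<and> (\<lambda>e. l2_inner M e (S e)) summable_on E))"

definition density_op :: "'a measure \<Rightarrow> 'a operator \<Rightarrow> bool" where
  "density_op M \<gamma> \<longleftrightarrow>
     bounded_op M \<gamma> \<and> selfadjoint_op M \<gamma> \<and> nonneg_op M \<gamma> \<and> has_trace M \<gamma> 1"

definition faithful_op :: "'a measure \<Rightarrow> 'a operator \<Rightarrow> bool" where
  "faithful_op M \<gamma> \<longleftrightarrow> (\<forall>f\<in>L2 M. vec_eq M (\<gamma> f) (\<lambda>_. 0) \<longrightarrow> vec_eq M f (\<lambda>_. 0))"


section \<open>Spectral calculus of a density operator\<close>

text \<open>
  A density operator is compact and self-adjoint, hence \<open>\<gamma> = \<Sum>\<^sub>e \<lambda>\<^sub>e |e\<rangle>\<langle>e|\<close> for an orthonormal basis of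
  eigenvectors. The notions below use one such basis; up to null sets they do not depend on it.
\<close>

definition eigenvalue_of :: "'a measure \<Rightarrow> 'a operator \<Rightarrow> ('a \<Rightarrow> complex) \<Rightarrow> real" where
  "eigenvalue_of M T e = Re (l2_inner M e (T e))"

definition eigenbasis :: "'a measure \<Rightarrow> 'a operator \<Rightarrow> ('a \<Rightarrow> complex) set" where
  "eigenbasis M T =
     (SOME E. orthonormal_basis M E \<and>
        (\<forall>e\<in>E. vec_eq M (T e) (\<lambda>x. complex_of_real (eigenvalue_of M T e) * e x)))"

definition integral_kernel :: "'a measure \<Rightarrow> 'a operator \<Rightarrow> 'a \<Rightarrow> 'a \<Rightarrow> complex" where
  "integral_kernel M T x y =
     (\<Sum>\<^sub>\<infinity>e\<in>eigenbasis M T. complex_of_real (eigenvalue_of M T e) * e x * cnj (e y))"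

definition one_body_density :: "'a measure \<Rightarrow> 'a operator \<Rightarrow> 'a \<Rightarrow> real" where
  "one_body_density M \<gamma> x = Re (integral_kernel M \<gamma> x x)"

text \<open>
  Possibly unbounded operators are given by their graphs. \<open>log_op M \<gamma>\<close> is
  \<open>\<Sum>\<^sub>e log \<lambda>\<^sub>e |e\<rangle>\<langle>e|\<close> on its maximal domain, i.e. the self-adjoint logarithm of a faithful \<open>\<gamma>\<close>.
\<close>

type_synonym 'a op_graph = "(('a \<Rightarrow> complex) \<times> ('a \<Rightarrow> complex)) set"

definition log_op :: "'a measure \<Rightarrow> 'a operator \<Rightarrow> 'a op_graph" where
  "log_op M \<gamma> =
     {(f, g). f \<in> L2 M \<and> g \<in> L2 M \<and>
        (\<forall>e\<in>eigenbasis M \<gamma>.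
           l2_inner M e g = complex_of_real (ln (eigenvalue_of M \<gamma> e)) * l2_inner M e f)}"

definition finite_entropy :: "'a measure \<Rightarrow> 'a operator \<Rightarrow> bool" where
  "finite_entropy M \<gamma> \<longleftrightarrow>
     (\<exists>T. trace_class M T \<and> (\<forall>f\<in>L2 M. (\<gamma> f, T f) \<in> log_op M \<gamma>))"


section \<open>Tensor products\<close>

text \<open>
  \<open>L\<^sup>2(M) \<otimes> L\<^sup>2(M)\<close> is identified with \<open>L\<^sup>2\<close> of the product measure \<open>M \<Otimes>\<^sub>M M\<close>, and
  \<open>L\<^sup>2(M)\<^sup>\<otimes>\<^sup>N\<close> with \<open>L\<^sup>2\<close> of the \<open>N\<close>-fold product \<open>Pow_measure M N\<close>, with tensor
  factors labelled by \<open>1, \<dots>, N\<close>.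
\<close>

abbreviation Pow_measure :: "'a measure \<Rightarrow> nat \<Rightarrow> (nat \<Rightarrow> 'a) measure" where
  "Pow_measure M N \<equiv> Pi\<^sub>M {1..N} (\<lambda>_. M)"

text \<open>\<open>B \<otimes> 1\<close>, the closure of its restriction to the algebraic tensor product.\<close>

definition tensor_one :: "'a measure \<Rightarrow> 'a op_graph \<Rightarrow> ('a \<times> 'a) op_graph" where
  "tensor_one M B =
     {(F, G). F \<in> L2 (M \<Otimes>\<^sub>M M) \<and> G \<in> L2 (M \<Otimes>\<^sub>M M) \<and>
        (\<forall>\<epsilon>>0. \<exists>(n::nat) f g h.
           (\<forall>k<n. (f k, g k) \<in> B \<and> h k \<in> L2 M) \<and>
           l2_norm (M \<Otimes>\<^sub>M M) (\<lambda>(x, y). F (x, y) - (\<Sum>k<n. f k x * h k y)) < \<epsilon> \<and>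
           l2_norm (M \<Otimes>\<^sub>M M) (\<lambda>(x, y). G (x, y) - (\<Sum>k<n. g k x * h k y)) < \<epsilon>)}"

definition tensor_power_op :: "'a measure \<Rightarrow> nat \<Rightarrow> 'a operator \<Rightarrow> (nat \<Rightarrow> 'a) operator" where
  "tensor_power_op M N T =
     (SOME G. bounded_op (Pow_measure M N) G \<and>
        (\<forall>f. (\<forall>k\<in>{1..N}. f k \<in> L2 M) \<longrightarrow>
           vec_eq (Pow_measure M N)
             (G (\<lambda>x. \<Prod>k\<in>{1..N}. f k (x k))) (\<lambda>x. \<Prod>k\<in>{1..N}. T (f k) (x k))))"

text \<open>\<open>X\<^sub>i\<^sub>j\<close>, determined by its action on \<open>\<phi>(x\<^sub>i, x\<^sub>j) \<xi>((x\<^sub>k)\<^sub>k\<^sub>\<noteq>\<^sub>i\<^sub>,\<^sub>j)\<close>.\<close>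

definition pair_op :: "'a measure \<Rightarrow> nat \<Rightarrow> ('a \<times> 'a) operator \<Rightarrow> nat \<Rightarrow> nat \<Rightarrow> (nat \<Rightarrow> 'a) operator" where
  "pair_op M N X i j =
     (SOME Y. bounded_op (Pow_measure M N) Y \<and>
        (\<forall>\<phi>\<in>L2 (M \<Otimes>\<^sub>M M). \<forall>\<xi>\<in>L2 (Pi\<^sub>M ({1..N} - {i, j}) (\<lambda>_. M)).
           vec_eq (Pow_measure M N)
             (Y (\<lambda>x. \<phi> (x i, x j) * \<xi> (restrict x ({1..N} - {i, j}))))
             (\<lambda>x. X \<phi> (x i, x j) * \<xi> (restrict x ({1..N} - {i, j})))))"

definition pair_op_product ::
  "'a measure \<Rightarrow> nat \<Rightarrow> ('a \<times> 'a) operator \<Rightarrow> nat \<Rightarrow> (nat \<Rightarrow> nat) \<Rightarrow> (nat \<Rightarrow> nat) \<Rightarrow> (nat \<Rightarrow> 'a) operator" where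
  "pair_op_product M N X m i j = foldr (\<lambda>\<nu> T. pair_op M N X (i \<nu>) (j \<nu>) \<circ> T) [1..<Suc m] id"


section \<open>The physical space and the two-body operator\<close>

text \<open>
  \<open>Flat_Torus L\<close> is the torus \<open>\<real>\<^sup>d / L\<int>\<^sup>d\<close> of side length \<open>L > 0\<close>, with points represented in the
  cell \<open>[0, L)\<^sup>d\<close>; functions on it are \<open>L\<int>\<^sup>d\<close>-periodic functions on \<open>\<real>\<^sup>d\<close>.
\<close>

datatype config_space = Euclidean | Flat_Torus real

fun valid_space :: "config_space \<Rightarrow> bool" where
  "valid_space Euclidean = True"
| "valid_space (Flat_Torus L) = (L > 0)"

fun space_measure :: "config_space \<Rightarrow> (real ^ 'd) measure" where
  "space_measure Euclidean = lborel"
| "space_measure (Flat_Torus L) = restrict_space lborel {x. \<forall>k. 0 \<le> x $ k \<and> x $ k < L}"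

text \<open>Distance of (the class of) \<open>x\<close> to the origin of the space.\<close>

fun space_norm :: "config_space \<Rightarrow> real ^ 'd \<Rightarrow> real" where
  "space_norm Euclidean x = norm x"
| "space_norm (Flat_Torus L) x = infdist x {z. \<forall>k. \<exists>n::int. z $ k = L * of_int n}"

text \<open>On the torus this includes periodicity of \<open>V\<close>, since \<open>space_norm\<close> is periodic.\<close>

definition radially_symmetric :: "config_space \<Rightarrow> (real ^ 'd \<Rightarrow> real) \<Rightarrow> bool" where
  "radially_symmetric \<Omega> V \<longleftrightarrow> (\<forall>x y. space_norm \<Omega> x = space_norm \<Omega> y \<longrightarrow> V x = V y)"

definition convolution :: "config_space \<Rightarrow> (real ^ 'd \<Rightarrow> real) \<Rightarrow> (real ^ 'd \<Rightarrow> real) \<Rightarrow> real ^ 'd \<Rightarrow> real" where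
  "convolution \<Omega> V \<rho> x = (\<integral>y. V (x - y) * \<rho> y \<partial>space_measure \<Omega>)"

text \<open>The bounded multiplication operator \<open>V - (V * \<rho>\<^sub>\<gamma>) \<otimes> 1\<close>.\<close>

definition fluctuation_potential ::
  "config_space \<Rightarrow> (real ^ 'd \<Rightarrow> real) \<Rightarrow> (real ^ 'd) operator \<Rightarrow> ((real ^ 'd) \<times> (real ^ 'd)) operator" where
  "fluctuation_potential \<Omega> V \<gamma> F =
     (\<lambda>(x, y). complex_of_real
        (V (x - y) - convolution \<Omega> V (one_body_density (space_measure \<Omega>) \<gamma>) x) * F (x, y))"

text \<open>
  \<open>K\<close> is the bounded operator given by the commutator \<open>[A, B] = AB - BA\<close> of a bounded operator \<open>A\<close>
  with a self-adjoint operator \<open>B\<close>. As usual the commutator is understood as a sesquilinear form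
  on the domain of \<open>B\<close>: \<open>\<langle>\<phi>, BA\<psi>\<rangle>\<close> is read as \<open>\<langle>B\<phi>, A\<psi>\<rangle>\<close>. For self-adjoint \<open>B\<close> this is equivalent to
  requiring that \<open>A\<close> preserves the domain of \<open>B\<close> and that \<open>AB - BA\<close> is bounded there.
\<close>

definition bounded_commutator :: "'a measure \<Rightarrow> 'a operator \<Rightarrow> 'a op_graph \<Rightarrow> 'a operator \<Rightarrow> bool" where
  "bounded_commutator M A B K \<longleftrightarrow>
     bounded_op M K \<and>
     (\<forall>(\<phi>, B\<phi>)\<in>B. \<forall>(\<psi>, B\<psi>)\<in>B.
        l2_inner M \<phi> (K \<psi>) = l2_inner M \<phi> (A B\<psi>) - l2_inner M B\<phi> (A \<psi>))"

text \<open>\<open>X = -\<i> [V - (V * \<rho>\<^sub>\<gamma>) \<otimes> 1, (log \<gamma>) \<otimes> 1]\<close> is bounded.\<close>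

definition bounded_two_body_op ::
  "config_space \<Rightarrow> (real ^ 'd \<Rightarrow> real) \<Rightarrow> (real ^ 'd) operator \<Rightarrow> ((real ^ 'd) \<times> (real ^ 'd)) operator \<Rightarrow> bool" where
  "bounded_two_body_op \<Omega> V \<gamma> X \<longleftrightarrow>
     (\<exists>K. bounded_commutator (space_measure \<Omega> \<Otimes>\<^sub>M space_measure \<Omega>)
            (fluctuation_potential \<Omega> V \<gamma>)
            (tensor_one (space_measure \<Omega>) (log_op (space_measure \<Omega>) \<gamma>)) K \<and>
          (\<forall>F. X F = (\<lambda>z. - \<i> * K F z)))"

end

(*
  The one mechanism behind both cases is that a partial trace of gamma X_ij over the factor touched only
  once already vanishes.  In an eigenbasis (e) of gamma with eigenvalues lambda_e, the commutator K of
  A = V - (V * rho) (x) 1 with (log gamma) (x) 1 has the matrix elements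
  <e (x) f, K (e' (x) f')> = (log lambda_e' - log lambda_e) <e (x) f, A (e' (x) f')>.
  For e = e' this is zero, which is case (1).  For f = f', summation against lambda_f turns V into
  V * rho, so that A averages to zero, which is case (2).

  All other operators X_kl act trivially on the singled-out factor, hence are block diagonal, with equal
  blocks, in the product eigenbasis of the N-fold tensor product.  Expanding P X Q in this basis, the sum
  over the singled-out factor can be carried out first, because rows and columns of matrices of bounded
  operators are square summable while the eigenvalues of gamma are summable.

  The existence of the eigenbasis has to be proved as well.  Since gamma is Hilbert-Schmidt, power iteration
  on the orthogonal complement of a maximal orthonormal set of eigenvectors yields another eigenvector.
*)

theory Submission
  imports Defs
begin

text \<open>\<open>eigenbasis\<close>, \<open>tensor_power_op\<close> and \<open>pair_op\<close> are
  choices, and \<open>log_op\<close> and \<open>one_body_density\<close> are read off the chosen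
  eigenbasis, so nothing is known of them until existence is proved. Operators are therefore
  constructed from prescribed coefficients in an orthonormal basis by Riesz-Fischer, and identities
  between vectors, which hold only almost everywhere, are checked on coefficients. The unbounded
  logarithm enters only through its action on eigenvectors, where it is a scalar.

  Two obstacles shape the summations. \<open>has_trace\<close> quantifies over all orthonormal
  bases, so the computation in the product eigenbasis has to be transported to an arbitrary one. And
  \<open>X\<close> is merely bounded, so the double sums over its matrix elements converge only
  thanks to the eigenvalues: each exchange of sums joins a summable weight with one square-summable
  row and one square-summable column. Faithfulness makes all eigenvalues nonzero, hence the
  eigenbasis countable, which is used to unite null sets when tensor product bases are
  built.\<close>

section \<open>Square-integrable functions\<close>

lemma borel_measurable_cnj [measurable]:
  "f \<in> borel_measurable M \<Longrightarrow> (\<lambda>x. cnj (f x)) \<in> borel_measurable M"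
  by (rule measurable_compose[of f M borel cnj]) (auto intro!: borel_measurable_continuous_onI continuous_intros)

lemma L2_measurable [measurable_dest]: "f \<in> L2 M \<Longrightarrow> f \<in> borel_measurable M"
  by (simp add: L2_def)

lemma L2_norm_integrable: "f \<in> L2 M \<Longrightarrow> integrable M (\<lambda>x. (cmod (f x))\<^sup>2)"
  by (simp add: L2_def)

lemma L2_inner_integrable:
  assumes "f \<in> L2 M" "g \<in> L2 M"
  shows "integrable M (\<lambda>x. cnj (f x) * g x)"
proof (rule Bochner_Integration.integrable_bound)
  show "integrable M (\<lambda>x. (cmod (f x))\<^sup>2 + (cmod (g x))\<^sup>2)"
    using assms by (simp add: L2_norm_integrable)
  have "cmod (cnj (f x) * g x) \<le> (cmod (f x))\<^sup>2 + (cmod (g x))\<^sup>2" for x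
  proof -
    have "0 \<le> cmod (f x) * cmod (g x)" by simp
    then have "cmod (f x) * cmod (g x) \<le> (cmod (f x))\<^sup>2 + (cmod (g x))\<^sup>2"
      using sum_squares_bound[of "cmod (f x)" "cmod (g x)"] by linarith
    then show ?thesis by (simp add: norm_mult)
  qed
  then show "AE x in M. norm (cnj (f x) * g x) \<le> norm ((cmod (f x))\<^sup>2 + (cmod (g x))\<^sup>2)"
    by auto
  show "(\<lambda>x. cnj (f x) * g x) \<in> borel_measurable M"
    using assms[THEN L2_measurable] by measurable
qed

lemma L2_zero [simp, intro]: "(\<lambda>_. 0) \<in> L2 M"
  by (simp add: L2_def)

lemma L2_cmult [intro]: "f \<in> L2 M \<Longrightarrow> (\<lambda>x. c * f x) \<in> L2 M"
  by (auto simp: L2_def norm_mult power_mult_distrib)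

lemma L2_add [intro]:
  assumes "f \<in> L2 M" "g \<in> L2 M"
  shows "(\<lambda>x. f x + g x) \<in> L2 M"
proof -
  have "integrable M (\<lambda>x. (cmod (f x + g x))\<^sup>2)"
  proof (rule Bochner_Integration.integrable_bound)
    show "integrable M (\<lambda>x. 2 * (cmod (f x))\<^sup>2 + 2 * (cmod (g x))\<^sup>2)"
      using assms by (simp add: L2_norm_integrable)
    have "(cmod (f x + g x))\<^sup>2 \<le> 2 * (cmod (f x))\<^sup>2 + 2 * (cmod (g x))\<^sup>2" for x
    proof -
      have "(cmod (f x + g x))\<^sup>2 \<le> (cmod (f x) + cmod (g x))\<^sup>2"
        by (intro power_mono norm_triangle_ineq) auto
      also have "\<dots> \<le> 2 * (cmod (f x))\<^sup>2 + 2 * (cmod (g x))\<^sup>2"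
        using sum_squares_bound[of "cmod (f x)" "cmod (g x)"]
        by (simp add: power2_sum)
      finally show ?thesis .
    qed
    then show "AE x in M. norm ((cmod (f x + g x))\<^sup>2) \<le> norm (2 * (cmod (f x))\<^sup>2 + 2 * (cmod (g x))\<^sup>2)"
      by auto
    show "(\<lambda>x. (cmod (f x + g x))\<^sup>2) \<in> borel_measurable M"
      using assms[THEN L2_measurable] by measurable
  qed
  then show ?thesis
    using assms[THEN L2_measurable] by (simp add: L2_def)
qed

lemma L2_diff [intro]: "f \<in> L2 M \<Longrightarrow> g \<in> L2 M \<Longrightarrow> (\<lambda>x. f x - g x) \<in> L2 M"
  using L2_add[of f M "\<lambda>x. (-1) * g x"] L2_cmult[of g M "-1"] by simp

lemma L2_sum [intro]: "(\<And>k. k \<in> T \<Longrightarrow> f k \<in> L2 M) \<Longrightarrow> (\<lambda>x. \<Sum>k\<in>T. f k x) \<in> L2 M"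
  by (induction T rule: infinite_finite_induct) (auto intro: L2_add)

lemma l2_inner_cong_AE:
  assumes "f \<in> borel_measurable M" "g \<in> borel_measurable M"
    "f' \<in> borel_measurable M" "g' \<in> borel_measurable M" "vec_eq M f f'" "vec_eq M g g'"
  shows "l2_inner M f g = l2_inner M f' g'"
  unfolding l2_inner_def
proof (rule integral_cong_AE)
  show "AE x in M. cnj (f x) * g x = cnj (f' x) * g' x"
    using assms(5,6) unfolding vec_eq_def by eventually_elim simp
qed (use assms in measurable)

lemma l2_inner_cong_right:
  "f \<in> L2 M \<Longrightarrow> g \<in> L2 M \<Longrightarrow> g' \<in> L2 M \<Longrightarrow> vec_eq M g g' \<Longrightarrow> l2_inner M f g = l2_inner M f g'"
  by (rule l2_inner_cong_AE) (auto dest: L2_measurable simp: vec_eq_def)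

lemma l2_inner_add_right:
  "f \<in> L2 M \<Longrightarrow> g \<in> L2 M \<Longrightarrow> h \<in> L2 M \<Longrightarrow>
    l2_inner M f (\<lambda>x. g x + h x) = l2_inner M f g + l2_inner M f h"
  unfolding l2_inner_def by (simp add: distrib_left L2_inner_integrable)

lemma l2_inner_diff_right:
  "f \<in> L2 M \<Longrightarrow> g \<in> L2 M \<Longrightarrow> h \<in> L2 M \<Longrightarrow>
    l2_inner M f (\<lambda>x. g x - h x) = l2_inner M f g - l2_inner M f h"
  unfolding l2_inner_def by (simp add: right_diff_distrib L2_inner_integrable)

lemma l2_inner_cmult_right: "l2_inner M f (\<lambda>x. c * g x) = c * l2_inner M f g"
  unfolding l2_inner_def by (simp add: mult.left_commute)

lemma l2_inner_commute: "l2_inner M g f = cnj (l2_inner M f g)"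
proof -
  have "cnj (l2_inner M f g) = (\<integral>x. cnj (cnj (f x) * g x) \<partial>M)"
    unfolding l2_inner_def by (simp only: Bochner_Integration.integral_cnj)
  then show ?thesis
    unfolding l2_inner_def by (simp add: mult.commute)
qed

lemma l2_inner_cmult_left: "l2_inner M (\<lambda>x. c * f x) g = cnj c * l2_inner M f g"
  unfolding l2_inner_def by (simp add: mult.assoc)

lemma l2_inner_add_left:
  "f \<in> L2 M \<Longrightarrow> g \<in> L2 M \<Longrightarrow> h \<in> L2 M \<Longrightarrow>
    l2_inner M (\<lambda>x. g x + h x) f = l2_inner M g f + l2_inner M h f"
  unfolding l2_inner_def by (simp add: distrib_right L2_inner_integrable)

lemma l2_inner_diff_left:
  "f \<in> L2 M \<Longrightarrow> g \<in> L2 M \<Longrightarrow> h \<in> L2 M \<Longrightarrow>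
    l2_inner M (\<lambda>x. g x - h x) f = l2_inner M g f - l2_inner M h f"
  unfolding l2_inner_def by (simp add: left_diff_distrib L2_inner_integrable)

lemma l2_inner_zero [simp]: "l2_inner M f (\<lambda>_. 0) = 0" "l2_inner M (\<lambda>_. 0) f = 0"
  unfolding l2_inner_def by simp_all

lemma l2_inner_sum_right:
  "f \<in> L2 M \<Longrightarrow> (\<And>k. k \<in> T \<Longrightarrow> g k \<in> L2 M) \<Longrightarrow>
    l2_inner M f (\<lambda>x. \<Sum>k\<in>T. g k x) = (\<Sum>k\<in>T. l2_inner M f (g k))"
  by (induction T rule: infinite_finite_induct) (auto simp: l2_inner_add_right L2_sum)

lemma l2_inner_sum_left:
  "f \<in> L2 M \<Longrightarrow> (\<And>k. k \<in> T \<Longrightarrow> g k \<in> L2 M) \<Longrightarrow>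
    l2_inner M (\<lambda>x. \<Sum>k\<in>T. g k x) f = (\<Sum>k\<in>T. l2_inner M (g k) f)"
  by (induction T rule: infinite_finite_induct) (auto simp: l2_inner_add_left L2_sum)

lemma l2_norm_nonneg [simp]: "0 \<le> l2_norm M f"
  by (simp add: l2_norm_def)

lemma l2_norm_power2: "(l2_norm M f)\<^sup>2 = (\<integral>x. (cmod (f x))\<^sup>2 \<partial>M)"
  by (simp add: l2_norm_def)

lemma l2_inner_self: "l2_inner M f f = of_real ((l2_norm M f)\<^sup>2)"
proof -
  have "l2_inner M f f = (\<integral>x. of_real ((cmod (f x))\<^sup>2) \<partial>M)"
    unfolding l2_inner_def
    by (intro Bochner_Integration.integral_cong refl) (metis complex_norm_square mult.commute of_real_power)
  then show ?thesis
    by (simp add: l2_norm_power2 del: of_real_power)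
qed

lemma l2_norm_cong_AE:
  "f \<in> borel_measurable M \<Longrightarrow> g \<in> borel_measurable M \<Longrightarrow> vec_eq M f g \<Longrightarrow> l2_norm M f = l2_norm M g"
  unfolding l2_norm_def vec_eq_def by (auto intro!: integral_cong_AE)

lemma l2_norm_eq_0_iff: "f \<in> L2 M \<Longrightarrow> l2_norm M f = 0 \<longleftrightarrow> vec_eq M f (\<lambda>_. 0)"
  unfolding l2_norm_def vec_eq_def
  using integral_nonneg_eq_0_iff_AE[of M "\<lambda>x. (cmod (f x))\<^sup>2"] by (simp add: L2_norm_integrable)

lemma l2_norm_zero [simp]: "l2_norm M (\<lambda>_. 0) = 0"
  by (simp add: l2_norm_def)

lemma l2_norm_cmult: "l2_norm M (\<lambda>x. c * f x) = cmod c * l2_norm M f"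
  by (simp add: l2_norm_def norm_mult power_mult_distrib real_sqrt_mult)

lemma vec_eq_refl [simp]: "vec_eq M f f"
  by (simp add: vec_eq_def)

lemma vec_eq_sym: "vec_eq M f g \<Longrightarrow> vec_eq M g f"
  unfolding vec_eq_def by (rule AE_mp, assumption) auto

lemma vec_eq_trans: "vec_eq M f g \<Longrightarrow> vec_eq M g h \<Longrightarrow> vec_eq M f h"
  unfolding vec_eq_def by (erule AE_mp, erule AE_mp) auto

lemma vec_eq_diff_iff: "vec_eq M (\<lambda>x. f x - g x) (\<lambda>_. 0) \<longleftrightarrow> vec_eq M f g"
  by (simp add: vec_eq_def)

section \<open>Cauchy-Schwarz and the triangle inequality\<close>

text \<open>The component of \<open>g\<close> orthogonal to \<open>f\<close> has nonnegative norm;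
  \<open>c\<close> is the coefficient of the projection onto \<open>f\<close>. A null
  \<open>f\<close> is treated apart because \<open>c\<close> divides by its squared norm.\<close>

lemma l2_Cauchy_Schwarz:
  assumes f: "f \<in> L2 M" and g: "g \<in> L2 M"
  shows "cmod (l2_inner M f g) \<le> l2_norm M f * l2_norm M g"
proof (cases "l2_norm M f = 0")
  case True
  then have "l2_inner M f g = l2_inner M (\<lambda>_. 0) g"
    using f g by (intro l2_inner_cong_AE) (auto simp: l2_norm_eq_0_iff dest: L2_measurable)
  then show ?thesis by simp
next
  case False
  define a where "a = l2_inner M f g"
  define n where "n = (l2_norm M f)\<^sup>2"
  have n: "n > 0" using False by (simp add: n_def)
  define c where "c = a / of_real n"
  have cf: "(\<lambda>x. c * f x) \<in> L2 M" using f by auto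
  have h: "(\<lambda>x. g x - c * f x) \<in> L2 M" using f g by auto
  have ff: "l2_inner M f f = of_real n" by (simp add: l2_inner_self n_def)
  have gf: "l2_inner M g f = cnj a" unfolding a_def by (rule l2_inner_commute)
  have 0: "l2_inner M f (\<lambda>x. g x - c * f x) = 0"
    using n by (simp add: l2_inner_diff_right[OF f g cf] l2_inner_cmult_right ff flip: a_def) (simp add: c_def)
  have "l2_inner M (\<lambda>x. g x - c * f x) (\<lambda>x. g x - c * f x) = l2_inner M g (\<lambda>x. g x - c * f x)"
    by (subst l2_inner_diff_left[OF h g cf]) (simp add: l2_inner_cmult_left 0)
  also have "\<dots> = of_real ((l2_norm M g)\<^sup>2) - c * cnj a"
    by (simp add: l2_inner_diff_right f g cf l2_inner_cmult_right gf l2_inner_self)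
  also have "c * cnj a = of_real ((cmod a)\<^sup>2 / n)"
    unfolding of_real_divide complex_norm_square c_def by simp
  finally have "complex_of_real ((l2_norm M (\<lambda>x. g x - c * f x))\<^sup>2)
      = of_real ((l2_norm M g)\<^sup>2 - (cmod a)\<^sup>2 / n)"
    by (simp add: l2_inner_self del: of_real_power)
  then have "(l2_norm M (\<lambda>x. g x - c * f x))\<^sup>2 = (l2_norm M g)\<^sup>2 - (cmod a)\<^sup>2 / n"
    using of_real_eq_iff by blast
  then have "(cmod a)\<^sup>2 / n \<le> (l2_norm M g)\<^sup>2"
    by (metis diff_ge_0_iff_ge zero_le_power2)
  then have "(cmod a)\<^sup>2 \<le> (l2_norm M f * l2_norm M g)\<^sup>2"
    using n by (simp add: divide_le_eq n_def power_mult_distrib mult.commute)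
  then show ?thesis
    unfolding a_def by (rule power2_le_imp_le) auto
qed

lemma l2_norm_triangle:
  assumes f: "f \<in> L2 M" and g: "g \<in> L2 M"
  shows "l2_norm M (\<lambda>x. f x + g x) \<le> l2_norm M f + l2_norm M g"
proof -
  have h: "(\<lambda>x. f x + g x) \<in> L2 M" using f g by auto
  have "l2_inner M (\<lambda>x. f x + g x) (\<lambda>x. f x + g x)
      = l2_inner M f f + l2_inner M g g + (l2_inner M f g + cnj (l2_inner M f g))"
    by (simp add: l2_inner_add_left[OF h f g] l2_inner_add_right f g flip: l2_inner_commute)
  then have "complex_of_real ((l2_norm M (\<lambda>x. f x + g x))\<^sup>2)
      = of_real ((l2_norm M f)\<^sup>2) + of_real ((l2_norm M g)\<^sup>2)
        + (l2_inner M f g + cnj (l2_inner M f g))"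
    by (simp only: l2_inner_self)
  then have "(l2_norm M (\<lambda>x. f x + g x))\<^sup>2
      = (l2_norm M f)\<^sup>2 + (l2_norm M g)\<^sup>2 + 2 * Re (l2_inner M f g)"
    by (simp add: complex_eq_iff)
  moreover have "Re (l2_inner M f g) \<le> l2_norm M f * l2_norm M g"
    by (rule order_trans[OF complex_Re_le_cmod l2_Cauchy_Schwarz[OF f g]])
  ultimately have "(l2_norm M (\<lambda>x. f x + g x))\<^sup>2 \<le> (l2_norm M f + l2_norm M g)\<^sup>2"
    unfolding power2_sum by linarith
  then show ?thesis
    by (rule power2_le_imp_le) auto
qed

lemma l2_norm_triangle_diff:
  assumes f: "f \<in> L2 M" and g: "g \<in> L2 M" and h: "h \<in> L2 M"
  shows "l2_norm M (\<lambda>x. f x - h x) \<le> l2_norm M (\<lambda>x. f x - g x) + l2_norm M (\<lambda>x. g x - h x)"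
  using l2_norm_triangle[of "\<lambda>x. f x - g x" M "\<lambda>x. g x - h x"] assms by (simp add: L2_diff)

lemma l2_norm_minus_commute: "l2_norm M (\<lambda>x. f x - g x) = l2_norm M (\<lambda>x. g x - f x)"
  by (simp add: l2_norm_def norm_minus_commute)

section \<open>Completeness\<close>

lemma nn_integral_L2: "f \<in> L2 M \<Longrightarrow> (\<integral>\<^sup>+x. ennreal ((cmod (f x))\<^sup>2) \<partial>M) = ennreal ((l2_norm M f)\<^sup>2)"
  by (simp add: l2_norm_power2 nn_integral_eq_integral L2_norm_integrable)

text \<open>Requires no integrability in advance, so that limits obtained from Fatou and functions
  obtained from Tonelli can be recognized as square integrable.\<close>

lemma L2I_nn_integral:
  assumes "f \<in> borel_measurable M" "(\<integral>\<^sup>+x. ennreal ((cmod (f x))\<^sup>2) \<partial>M) \<le> ennreal B"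
  shows "f \<in> L2 M"
proof -
  have "(\<integral>\<^sup>+x. ennreal (norm ((cmod (f x))\<^sup>2)) \<partial>M) < \<infinity>"
    using order_le_less_trans[OF assms(2) ennreal_less_top] by simp
  with assms(1) show ?thesis
    unfolding L2_def by (auto intro!: integrableI_bounded)
qed

lemma l2_norm_le_nn_integral:
  assumes "f \<in> borel_measurable M" "(\<integral>\<^sup>+x. ennreal ((cmod (f x))\<^sup>2) \<partial>M) \<le> ennreal (B\<^sup>2)" "0 \<le> B"
  shows "l2_norm M f \<le> B"
proof -
  have "ennreal ((l2_norm M f)\<^sup>2) \<le> ennreal (B\<^sup>2)"
    using assms(2) unfolding nn_integral_L2[OF L2I_nn_integral[OF assms(1,2)]] .
  then have "(l2_norm M f)\<^sup>2 \<le> B\<^sup>2"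
    by (subst (asm) ennreal_le_iff) auto
  then show ?thesis
    using assms(3) by (rule power2_le_imp_le)
qed

text \<open>Weighting the increments with \<open>2^k\<close> makes \<open>\<Sum>k. 2^k * |u\<^sub>k\<^sub>+\<^sub>1 - u\<^sub>k|\<^sup>2\<close> integrable, so that the
  increments decay geometrically at almost every point.\<close>

lemma L2_complete_fast:
  fixes u :: "nat \<Rightarrow> 'a \<Rightarrow> complex"
  assumes u: "\<And>k. u k \<in> L2 M"
    and fast: "\<And>k. l2_norm M (\<lambda>x. u (Suc k) x - u k x) \<le> (1/2) ^ k"
  shows "\<exists>f\<in>L2 M. \<forall>k. l2_norm M (\<lambda>x. f x - u k x) \<le> 2 * (1/2) ^ k"
proof -
  note [measurable] = u[THEN L2_measurable]
  define d where "d k x = u (Suc k) x - u k x" for k x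
  have d: "d k \<in> L2 M" for k unfolding d_def using u by auto
  note [measurable] = d[THEN L2_measurable]
  have "(\<integral>\<^sup>+x. (\<Sum>k. ennreal (2 ^ k * (cmod (d k x))\<^sup>2)) \<partial>M)
      = (\<Sum>k. \<integral>\<^sup>+x. ennreal (2 ^ k * (cmod (d k x))\<^sup>2) \<partial>M)"
    by (intro nn_integral_suminf) measurable
  also have "\<dots> = (\<Sum>k. ennreal (2 ^ k * (l2_norm M (d k))\<^sup>2))"
    by (simp add: ennreal_mult' nn_integral_cmult nn_integral_L2 d)
  also have "\<dots> \<le> (\<Sum>k. ennreal ((1/2) ^ k))"
  proof (intro suminf_le ennreal_leI)
    fix k :: nat
    have "(l2_norm M (d k))\<^sup>2 \<le> ((1/2) ^ k)\<^sup>2"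
      using fast[of k] by (intro power_mono) (auto simp: d_def[abs_def])
    then have "2 ^ k * (l2_norm M (d k))\<^sup>2 \<le> 2 ^ k * ((1/2) ^ k)\<^sup>2"
      by (intro mult_left_mono) auto
    also have "\<dots> = (1/2) ^ k"
      by (simp add: power2_eq_square power_one_over)
    finally show "2 ^ k * (l2_norm M (d k))\<^sup>2 \<le> (1/2) ^ k" .
  qed auto
  also have "\<dots> = ennreal (\<Sum>k. (1/2) ^ k)"
    by (intro suminf_ennreal2) auto
  also have "\<dots> < \<infinity>" by simp
  finally have fin: "(\<integral>\<^sup>+x. (\<Sum>k. ennreal (2 ^ k * (cmod (d k x))\<^sup>2)) \<partial>M) \<noteq> \<infinity>"
    by (rule less_imp_neq)
  have "AE x in M. (\<Sum>k. ennreal (2 ^ k * (cmod (d k x))\<^sup>2)) \<noteq> \<infinity>"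
    by (rule nn_integral_PInf_AE[OF _ fin]) measurable
  then have conv: "AE x in M. convergent (\<lambda>n. u n x)"
  proof (rule AE_mp, intro AE_I2 impI)
    fix x assume fin: "(\<Sum>k. ennreal (2 ^ k * (cmod (d k x))\<^sup>2)) \<noteq> \<infinity>"
    have "\<exists>B. S = ennreal B \<and> 0 \<le> B" if "S \<noteq> \<infinity>" for S
      using that by (cases S) auto
    from this[OF fin] obtain B where B: "(\<Sum>k. ennreal (2 ^ k * (cmod (d k x))\<^sup>2)) = ennreal B" "0 \<le> B"
      by blast
    have le: "2 ^ k * (cmod (d k x))\<^sup>2 \<le> B" for k
    proof -
      have "(\<Sum>i\<in>{k}. ennreal (2 ^ i * (cmod (d i x))\<^sup>2)) \<le> (\<Sum>k. ennreal (2 ^ k * (cmod (d k x))\<^sup>2))"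
        by (intro sum_le_suminf) auto
      then have "ennreal (2 ^ k * (cmod (d k x))\<^sup>2) \<le> ennreal B"
        unfolding B(1) by simp
      then show ?thesis
        by (subst (asm) ennreal_le_iff[OF B(2)])
    qed
    \<comment> \<open>Since \<open>2 ^ k * (cmod (d k x))\<^sup>2\<close> is at most
      \<open>B\<close>, the increments at this point are dominated by a geometric series of ratio
      \<open>sqrt (1/2)\<close>.\<close>
    have "cmod (d k x) \<le> sqrt B * (sqrt (1/2)) ^ k" for k
    proof (rule power2_le_imp_le)
      have "(sqrt (1/2) ^ k)\<^sup>2 = (1/2::real) ^ k"
        by (subst power_mult[symmetric], subst mult.commute, subst power_mult) simp
      then have *: "(sqrt B * sqrt (1/2) ^ k)\<^sup>2 = B * (1/2) ^ k"
        using B(2) by (simp only: power_mult_distrib real_sqrt_pow2)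
      show "(cmod (d k x))\<^sup>2 \<le> (sqrt B * sqrt (1/2) ^ k)\<^sup>2"
        unfolding * using mult_right_mono[OF le[of k], of "(1/2) ^ k"]
        by (simp add: power_one_over)
    qed (use B(2) in auto)
    moreover have geom: "summable (\<lambda>k. sqrt B * (sqrt (1/2)) ^ k)"
      by (intro summable_mult summable_geometric) simp
    ultimately have "summable (\<lambda>k. d k x)"
      by (intro summable_comparison_test'[OF geom, where N = 0 and f = "\<lambda>k. d k x"]) simp
    then have "convergent (\<lambda>n. \<Sum>k<n. d k x)"
      using summable_iff_convergent by blast
    moreover have "(\<Sum>k<n. d k x) = u n x - u 0 x" for n
      unfolding d_def by (rule sum_lessThan_telescope)
    ultimately have "convergent (\<lambda>n. u n x - u 0 x)" by simp
    then show "convergent (\<lambda>n. u n x)"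
      by (simp add: convergent_diff_const_right_iff)
  qed
  define f where "f x = lim (\<lambda>n. u n x)" for x
  have [measurable]: "f \<in> borel_measurable M"
    unfolding f_def by measurable
  have lim: "AE x in M. (\<lambda>n. u n x) \<longlonglongrightarrow> f x"
    using conv unfolding f_def by (auto simp: convergent_LIMSEQ_iff)
  have near: "l2_norm M (\<lambda>x. u n x - u k x) \<le> 2 * (1/2) ^ k" if "k \<le> n" for k n
  proof -
    \<comment> \<open>The subtracted term is the part of the geometric series not yet used up; it is
      what lets the induction close.\<close>
    have "l2_norm M (\<lambda>x. u n x - u k x) \<le> 2 * (1/2) ^ k - 2 * (1/2) ^ n"
      using that
    proof (induction rule: dec_induct)
      case (step n)
      then show ?case
        using l2_norm_triangle_diff[OF u[of "Suc n"] u[of n] u[of k]] fast[of n] by simp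
    qed simp
    then show ?thesis
      using zero_le_power[of "1/2::real" n] by linarith
  qed
  \<comment> \<open>Fatou's lemma in \<open>n\<close>, with the norms controlled by
    \<open>near\<close>. The case \<open>k = 0\<close> then yields membership of \<open>f\<close> in
    \<open>L2 M\<close>.\<close>
  have bound: "(\<integral>\<^sup>+x. ennreal ((cmod (f x - u k x))\<^sup>2) \<partial>M) \<le> ennreal ((2 * (1/2) ^ k)\<^sup>2)" for k
  proof -
    have "(\<integral>\<^sup>+x. ennreal ((cmod (f x - u k x))\<^sup>2) \<partial>M)
        = (\<integral>\<^sup>+x. liminf (\<lambda>n. ennreal ((cmod (u n x - u k x))\<^sup>2)) \<partial>M)"
    proof (rule nn_integral_cong_AE, use lim in \<open>rule AE_mp\<close>, intro AE_I2 impI)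
      fix x assume "(\<lambda>n. u n x) \<longlonglongrightarrow> f x"
      then have "(\<lambda>n. ennreal ((cmod (u n x - u k x))\<^sup>2)) \<longlonglongrightarrow> ennreal ((cmod (f x - u k x))\<^sup>2)"
        by (intro tendsto_intros)
      then show "ennreal ((cmod (f x - u k x))\<^sup>2) = liminf (\<lambda>n. ennreal ((cmod (u n x - u k x))\<^sup>2))"
        by (rule lim_imp_Liminf[OF trivial_limit_sequentially, symmetric])
    qed
    also have "\<dots> \<le> liminf (\<lambda>n. \<integral>\<^sup>+x. ennreal ((cmod (u n x - u k x))\<^sup>2) \<partial>M)"
      by (intro nn_integral_liminf) measurable
    also have "\<dots> \<le> ennreal ((2 * (1/2) ^ k)\<^sup>2)"
    proof (rule Liminf_le)
      show "\<forall>\<^sub>F n in sequentially. (\<integral>\<^sup>+x. ennreal ((cmod (u n x - u k x))\<^sup>2) \<partial>M) \<le> ennreal ((2 * (1/2) ^ k)\<^sup>2)"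
        using eventually_ge_at_top[of k]
      proof eventually_elim
        case (elim n)
        have "(\<integral>\<^sup>+x. ennreal ((cmod (u n x - u k x))\<^sup>2) \<partial>M) = ennreal ((l2_norm M (\<lambda>x. u n x - u k x))\<^sup>2)"
          using nn_integral_L2[of "\<lambda>x. u n x - u k x" M] u by (simp add: L2_diff)
        then show ?case
          using power_mono[OF near[OF elim] l2_norm_nonneg, of 2] by (simp only: ennreal_leI)
      qed
    qed auto
    finally show ?thesis .
  qed
  have "(\<lambda>x. f x - u 0 x) \<in> L2 M"
    by (rule L2I_nn_integral[OF _ bound]) measurable
  from L2_add[OF this u[of 0]] have "f \<in> L2 M" by simp
  moreover have "l2_norm M (\<lambda>x. f x - u k x) \<le> 2 * (1/2) ^ k" for k
    by (rule l2_norm_le_nn_integral[OF _ bound]) auto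
  ultimately show ?thesis by blast
qed

section \<open>Bounded operators\<close>

lemma bounded_op_L2 [intro]: "bounded_op M T \<Longrightarrow> f \<in> L2 M \<Longrightarrow> T f \<in> L2 M"
  by (simp add: bounded_op_def)

lemma bounded_op_add:
  "bounded_op M T \<Longrightarrow> f \<in> L2 M \<Longrightarrow> g \<in> L2 M \<Longrightarrow> vec_eq M (T (\<lambda>x. f x + g x)) (\<lambda>x. T f x + T g x)"
  by (simp add: bounded_op_def)

lemma bounded_op_cmult:
  "bounded_op M T \<Longrightarrow> f \<in> L2 M \<Longrightarrow> vec_eq M (T (\<lambda>x. c * f x)) (\<lambda>x. c * T f x)"
  by (simp add: bounded_op_def)

lemma bounded_op_bound:
  assumes "bounded_op M T"
  obtains C where "0 \<le> C" "\<And>f. f \<in> L2 M \<Longrightarrow> l2_norm M (T f) \<le> C * l2_norm M f"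
proof -
  obtain C where C: "\<forall>f\<in>L2 M. l2_norm M (T f) \<le> C * l2_norm M f"
    using assms unfolding bounded_op_def by blast
  show thesis
  \<comment> \<open>The constant in \<open>bounded_op\<close> may be negative when every vector has
    norm 0.\<close>
  proof (rule that[of "max C 0"])
    fix f assume f: "f \<in> L2 M"
    have "C * l2_norm M f \<le> max C 0 * l2_norm M f"
      by (rule mult_right_mono) auto
    with C f show "l2_norm M (T f) \<le> max C 0 * l2_norm M f" by fastforce
  qed simp
qed

lemma bounded_op_diff:
  assumes T: "bounded_op M T" and f: "f \<in> L2 M" and g: "g \<in> L2 M"
  shows "vec_eq M (T (\<lambda>x. f x - g x)) (\<lambda>x. T f x - T g x)"
proof -
  have 1: "vec_eq M (T (\<lambda>x. f x + (-1) * g x)) (\<lambda>x. T f x + T (\<lambda>x. (-1) * g x) x)"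
    by (rule bounded_op_add[OF T f L2_cmult[OF g]])
  have 2: "vec_eq M (T (\<lambda>x. (-1) * g x)) (\<lambda>x. (-1) * T g x)"
    by (rule bounded_op_cmult[OF T g])
  have "vec_eq M (T (\<lambda>x. f x + (-1) * g x)) (\<lambda>x. T f x - T g x)"
    using 1 2 unfolding vec_eq_def by eventually_elim simp
  then show ?thesis by simp
qed

text \<open>Boundedness sends a null vector to a null vector, and linearity transfers this to
  \<open>f - g\<close>. Hence operators on representatives descend to equivalence classes.\<close>

lemma bounded_op_cong:
  assumes T: "bounded_op M T" and f: "f \<in> L2 M" and g: "g \<in> L2 M" and fg: "vec_eq M f g"
  shows "vec_eq M (T f) (T g)"
proof -
  obtain C where C: "\<And>f. f \<in> L2 M \<Longrightarrow> l2_norm M (T f) \<le> C * l2_norm M f"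
    using bounded_op_bound[OF T] by blast
  have h: "(\<lambda>x. f x - g x) \<in> L2 M" by (rule L2_diff[OF f g])
  have "l2_norm M (\<lambda>x. f x - g x) = 0"
    using fg h by (simp add: l2_norm_eq_0_iff vec_eq_diff_iff)
  with C[OF h] have "l2_norm M (T (\<lambda>x. f x - g x)) = 0"
    using l2_norm_nonneg[of M "T (\<lambda>x. f x - g x)"] by simp
  then have "vec_eq M (T (\<lambda>x. f x - g x)) (\<lambda>_. 0)"
    using bounded_op_L2[OF T h] by (simp add: l2_norm_eq_0_iff)
  then have "vec_eq M (\<lambda>x. T f x - T g x) (\<lambda>_. 0)"
    by (rule vec_eq_trans[OF vec_eq_sym[OF bounded_op_diff[OF T f g]]])
  then show ?thesis by (simp add: vec_eq_diff_iff)
qed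

lemma bounded_op_id [intro]: "bounded_op M id"
  unfolding bounded_op_def by (auto intro!: exI[of _ 1])

lemma bounded_op_comp [intro]:
  assumes S: "bounded_op M S" and T: "bounded_op M T"
  shows "bounded_op M (S \<circ> T)"
proof -
  obtain C where C: "0 \<le> C" "\<And>f. f \<in> L2 M \<Longrightarrow> l2_norm M (S f) \<le> C * l2_norm M f"
    using bounded_op_bound[OF S] by blast
  obtain D where D: "\<And>f. f \<in> L2 M \<Longrightarrow> l2_norm M (T f) \<le> D * l2_norm M f"
    using bounded_op_bound[OF T] by blast
  have "l2_norm M (S (T f)) \<le> (C * D) * l2_norm M f" if f: "f \<in> L2 M" for f
    using order_trans[OF C(2)[OF bounded_op_L2[OF T f]] mult_left_mono[OF D[OF f] C(1)]]
    by (simp add: mult.assoc)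
  moreover have "vec_eq M (S (T (\<lambda>x. f x + g x))) (\<lambda>x. S (T f) x + S (T g) x)"
    if f: "f \<in> L2 M" and g: "g \<in> L2 M" for f g
    by (rule vec_eq_trans[OF bounded_op_cong[OF S _ _ bounded_op_add[OF T f g]] bounded_op_add[OF S]])
      (use T f g in auto)
  moreover have "vec_eq M (S (T (\<lambda>x. c * f x))) (\<lambda>x. c * S (T f) x)"
    if f: "f \<in> L2 M" for f c
    by (rule vec_eq_trans[OF bounded_op_cong[OF S _ _ bounded_op_cmult[OF T f]] bounded_op_cmult[OF S]])
      (use T f in auto)
  ultimately show ?thesis
    unfolding bounded_op_def comp_def using S T by blast
qed

lemma l2_inner_op_diff:
  assumes "bounded_op M T" "f \<in> L2 M" "g \<in> L2 M" "h \<in> L2 M"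
  shows "l2_inner M f (T (\<lambda>x. g x - h x)) = l2_inner M f (T g) - l2_inner M f (T h)"
  using assms
  by (subst l2_inner_cong_right[OF _ _ _ bounded_op_diff]) (auto simp: l2_inner_diff_right bounded_op_L2)

lemma l2_inner_op_add:
  assumes "bounded_op M T" "f \<in> L2 M" "g \<in> L2 M" "h \<in> L2 M"
  shows "l2_inner M f (T (\<lambda>x. g x + h x)) = l2_inner M f (T g) + l2_inner M f (T h)"
  using assms
  by (subst l2_inner_cong_right[OF _ _ _ bounded_op_add]) (auto simp: l2_inner_add_right bounded_op_L2)

lemma l2_inner_op_cmult:
  assumes "bounded_op M T" "f \<in> L2 M" "g \<in> L2 M"
  shows "l2_inner M f (T (\<lambda>x. c * g x)) = c * l2_inner M f (T g)"
  using assms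
  by (subst l2_inner_cong_right[OF _ _ _ bounded_op_cmult]) (auto simp: l2_inner_cmult_right)

lemma l2_inner_op_sum:
  assumes T: "bounded_op M T" and f: "f \<in> L2 M" and b: "\<And>k. k \<in> S \<Longrightarrow> b k \<in> L2 M"
  shows "l2_inner M f (T (\<lambda>x. \<Sum>k\<in>S. c k * b k x)) = (\<Sum>k\<in>S. c k * l2_inner M f (T (b k)))"
proof -
  \<comment> \<open>\<open>T\<close> need not map the zero function to the zero function, only to a
    null function; the empty sum therefore needs an argument.\<close>
  have zero: "l2_inner M f (T (\<lambda>_. 0)) = 0"
    using l2_inner_op_cmult[OF T f L2_zero, of 0] by simp
  show ?thesis
    using b
  proof (induction S rule: infinite_finite_induct)
    case (insert k S)
    have 1: "b k \<in> L2 M" "(\<lambda>x. \<Sum>k\<in>S. c k * b k x) \<in> L2 M"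
      using insert.prems by (auto intro!: L2_sum)
    show ?case
      using insert l2_inner_op_add[OF T f L2_cmult[OF 1(1)] 1(2)] l2_inner_op_cmult[OF T f 1(1)]
      by simp
  qed (simp_all add: zero)
qed

section \<open>Orthonormal families\<close>

text \<open>Indexed families instead of sets of vectors, because product bases are naturally indexed
  by pairs or by functions on the tensor factors and have to be reindexed.\<close>

definition ortho_family :: "'a measure \<Rightarrow> 'i set \<Rightarrow> ('i \<Rightarrow> 'a \<Rightarrow> complex) \<Rightarrow> bool" where
  "ortho_family M I b \<longleftrightarrow> (\<forall>i\<in>I. b i \<in> L2 M) \<and>
     (\<forall>i\<in>I. \<forall>j\<in>I. l2_inner M (b i) (b j) = (if i = j then 1 else 0))"

definition basis_family :: "'a measure \<Rightarrow> 'i set \<Rightarrow> ('i \<Rightarrow> 'a \<Rightarrow> complex) \<Rightarrow> bool" where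
  "basis_family M I b \<longleftrightarrow> ortho_family M I b \<and>
     (\<forall>f\<in>L2 M. (\<forall>i\<in>I. l2_inner M (b i) f = 0) \<longrightarrow> vec_eq M f (\<lambda>_. 0))"

lemma orthonormal_basis_iff: "orthonormal_basis M E \<longleftrightarrow> basis_family M E id"
  unfolding orthonormal_basis_def basis_family_def ortho_family_def by auto

lemma basis_family_ortho: "basis_family M I b \<Longrightarrow> ortho_family M I b"
  by (simp add: basis_family_def)

lemma ortho_family_L2 [intro]: "ortho_family M I b \<Longrightarrow> i \<in> I \<Longrightarrow> b i \<in> L2 M"
  by (simp add: ortho_family_def)

lemma ortho_family_inner:
  "ortho_family M I b \<Longrightarrow> i \<in> I \<Longrightarrow> j \<in> I \<Longrightarrow> l2_inner M (b i) (b j) = (if i = j then 1 else 0)"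
  by (simp add: ortho_family_def)

lemma ortho_family_norm: 
  assumes "ortho_family M I b" "i \<in> I" shows "l2_norm M (b i) = 1"
proof -
  have "complex_of_real ((l2_norm M (b i))\<^sup>2) = 1"
    using ortho_family_inner[OF assms(1,2,2)] by (simp only: l2_inner_self) simp
  then have "(l2_norm M (b i))\<^sup>2 = 1" using of_real_eq_1_iff by blast
  then show ?thesis
    using l2_norm_nonneg[of M "b i"] by (simp add: power2_eq_1_iff)
qed

text \<open>The standard way below to prove an almost everywhere identity: two vectors agree as soon
  as their coefficients do.\<close>

lemma basis_family_unique:
  assumes b: "basis_family M I b" and "f \<in> L2 M" "g \<in> L2 M"
    and "\<And>i. i \<in> I \<Longrightarrow> l2_inner M (b i) f = l2_inner M (b i) g"
  shows "vec_eq M f g"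
proof -
  have "l2_inner M (b i) (\<lambda>x. f x - g x) = 0" if "i \<in> I" for i
    using that assms ortho_family_L2[OF basis_family_ortho[OF b]] by (simp add: l2_inner_diff_right)
  then have "vec_eq M (\<lambda>x. f x - g x) (\<lambda>_. 0)"
    using b L2_diff[OF assms(2,3)] unfolding basis_family_def by blast
  then show ?thesis by (simp add: vec_eq_diff_iff)
qed

lemma basis_family_reindex:
  assumes b: "basis_family M I b" and h: "bij_betw h J I"
  shows "basis_family M J (\<lambda>j. b (h j))"
proof -
  have hJ: "h j \<in> I" if "j \<in> J" for j using h that by (auto simp: bij_betw_def)
  have inj: "h i = h j \<longleftrightarrow> i = j" if "i \<in> J" "j \<in> J" for i j
    using h that by (auto simp: bij_betw_def inj_on_def)
  have surj: "\<exists>j\<in>J. i = h j" if "i \<in> I" for i using h that by (auto simp: bij_betw_def)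
  show ?thesis
    using b hJ inj surj unfolding basis_family_def ortho_family_def by (simp, metis)
qed

section \<open>Bessel's inequality and the Riesz-Fischer theorem\<close>

context
  fixes M :: "'a measure" and I :: "'i set" and b :: "'i \<Rightarrow> 'a \<Rightarrow> complex"
  assumes ortho: "ortho_family M I b"
begin

lemma ortho_sum_L2: "S \<subseteq> I \<Longrightarrow> (\<lambda>x. \<Sum>i\<in>S. c i * b i x) \<in> L2 M"
  using ortho by (intro L2_sum L2_cmult) auto

lemma ortho_sum_inner:
  assumes "finite S" "S \<subseteq> I" "j \<in> I"
  shows "l2_inner M (b j) (\<lambda>x. \<Sum>i\<in>S. c i * b i x) = (if j \<in> S then c j else 0)"
proof -
  have "l2_inner M (b j) (\<lambda>x. \<Sum>i\<in>S. c i * b i x) = (\<Sum>i\<in>S. l2_inner M (b j) (\<lambda>x. c i * b i x))"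
    using assms ortho by (intro l2_inner_sum_right) auto
  also have "\<dots> = (\<Sum>i\<in>S. if i = j then c j else 0)"
    using assms by (intro sum.cong) (auto simp: l2_inner_cmult_right ortho_family_inner[OF ortho] subset_iff)
  also have "\<dots> = (if j \<in> S then c j else 0)"
    using assms(1) by (simp add: sum.delta)
  finally show ?thesis .
qed

lemma ortho_sum_inner_left:
  assumes "finite S" "S \<subseteq> I" "g \<in> L2 M"
  shows "l2_inner M (\<lambda>x. \<Sum>i\<in>S. c i * b i x) g = (\<Sum>i\<in>S. cnj (c i) * l2_inner M (b i) g)"
proof -
  have "l2_inner M (\<lambda>x. \<Sum>i\<in>S. c i * b i x) g = (\<Sum>i\<in>S. l2_inner M (\<lambda>x. c i * b i x) g)"
    using assms ortho by (intro l2_inner_sum_left) auto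
  then show ?thesis by (simp add: l2_inner_cmult_left)
qed

lemma ortho_sum_norm:
  assumes "finite S" "S \<subseteq> I"
  shows "(l2_norm M (\<lambda>x. \<Sum>i\<in>S. c i * b i x))\<^sup>2 = (\<Sum>i\<in>S. (cmod (c i))\<^sup>2)"
proof -
  have "complex_of_real ((l2_norm M (\<lambda>x. \<Sum>i\<in>S. c i * b i x))\<^sup>2)
      = (\<Sum>i\<in>S. cnj (c i) * l2_inner M (b i) (\<lambda>x. \<Sum>i\<in>S. c i * b i x))"
    unfolding l2_inner_self[symmetric]
    by (rule ortho_sum_inner_left[OF assms ortho_sum_L2[OF assms(2)]])
  also have "\<dots> = (\<Sum>i\<in>S. cnj (c i) * c i)"
    using assms by (intro sum.cong refl) (auto simp: ortho_sum_inner subset_iff)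
  also have "\<dots> = complex_of_real (\<Sum>i\<in>S. (cmod (c i))\<^sup>2)"
    unfolding of_real_sum complex_norm_square by (simp add: mult.commute)
  finally show ?thesis using of_real_eq_iff by blast
qed

text \<open>Pythagoras: the residual is orthogonal to the partial sum. The equality gives Bessel at
  once, and also shows that residuals decrease as \<open>S\<close> grows, which
  \<open>basis_expansion\<close> relies on.\<close>

lemma ortho_residual_norm:
  assumes "finite S" "S \<subseteq> I" "f \<in> L2 M"
  shows "(l2_norm M (\<lambda>x. f x - (\<Sum>i\<in>S. l2_inner M (b i) f * b i x)))\<^sup>2
    = (l2_norm M f)\<^sup>2 - (\<Sum>i\<in>S. (cmod (l2_inner M (b i) f))\<^sup>2)"
proof -
  define g where "g x = (\<Sum>i\<in>S. l2_inner M (b i) f * b i x)" for x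
  have g: "g \<in> L2 M" unfolding g_def by (rule ortho_sum_L2[OF assms(2)])
  have d: "(\<lambda>x. f x - g x) \<in> L2 M" by (rule L2_diff[OF assms(3) g])
  have gd: "l2_inner M g (\<lambda>x. f x - g x) = 0"
  proof -
    have "l2_inner M g (\<lambda>x. f x - g x)
        = (\<Sum>i\<in>S. cnj (l2_inner M (b i) f) * l2_inner M (b i) (\<lambda>x. f x - g x))"
      by (rule ortho_sum_inner_left[OF assms(1,2) d, of "\<lambda>i. l2_inner M (b i) f", folded g_def])
    also have "\<dots> = 0"
    proof (intro sum.neutral ballI)
      fix i assume i: "i \<in> S"
      then have "i \<in> I" using assms(2) by auto
      then have "l2_inner M (b i) (\<lambda>x. f x - g x) = l2_inner M (b i) f - l2_inner M (b i) g"
        using ortho assms(3) g by (intro l2_inner_diff_right) auto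
      also have "l2_inner M (b i) g = l2_inner M (b i) f"
        using ortho_sum_inner[OF assms(1,2) \<open>i \<in> I\<close>] i by (simp add: g_def[abs_def])
      finally show "cnj (l2_inner M (b i) f) * l2_inner M (b i) (\<lambda>x. f x - g x) = 0" by simp
    qed
    finally show ?thesis .
  qed
  have "l2_inner M f f = l2_inner M (\<lambda>x. (f x - g x) + g x) (\<lambda>x. (f x - g x) + g x)" by simp
  also have "\<dots> = l2_inner M (\<lambda>x. f x - g x) (\<lambda>x. f x - g x) + l2_inner M g g"
    using gd l2_inner_commute[of M g "\<lambda>x. f x - g x"]
      l2_inner_add_left[OF L2_add[OF d g] d g] l2_inner_add_right[OF d d g] l2_inner_add_right[OF g d g]
    by simp
  finally have "complex_of_real ((l2_norm M f)\<^sup>2)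
      = of_real ((l2_norm M (\<lambda>x. f x - g x))\<^sup>2 + (l2_norm M g)\<^sup>2)"
    by (simp only: l2_inner_self of_real_add)
  then have "(l2_norm M f)\<^sup>2 = (l2_norm M (\<lambda>x. f x - g x))\<^sup>2 + (l2_norm M g)\<^sup>2"
    using of_real_eq_iff by blast
  moreover have "(l2_norm M g)\<^sup>2 = (\<Sum>i\<in>S. (cmod (l2_inner M (b i) f))\<^sup>2)"
    unfolding g_def by (rule ortho_sum_norm[OF assms(1,2)])
  ultimately show ?thesis by (simp add: g_def)
qed

lemma Bessel:
  assumes "finite S" "S \<subseteq> I" "f \<in> L2 M"
  shows "(\<Sum>i\<in>S. (cmod (l2_inner M (b i) f))\<^sup>2) \<le> (l2_norm M f)\<^sup>2"
  using ortho_residual_norm[OF assms] zero_le_power2[of "l2_norm M (\<lambda>x. f x - (\<Sum>i\<in>S. l2_inner M (b i) f * b i x))"]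
  by linarith

text \<open>The index set may be uncountable, so finite sets are selected outside of which the
  squared coefficients sum to at most \<open>(1/4) ^ n\<close>. The partial sums over them have
  increments of norm at most \<open>(1/2) ^ n\<close>, as \<open>L2_complete_fast\<close> demands.
  The approximation clause is kept for expansions of vectors.\<close>

lemma Riesz_Fischer:
  assumes c: "(\<lambda>i. (cmod (c i))\<^sup>2) summable_on I"
  shows "\<exists>h\<in>L2 M. (\<forall>i\<in>I. l2_inner M (b i) h = c i) \<and>
    (\<forall>\<epsilon>>0. \<exists>S. finite S \<and> S \<subseteq> I \<and> l2_norm M (\<lambda>x. h x - (\<Sum>i\<in>S. c i * b i x)) < \<epsilon>)"
proof -
  define q where "q i = (cmod (c i))\<^sup>2" for i
  have "\<exists>S. finite S \<and> S \<subseteq> I \<and> (\<forall>T. finite T \<and> T \<subseteq> I \<and> T \<inter> S = {} \<longrightarrow> sum q T \<le> (1/4) ^ n)" for n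
  proof -
    have "(0::real) < (1/4) ^ n / 2" by simp
    from infsum_finite_approximation[OF c this]
    obtain S where S: "finite S" "S \<subseteq> I" "dist (sum q S) (infsum q I) \<le> (1/4) ^ n / 2"
      unfolding q_def by auto
    have "sum q T \<le> (1/4) ^ n" if T: "finite T" "T \<subseteq> I" "T \<inter> S = {}" for T
    proof -
      have "sum q S + sum q T = sum q (S \<union> T)"
        using S T by (subst sum.union_disjoint) auto
      also have "\<dots> \<le> infsum q I"
        using S T c by (intro finite_sum_le_infsum) (auto simp: q_def[abs_def])
      finally show ?thesis
        using S(3) zero_le_power[of "1/4::real" n] unfolding dist_real_def by linarith
    qed
    with S(1,2) show ?thesis by (intro exI[of _ S] conjI allI impI) auto
  qed
  then obtain S where S: "\<And>n. finite (S n)" "\<And>n. S n \<subseteq> I"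
      "\<And>n T. finite T \<Longrightarrow> T \<subseteq> I \<Longrightarrow> T \<inter> S n = {} \<Longrightarrow> sum q T \<le> (1/4) ^ n"
    by metis
  \<comment> \<open>The unions are increasing, so that an increment of partial sums is a sum over
    indices outside \<open>S n\<close>.\<close>
  define R where "R n = (\<Union>k\<le>n. S k)" for n
  have R: "finite (R n)" "R n \<subseteq> I" "S n \<subseteq> R n" "R n \<subseteq> R (Suc n)" for n
    using S(1,2) unfolding R_def by (auto simp: le_Suc_eq)
  define u where "u n x = (\<Sum>i\<in>R n. c i * b i x)" for n x
  have u: "u n \<in> L2 M" for n
    using ortho_sum_L2[OF R(2)] by (simp add: u_def[abs_def])
  have "l2_norm M (\<lambda>x. u (Suc n) x - u n x) \<le> (1/2) ^ n" for n
  proof -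
    have "u (Suc n) x - u n x = (\<Sum>i\<in>R (Suc n) - R n. c i * b i x)" for x
      unfolding u_def using R[of n] R(1)[of "Suc n"] by (simp add: sum_diff)
    then have "(l2_norm M (\<lambda>x. u (Suc n) x - u n x))\<^sup>2 = (\<Sum>i\<in>R (Suc n) - R n. (cmod (c i))\<^sup>2)"
      using R[of "Suc n"] by (simp only:) (rule ortho_sum_norm; auto)
    also have "\<dots> \<le> (1/4) ^ n"
      using S(3)[of "R (Suc n) - R n" n] R[of "Suc n"] R(3)[of n] by (auto simp: q_def)
    also have "(1/4::real) ^ n = ((1/2) ^ n)\<^sup>2"
      by (simp add: power2_eq_square flip: power_mult_distrib)
    finally show ?thesis by (rule power2_le_imp_le) simp
  qed
  then obtain h where h: "h \<in> L2 M" "\<And>n. l2_norm M (\<lambda>x. h x - u n x) \<le> 2 * (1/2) ^ n"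
    using L2_complete_fast[of u M] u by blast
  have small: "\<exists>n. C * (1/2) ^ n < \<epsilon>" if "\<epsilon> > 0" "C > 0" for \<epsilon> C :: real
  proof -
    obtain n where "(1/2::real) ^ n < \<epsilon> / C"
      using real_arch_pow_inv[of "\<epsilon> / C" "1/2"] \<open>\<epsilon> > 0\<close> \<open>C > 0\<close> by auto
    then have "C * (1/2) ^ n < \<epsilon>" using \<open>C > 0\<close> by (simp add: pos_less_divide_eq mult.commute)
    then show ?thesis ..
  qed
  have "l2_inner M (b i) h = c i" if i: "i \<in> I" for i
  proof -
    have bi: "b i \<in> L2 M" using ortho i by auto
    \<comment> \<open>Two units come from the distance of \<open>h\<close> to \<open>u n\<close>,
      one from the coefficient \<open>c i\<close> itself in case \<open>i\<close> does not yet
      belong to \<open>R n\<close>.\<close>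
    have "cmod (l2_inner M (b i) h - c i) \<le> 3 * (1/2) ^ n" for n
    proof -
      have "l2_inner M (b i) (u n) = (if i \<in> R n then c i else 0)"
        unfolding u_def by (rule ortho_sum_inner[OF R(1,2) i])
      moreover have "cmod (c i) \<le> (1/2) ^ n" if "i \<notin> R n"
      proof -
        have "(cmod (c i))\<^sup>2 \<le> (1/4) ^ n"
          using S(3)[of "{i}" n] R(3)[of n] that i by (auto simp: q_def)
        also have "(1/4::real) ^ n = ((1/2) ^ n)\<^sup>2"
          by (simp add: power2_eq_square flip: power_mult_distrib)
        finally show ?thesis by (rule power2_le_imp_le) simp
      qed
      ultimately have 1: "cmod (l2_inner M (b i) (u n) - c i) \<le> (1/2) ^ n" by auto
      have "cmod (l2_inner M (b i) (\<lambda>x. h x - u n x)) \<le> l2_norm M (b i) * l2_norm M (\<lambda>x. h x - u n x)"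
        by (rule l2_Cauchy_Schwarz[OF bi L2_diff[OF h(1) u]])
      then have 2: "cmod (l2_inner M (b i) h - l2_inner M (b i) (u n)) \<le> 2 * (1/2) ^ n"
        using h(2)[of n] by (simp add: l2_inner_diff_right bi h(1) u ortho_family_norm[OF ortho i])
      show ?thesis
        using norm_triangle_ineq[of "l2_inner M (b i) h - l2_inner M (b i) (u n)" "l2_inner M (b i) (u n) - c i"] 1 2
        by simp
    qed
    then have "\<not> cmod (l2_inner M (b i) h - c i) > 0"
      using small[of _ 3] by (meson leD zero_less_numeral)
    then show ?thesis by simp
  qed
  moreover have "\<exists>S. finite S \<and> S \<subseteq> I \<and> l2_norm M (\<lambda>x. h x - (\<Sum>i\<in>S. c i * b i x)) < \<epsilon>" if \<epsilon>: "\<epsilon> > 0" for \<epsilon>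
  proof -
    obtain n where "2 * (1/2) ^ n < \<epsilon>" using small[OF \<epsilon>, of 2] by auto
    then show ?thesis
      using h(2)[of n] R(1,2)[of n] unfolding u_def by (intro exI[of _ "R n"]) auto
  qed
  ultimately show ?thesis using h(1) by blast
qed

lemma ortho_coeff_summable:
  assumes "f \<in> L2 M" shows "(\<lambda>i. (cmod (l2_inner M (b i) f))\<^sup>2) summable_on I"
  by (rule nonneg_bounded_partial_sums_imp_summable_on[where C = "(l2_norm M f)\<^sup>2"])
    (auto intro!: eventually_finite_subsets_at_top_weakI Bessel assms)

text \<open>Proved without an adjoint, by testing \<open>f \<mapsto> \<langle>g, T f\<rangle>\<close> on \<open>f = \<Sum>i\<in>S. cnj (a i) * b i\<close> with \<open>a i = \<langle>g, T (b i)\<rangle>\<close>.\<close>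

lemma dual_Bessel:
  assumes T: "bounded_op M T" and C: "\<And>f. f \<in> L2 M \<Longrightarrow> l2_norm M (T f) \<le> C * l2_norm M f" "0 \<le> C"
    and g: "g \<in> L2 M" and S: "finite S" "S \<subseteq> I"
  shows "(\<Sum>i\<in>S. (cmod (l2_inner M g (T (b i))))\<^sup>2) \<le> (C * l2_norm M g)\<^sup>2"
proof -
  define a where "a i = l2_inner M g (T (b i))" for i
  define s where "s = (\<Sum>i\<in>S. (cmod (a i))\<^sup>2)"
  define f where "f x = (\<Sum>i\<in>S. cnj (a i) * b i x)" for x
  have f: "f \<in> L2 M" using ortho_sum_L2[OF S(2)] by (simp add: f_def[abs_def])
  have s0: "0 \<le> s" by (simp add: s_def sum_nonneg)
  have "l2_inner M g (T f) = (\<Sum>i\<in>S. cnj (a i) * a i)"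
    unfolding f_def a_def by (rule l2_inner_op_sum[OF T g]) (use ortho S in auto)
  also have "\<dots> = of_real s"
    unfolding s_def of_real_sum complex_norm_square by (simp add: mult.commute)
  finally have "s = cmod (l2_inner M g (T f))" using s0 by simp
  also have "\<dots> \<le> l2_norm M g * (C * l2_norm M f)"
    using order_trans[OF l2_Cauchy_Schwarz[OF g bounded_op_L2[OF T f]] mult_left_mono[OF C(1)[OF f] l2_norm_nonneg]] .
  also have "l2_norm M f = sqrt s"
  proof -
    have "(l2_norm M f)\<^sup>2 = s"
      unfolding f_def s_def using ortho_sum_norm[OF S, of "\<lambda>i. cnj (a i)"] by simp
    then show ?thesis by (metis l2_norm_nonneg real_sqrt_abs abs_of_nonneg)
  qed
  finally have *: "sqrt s * sqrt s \<le> (C * l2_norm M g) * sqrt s" using s0 by (simp add: mult_ac)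
  have "sqrt s \<le> C * l2_norm M g"
  proof (cases "s = 0")
    case False
    with s0 have "sqrt s > 0" by simp
    with * show ?thesis by (rule mult_right_le_imp_le)
  qed (use C in auto)
  then have "(sqrt s)\<^sup>2 \<le> (C * l2_norm M g)\<^sup>2" using s0 by (intro power_mono) auto
  then show ?thesis using s0 by (simp add: s_def a_def)
qed

end

section \<open>Expansions in an orthonormal basis\<close>

text \<open>Riesz-Fischer applied to the coefficients of \<open>f\<close> returns a vector
  \<open>h\<close> with the same coefficients, hence equal to \<open>f\<close>. One good finite set
  is enough, since enlarging it only decreases the residual.\<close>

lemma basis_expansion:
  assumes b: "basis_family M I b" and f: "f \<in> L2 M" and "\<epsilon> > 0"
  shows "\<exists>S. finite S \<and> S \<subseteq> I \<and> (\<forall>T. finite T \<and> S \<subseteq> T \<and> T \<subseteq> I \<longrightarrow>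
    l2_norm M (\<lambda>x. f x - (\<Sum>i\<in>T. l2_inner M (b i) f * b i x)) < \<epsilon>)"
proof -
  note o = basis_family_ortho[OF b]
  obtain h where h: "h \<in> L2 M" "\<And>i. i \<in> I \<Longrightarrow> l2_inner M (b i) h = l2_inner M (b i) f"
    "\<And>\<epsilon>. \<epsilon> > 0 \<Longrightarrow> \<exists>S. finite S \<and> S \<subseteq> I \<and> l2_norm M (\<lambda>x. h x - (\<Sum>i\<in>S. l2_inner M (b i) f * b i x)) < \<epsilon>"
    using Riesz_Fischer[OF o ortho_coeff_summable[OF o f]] by blast
  have hf: "vec_eq M h f"
    by (rule basis_family_unique[OF b h(1) f h(2)])
  obtain S where S: "finite S" "S \<subseteq> I" "l2_norm M (\<lambda>x. h x - (\<Sum>i\<in>S. l2_inner M (b i) f * b i x)) < \<epsilon>"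
    using h(3)[OF \<open>\<epsilon> > 0\<close>] by blast
  have "l2_norm M (\<lambda>x. f x - (\<Sum>i\<in>S. l2_inner M (b i) f * b i x))
      = l2_norm M (\<lambda>x. h x - (\<Sum>i\<in>S. l2_inner M (b i) f * b i x))"
  proof (rule l2_norm_cong_AE)
    show "vec_eq M (\<lambda>x. f x - (\<Sum>i\<in>S. l2_inner M (b i) f * b i x)) (\<lambda>x. h x - (\<Sum>i\<in>S. l2_inner M (b i) f * b i x))"
      using hf unfolding vec_eq_def by eventually_elim simp
  qed (intro L2_measurable L2_diff f h(1) ortho_sum_L2[OF o S(2)])+
  with S(3) have less: "l2_norm M (\<lambda>x. f x - (\<Sum>i\<in>S. l2_inner M (b i) f * b i x)) < \<epsilon>" by simp
  have "l2_norm M (\<lambda>x. f x - (\<Sum>i\<in>T. l2_inner M (b i) f * b i x)) < \<epsilon>"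
    if T: "finite T" "S \<subseteq> T" "T \<subseteq> I" for T
  proof (rule le_less_trans[OF _ less], rule power2_le_imp_le)
    have "(\<Sum>i\<in>S. (cmod (l2_inner M (b i) f))\<^sup>2) \<le> (\<Sum>i\<in>T. (cmod (l2_inner M (b i) f))\<^sup>2)"
      using T by (intro sum_mono2) auto
    then show "(l2_norm M (\<lambda>x. f x - (\<Sum>i\<in>T. l2_inner M (b i) f * b i x)))\<^sup>2
      \<le> (l2_norm M (\<lambda>x. f x - (\<Sum>i\<in>S. l2_inner M (b i) f * b i x)))\<^sup>2"
      unfolding ortho_residual_norm[OF o T(1,3) f] ortho_residual_norm[OF o S(1,2) f] by simp
  qed simp
  with S(1,2) show ?thesis by blast
qed

text \<open>Partial sums of \<open>f\<close> converge in norm and \<open>T\<close> is continuous.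
  This is the rule by which the basis is inserted between two operators, so that products of
  operators become unconditionally convergent matrix products.\<close>

lemma basis_op_expansion:
  assumes b: "basis_family M I b" and T: "bounded_op M T" and g: "g \<in> L2 M" and f: "f \<in> L2 M"
  shows "((\<lambda>i. l2_inner M (b i) f * l2_inner M g (T (b i))) has_sum l2_inner M g (T f)) I"
  unfolding has_sum_def tendsto_iff eventually_finite_subsets_at_top
proof (intro allI impI)
  fix \<epsilon> :: real assume \<epsilon>: "\<epsilon> > 0"
  note o = basis_family_ortho[OF b]
  obtain C where C: "0 \<le> C" "\<And>f. f \<in> L2 M \<Longrightarrow> l2_norm M (T f) \<le> C * l2_norm M f"
    using bounded_op_bound[OF T] by blast
  \<comment> \<open>The summand 1 only makes the divisor positive.\<close>
  define B where "B = l2_norm M g * C + 1"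
  have B: "B > 0" using C by (simp add: B_def add_nonneg_pos)
  then have "\<epsilon> / B > 0" using \<epsilon> by simp
  from basis_expansion[OF b f this] obtain S where S: "finite S" "S \<subseteq> I"
    and S': "\<forall>R. finite R \<and> S \<subseteq> R \<and> R \<subseteq> I \<longrightarrow>
      l2_norm M (\<lambda>x. f x - (\<Sum>i\<in>R. l2_inner M (b i) f * b i x)) < \<epsilon> / B"
    by (elim exE conjE) (rule that, assumption+)
  show "\<exists>X. finite X \<and> X \<subseteq> I \<and> (\<forall>Y. finite Y \<and> X \<subseteq> Y \<and> Y \<subseteq> I \<longrightarrow>
     dist (\<Sum>i\<in>Y. l2_inner M (b i) f * l2_inner M g (T (b i))) (l2_inner M g (T f)) < \<epsilon>)"
  proof (intro exI[of _ S] conjI allI impI S(1,2), elim conjE)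
    fix R assume R: "finite R" "S \<subseteq> R" "R \<subseteq> I"
    define p where "p x = (\<Sum>i\<in>R. l2_inner M (b i) f * b i x)" for x
    have p: "p \<in> L2 M" using ortho_sum_L2[OF o R(3)] by (simp add: p_def[abs_def])
    have "(\<Sum>i\<in>R. l2_inner M (b i) f * l2_inner M g (T (b i))) = l2_inner M g (T p)"
      unfolding p_def by (rule l2_inner_op_sum[OF T g, symmetric]) (use o R in auto)
    then have "dist (\<Sum>i\<in>R. l2_inner M (b i) f * l2_inner M g (T (b i))) (l2_inner M g (T f))
        = cmod (l2_inner M g (T (\<lambda>x. f x - p x)))"
      by (simp add: dist_norm norm_minus_commute l2_inner_op_diff[OF T g f p])
    also have "\<dots> \<le> l2_norm M g * (C * l2_norm M (\<lambda>x. f x - p x))"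
      using order_trans[OF l2_Cauchy_Schwarz[OF g bounded_op_L2[OF T]] mult_left_mono[OF C(2) l2_norm_nonneg]]
        L2_diff[OF f p] by blast
    also have "\<dots> \<le> B * l2_norm M (\<lambda>x. f x - p x)"
      by (simp add: B_def distrib_right)
    also have "\<dots> < B * (\<epsilon> / B)"
      using S'[rule_format, of R] R B by (intro mult_strict_left_mono) (simp_all add: p_def)
    finally show "dist (\<Sum>i\<in>R. l2_inner M (b i) f * l2_inner M g (T (b i))) (l2_inner M g (T f)) < \<epsilon>"
      using B by simp
  qed
qed

lemma Parseval_inner:
  assumes "basis_family M I b" "g \<in> L2 M" "f \<in> L2 M"
  shows "((\<lambda>i. l2_inner M (b i) f * l2_inner M g (b i)) has_sum l2_inner M g f) I"
  using basis_op_expansion[OF assms(1) bounded_op_id assms(2,3)] by simp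

lemma Parseval:
  assumes "basis_family M I b" "f \<in> L2 M"
  shows "((\<lambda>i. (cmod (l2_inner M (b i) f))\<^sup>2) has_sum (l2_norm M f)\<^sup>2) I"
proof -
  have "l2_inner M (b i) f * l2_inner M f (b i) = of_real ((cmod (l2_inner M (b i) f))\<^sup>2)" for i
    unfolding complex_norm_square by (simp flip: l2_inner_commute)
  then have "((\<lambda>i. complex_of_real ((cmod (l2_inner M (b i) f))\<^sup>2)) has_sum of_real ((l2_norm M f)\<^sup>2)) I"
    using Parseval_inner[OF assms(1,2,2)] by (simp only: l2_inner_self)
  then show ?thesis by (simp only: has_sum_of_real_iff)
qed

text \<open>Supplies the operators behind the choices in \<open>tensor_power_op\<close> and
  \<open>pair_op\<close> without extending anything from a dense subspace: Riesz-Fischer realizes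
  the prescribed coefficients, and linearity of the coefficients becomes linearity of
  \<open>Y\<close> up to null sets.\<close>

lemma bounded_op_from_coefficients:
  assumes b: "basis_family M I b"
    and add: "\<And>i f g. i \<in> I \<Longrightarrow> f \<in> L2 M \<Longrightarrow> g \<in> L2 M \<Longrightarrow> c i (\<lambda>x. f x + g x) = c i f + c i g"
    and mult: "\<And>i f a. i \<in> I \<Longrightarrow> f \<in> L2 M \<Longrightarrow> c i (\<lambda>x. a * f x) = a * c i f"
    and bound: "\<And>S f. finite S \<Longrightarrow> S \<subseteq> I \<Longrightarrow> f \<in> L2 M \<Longrightarrow> (\<Sum>i\<in>S. (cmod (c i f))\<^sup>2) \<le> (C * l2_norm M f)\<^sup>2"
    and C: "0 \<le> C"
  shows "\<exists>Y. bounded_op M Y \<and> (\<forall>f\<in>L2 M. \<forall>i\<in>I. l2_inner M (b i) (Y f) = c i f)"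
proof -
  note o = basis_family_ortho[OF b]
  have "\<exists>h\<in>L2 M. \<forall>i\<in>I. l2_inner M (b i) h = c i f" if f: "f \<in> L2 M" for f
  proof -
    have "(\<lambda>i. (cmod (c i f))\<^sup>2) summable_on I"
      by (rule nonneg_bounded_partial_sums_imp_summable_on[where C = "(C * l2_norm M f)\<^sup>2"])
        (auto intro!: eventually_finite_subsets_at_top_weakI bound f)
    from Riesz_Fischer[OF o this] show ?thesis by blast
  qed
  then obtain Y where Y: "\<And>f. f \<in> L2 M \<Longrightarrow> Y f \<in> L2 M"
      "\<And>f i. f \<in> L2 M \<Longrightarrow> i \<in> I \<Longrightarrow> l2_inner M (b i) (Y f) = c i f"
    by metis
  have "bounded_op M Y"
    unfolding bounded_op_def
  proof (intro conjI ballI allI exI[of _ C])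
    fix f assume f: "f \<in> L2 M"
    show "Y f \<in> L2 M" by (rule Y(1)[OF f])
    show "vec_eq M (Y (\<lambda>x. f x + g x)) (\<lambda>x. Y f x + Y g x)" if g: "g \<in> L2 M" for g
      by (rule basis_family_unique[OF b])
        (auto simp: Y add L2_add f g l2_inner_add_right ortho_family_L2[OF o])
    show "vec_eq M (Y (\<lambda>x. a * f x)) (\<lambda>x. a * Y f x)" for a
      by (rule basis_family_unique[OF b])
        (auto simp: Y mult L2_cmult f l2_inner_cmult_right ortho_family_L2[OF o])
    have "((\<lambda>i. (cmod (c i f))\<^sup>2) has_sum (l2_norm M (Y f))\<^sup>2) I"
      using Parseval[OF b Y(1)[OF f]] by (rule has_sum_cong[THEN iffD1, rotated]) (simp add: Y(2) f)
    then have "(l2_norm M (Y f))\<^sup>2 \<le> (C * l2_norm M f)\<^sup>2"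
      by (rule has_sum_le_finite_sums) (rule bound[OF _ _ f])
    then show "l2_norm M (Y f) \<le> C * l2_norm M f"
      by (rule power2_le_imp_le) (simp add: C)
  qed
  with Y(2) show ?thesis by blast
qed

section \<open>Maximal orthonormal sets\<close>

text \<open>Zorn's lemma on orthonormal subsets of \<open>Q\<close>. With \<open>Q = L2 M\<close> it
  completes an orthonormal set to a basis; with \<open>Q\<close> the set of eigenvectors of \<gamma>
  it yields the candidate for the eigenbasis. Maximality is phrased with unit vectors, so
  \<open>Q\<close> may be any set of vectors.\<close>

lemma maximal_orthonormal_extension:
  assumes D: "D \<subseteq> Q" "ortho_family M D id" and Q: "Q \<subseteq> L2 M"
  shows "\<exists>E. D \<subseteq> E \<and> E \<subseteq> Q \<and> ortho_family M E id \<and>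
    (\<forall>f\<in>Q. (\<forall>e\<in>E. l2_inner M e f = 0) \<longrightarrow> l2_inner M f f \<noteq> 1)"
proof -
  define A where "A = {E. D \<subseteq> E \<and> E \<subseteq> Q \<and> ortho_family M E id}"
  have "\<exists>E\<in>A. \<forall>F\<in>A. E \<subseteq> F \<longrightarrow> F = E"
  proof (rule subset_Zorn_nonempty)
    show "A \<noteq> {}" using D by (auto simp: A_def)
    fix K assume K: "K \<noteq> {}" "subset.chain A K"
    then have KA: "K \<subseteq> A" and lin: "\<And>x y. x \<in> K \<Longrightarrow> y \<in> K \<Longrightarrow> x \<subseteq> y \<or> y \<subseteq> x"
      by (auto simp: subset_chain_def)
    have "ortho_family M (\<Union>K) id"
      unfolding ortho_family_def id_apply
    proof (intro conjI ballI)
      fix e f assume "e \<in> \<Union>K" "f \<in> \<Union>K"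
      then obtain x y where "x \<in> K" "e \<in> x" "y \<in> K" "f \<in> y" by blast
      then obtain z where "z \<in> K" "e \<in> z" "f \<in> z" using lin[of x y] by blast
      then show "l2_inner M e f = (if e = f then 1 else 0)"
        using KA ortho_family_inner[of M z id e f] by (auto simp: A_def)
    qed (use KA Q in \<open>auto simp: A_def\<close>)
    then show "\<Union>K \<in> A" using K(1) KA by (auto simp: A_def)
  qed
  then obtain E where E: "E \<in> A" "\<And>F. F \<in> A \<Longrightarrow> E \<subseteq> F \<Longrightarrow> F = E" by blast
  have "l2_inner M f f \<noteq> 1" if f: "f \<in> Q" "\<forall>e\<in>E. l2_inner M e f = 0" for f
  proof
    assume 1: "l2_inner M f f = 1"
    have 0: "l2_inner M f e = 0" if "e \<in> E" for e
      using l2_inner_commute[of M f e] f(2) that by simp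
    have fE: "f \<notin> E" using f(2) 1 by auto
    have o: "ortho_family M E id" using E(1) by (simp add: A_def)
    have "ortho_family M (insert f E) id"
      using o 1 f fE Q 0 unfolding ortho_family_def by auto
    then have "insert f E \<in> A" using E(1) f(1) by (auto simp: A_def)
    then show False using E(2)[of "insert f E"] fE by auto
  qed
  with E(1) show ?thesis by (auto simp: A_def)
qed

lemma l2_normalize:
  assumes "f \<in> L2 M" "\<not> vec_eq M f (\<lambda>_. 0)"
  shows "l2_inner M (\<lambda>x. of_real (inverse (l2_norm M f)) * f x) (\<lambda>x. of_real (inverse (l2_norm M f)) * f x) = 1"
proof -
  have "l2_norm M f \<noteq> 0" using assms by (simp add: l2_norm_eq_0_iff)
  then show ?thesis
    unfolding l2_inner_cmult_left l2_inner_cmult_right l2_inner_self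
    by (simp add: power2_eq_square field_simps)
qed

lemma orthonormal_basis_extension:
  assumes "ortho_family M D id"
  shows "\<exists>E. D \<subseteq> E \<and> orthonormal_basis M E"
proof -
  have "D \<subseteq> L2 M" using assms by (auto simp: ortho_family_def)
  from maximal_orthonormal_extension[OF this assms order_refl]
  obtain E where E: "D \<subseteq> E" "ortho_family M E id"
    "\<And>f. f \<in> L2 M \<Longrightarrow> \<forall>e\<in>E. l2_inner M e f = 0 \<Longrightarrow> l2_inner M f f \<noteq> 1"
    by blast
  have "vec_eq M f (\<lambda>_. 0)" if f: "f \<in> L2 M" "\<forall>e\<in>E. l2_inner M e f = 0" for f
  proof (rule ccontr)
    assume nz: "\<not> vec_eq M f (\<lambda>_. 0)"
    have "\<forall>e\<in>E. l2_inner M e (\<lambda>x. of_real (inverse (l2_norm M f)) * f x) = 0"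
      using f(2) by (simp only: l2_inner_cmult_right) simp
    from E(3)[OF L2_cmult[OF f(1)] this] l2_normalize[OF f(1) nz] show False by contradiction
  qed
  with E show ?thesis
    unfolding orthonormal_basis_iff basis_family_def by auto
qed

section \<open>The spectral theorem for density operators\<close>

lemma L2_complete:
  fixes u :: "nat \<Rightarrow> 'a \<Rightarrow> complex"
  assumes u: "\<And>k. u k \<in> L2 M"
    and Cauchy: "\<And>\<epsilon>. \<epsilon> > 0 \<Longrightarrow> \<exists>N. \<forall>m\<ge>N. \<forall>n\<ge>N. l2_norm M (\<lambda>x. u m x - u n x) < \<epsilon>"
  shows "\<exists>f\<in>L2 M. (\<lambda>n. l2_norm M (\<lambda>x. f x - u n x)) \<longlonglongrightarrow> 0"
proof -
  have "\<exists>N. \<forall>m\<ge>N. \<forall>n\<ge>N. l2_norm M (\<lambda>x. u m x - u n x) < (1/2) ^ k" for k :: nat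
    by (rule Cauchy) simp
  then obtain N where N: "\<And>k m n. m \<ge> N k \<Longrightarrow> n \<ge> N k \<Longrightarrow> l2_norm M (\<lambda>x. u m x - u n x) < (1/2) ^ k"
    by metis
  \<comment> \<open>Partial sums of \<open>N\<close> are both increasing and at least
    \<open>N k\<close>, so they index a subsequence with geometrically small increments.\<close>
  define r where "r k = (\<Sum>j\<le>k. N j)" for k
  have r: "N k \<le> r k" "r k \<le> r (Suc k)" for k
    unfolding r_def by (auto intro: member_le_sum)
  have "l2_norm M (\<lambda>x. u (r (Suc k)) x - u (r k) x) \<le> (1/2) ^ k" for k
    using N[of k "r (Suc k)" "r k"] r[of k] by simp
  then obtain f where f: "f \<in> L2 M" "\<And>k. l2_norm M (\<lambda>x. f x - u (r k) x) \<le> 2 * (1/2) ^ k"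
    using L2_complete_fast[of "\<lambda>k. u (r k)" M] u by blast
  have "(\<lambda>n. l2_norm M (\<lambda>x. f x - u n x)) \<longlonglongrightarrow> 0"
  proof (rule LIMSEQ_I)
    fix \<epsilon> :: real assume "\<epsilon> > 0"
    \<comment> \<open>Of the three units, two bound the distance from \<open>f\<close> to
      \<open>u (r k)\<close> and one the distance from there to \<open>u n\<close>.\<close>
    then obtain k where k: "(1/2::real) ^ k < \<epsilon> / 3"
      using real_arch_pow_inv[of "\<epsilon> / 3" "1/2"] by auto
    have "l2_norm M (\<lambda>x. f x - u n x) < \<epsilon>" if "n \<ge> r k" for n
      using l2_norm_triangle_diff[OF f(1) u[of "r k"] u[of n]] f(2)[of k] N[of k "r k" n] r(1)[of k] that k
      by simp
    then show "\<exists>no. \<forall>n\<ge>no. norm (l2_norm M (\<lambda>x. f x - u n x) - 0) < \<epsilon>" by auto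
  qed
  with f(1) show ?thesis by blast
qed

lemma bounded_op_funpow: "bounded_op M T \<Longrightarrow> bounded_op M (T ^^ n)"
  by (induction n) auto

lemma selfadjoint_op_inner:
  "selfadjoint_op M T \<Longrightarrow> f \<in> L2 M \<Longrightarrow> g \<in> L2 M \<Longrightarrow> l2_inner M f (T g) = l2_inner M (T f) g"
  by (simp add: selfadjoint_op_def)

lemma selfadjoint_op_funpow:
  assumes T: "bounded_op M T" and sa: "selfadjoint_op M T" and f: "f \<in> L2 M" and g: "g \<in> L2 M"
  shows "l2_inner M f ((T ^^ n) g) = l2_inner M ((T ^^ n) f) g"
  using f
proof (induction n arbitrary: f)
  case (Suc n)
  have "l2_inner M f ((T ^^ Suc n) g) = l2_inner M (T f) ((T ^^ n) g)"
    using selfadjoint_op_inner[OF sa Suc.prems, of "(T ^^ n) g"] bounded_op_L2[OF bounded_op_funpow[OF T] g] by simp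
  also have "\<dots> = l2_inner M ((T ^^ n) (T f)) g"
    by (rule Suc.IH[OF bounded_op_L2[OF T Suc.prems]])
  finally show ?case by (simp add: funpow_swap1)
qed simp

text \<open>This is \<open>\<langle>h, T h\<rangle> \<ge> 0\<close> for \<open>h = f - T f / C\<close>.\<close>

lemma nonneg_op_norm_le:
  assumes T: "bounded_op M T" and sa: "selfadjoint_op M T" and nn: "nonneg_op M T"
    and C: "\<And>f. f \<in> L2 M \<Longrightarrow> l2_norm M (T f) \<le> C * l2_norm M f" "0 < C" and f: "f \<in> L2 M"
  shows "(l2_norm M (T f))\<^sup>2 \<le> C * Re (l2_inner M f (T f))"
proof -
  define t where "t = complex_of_real (inverse C)"
  define g where "g = T f"
  have g: "g \<in> L2 M" unfolding g_def using T f by auto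
  have tg: "(\<lambda>x. t * g x) \<in> L2 M" using g by auto
  have h: "(\<lambda>x. f x - t * g x) \<in> L2 M" by (rule L2_diff[OF f tg])
  have gg: "l2_inner M g (T f) = of_real ((l2_norm M g)\<^sup>2)" "l2_inner M f (T g) = of_real ((l2_norm M g)\<^sup>2)"
    using selfadjoint_op_inner[OF sa f g] by (simp_all only: g_def[symmetric] l2_inner_self)
  have "l2_inner M (\<lambda>x. f x - t * g x) (T (\<lambda>x. f x - t * g x))
     = l2_inner M f (T (\<lambda>x. f x - t * g x)) - t * l2_inner M g (T (\<lambda>x. f x - t * g x))"
    using l2_inner_diff_left[OF bounded_op_L2[OF T h] f tg] by (simp add: l2_inner_cmult_left t_def)
  also have "\<dots> = l2_inner M f (T f) - t * of_real ((l2_norm M g)\<^sup>2)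
      - t * (of_real ((l2_norm M g)\<^sup>2) - t * l2_inner M g (T g))"
    unfolding l2_inner_op_diff[OF T f f tg] l2_inner_op_diff[OF T g f tg]
      l2_inner_op_cmult[OF T f g] l2_inner_op_cmult[OF T g g] gg ..
  finally have "Re (l2_inner M (\<lambda>x. f x - t * g x) (T (\<lambda>x. f x - t * g x)))
     = Re (l2_inner M f (T f) - t * of_real ((l2_norm M g)\<^sup>2)
      - t * (of_real ((l2_norm M g)\<^sup>2) - t * l2_inner M g (T g)))"
    by (rule arg_cong)
  also have "\<dots> = Re (l2_inner M f (T f)) - 2 * inverse C * (l2_norm M g)\<^sup>2 + (inverse C)\<^sup>2 * Re (l2_inner M g (T g))"
    unfolding t_def by (simp add: algebra_simps power2_eq_square del: of_real_inverse of_real_power of_real_mult)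
  finally have "Re (l2_inner M (\<lambda>x. f x - t * g x) (T (\<lambda>x. f x - t * g x)))
     = Re (l2_inner M f (T f)) - 2 * inverse C * (l2_norm M g)\<^sup>2 + (inverse C)\<^sup>2 * Re (l2_inner M g (T g))" .
  moreover have "0 \<le> Re (l2_inner M (\<lambda>x. f x - t * g x) (T (\<lambda>x. f x - t * g x)))"
    using nn h by (simp add: nonneg_op_def)
  moreover have "(inverse C)\<^sup>2 * Re (l2_inner M g (T g)) \<le> inverse C * (l2_norm M g)\<^sup>2"
  proof -
    have "Re (l2_inner M g (T g)) \<le> l2_norm M g * (C * l2_norm M g)"
      using order_trans[OF complex_Re_le_cmod order_trans[OF l2_Cauchy_Schwarz[OF g bounded_op_L2[OF T g]]
          mult_left_mono[OF C(1)[OF g] l2_norm_nonneg]]] .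
    then have "(inverse C)\<^sup>2 * Re (l2_inner M g (T g)) \<le> (inverse C)\<^sup>2 * (l2_norm M g * (C * l2_norm M g))"
      by (rule mult_left_mono) simp
    also have "\<dots> = inverse C * (l2_norm M g)\<^sup>2"
      using C(2) by (simp add: power2_eq_square field_simps)
    finally show ?thesis .
  qed
  ultimately have "inverse C * (l2_norm M g)\<^sup>2 \<le> Re (l2_inner M f (T f))" by simp
  then show ?thesis using C(2) by (simp add: g_def field_simps)
qed

text \<open>The Hilbert-Schmidt norm dominates the operator norm, here only for vectors whose
  coefficients are supported in \<open>J\<close>, so that \<open>t\<close> needs to see no other
  basis vectors.\<close>

lemma basis_op_norm_le:
  assumes b: "basis_family M I b" and T: "bounded_op M T" and f: "f \<in> L2 M"
    and J: "\<And>i. i \<in> I - J \<Longrightarrow> l2_inner M (b i) f = 0"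
    and t: "\<And>S. finite S \<Longrightarrow> S \<subseteq> I \<inter> J \<Longrightarrow> (\<Sum>i\<in>S. (l2_norm M (T (b i)))\<^sup>2) \<le> t"
  shows "(l2_norm M (T f))\<^sup>2 \<le> t * (l2_norm M f)\<^sup>2"
proof -
  note o = basis_family_ortho[OF b]
  \<comment> \<open>Testing against \<open>T f\<close> itself: the expansion and Cauchy-Schwarz for
    sums bound the square of the norm of \<open>g\<close> by that norm times the desired quantity,
    and one factor cancels.\<close>
  define g where "g = T f"
  have g: "g \<in> L2 M" unfolding g_def using T f by auto
  have t0: "0 \<le> t" using t[of "{}"] by simp
  have "norm (l2_inner M g (T f)) \<le> l2_norm M g * (l2_norm M f * sqrt t)"
  proof (rule Lim_norm_ubound)
    show "((\<lambda>S. \<Sum>i\<in>S. l2_inner M (b i) f * l2_inner M g (T (b i))) \<longlongrightarrow> l2_inner M g (T f)) (finite_subsets_at_top I)"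
      using basis_op_expansion[OF b T g f] unfolding has_sum_def .
    show "\<forall>\<^sub>F S in finite_subsets_at_top I.
      norm (\<Sum>i\<in>S. l2_inner M (b i) f * l2_inner M g (T (b i))) \<le> l2_norm M g * (l2_norm M f * sqrt t)"
    proof (rule eventually_finite_subsets_at_top_weakI)
      fix S assume S: "finite S" "S \<subseteq> I"
      have "(\<Sum>i\<in>S. l2_inner M (b i) f * l2_inner M g (T (b i)))
          = (\<Sum>i\<in>S \<inter> J. l2_inner M (b i) f * l2_inner M g (T (b i)))"
        using S J by (intro sum.mono_neutral_right) auto
      also have "norm \<dots> \<le> (\<Sum>i\<in>S \<inter> J. l2_norm M g * (cmod (l2_inner M (b i) f) * l2_norm M (T (b i))))"
      proof (intro order_trans[OF norm_sum] sum_mono)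
        fix i assume "i \<in> S \<inter> J"
        then have "b i \<in> L2 M" using o S by auto
        then have "cmod (l2_inner M g (T (b i))) \<le> l2_norm M g * l2_norm M (T (b i))"
          using T by (intro l2_Cauchy_Schwarz[OF g]) auto
        then have "cmod (l2_inner M (b i) f) * cmod (l2_inner M g (T (b i)))
            \<le> cmod (l2_inner M (b i) f) * (l2_norm M g * l2_norm M (T (b i)))"
          by (rule mult_left_mono) simp
        then show "norm (l2_inner M (b i) f * l2_inner M g (T (b i)))
            \<le> l2_norm M g * (cmod (l2_inner M (b i) f) * l2_norm M (T (b i)))"
          by (simp add: norm_mult mult_ac)
      qed
      also have "\<dots> = l2_norm M g * (\<Sum>i\<in>S \<inter> J. \<bar>cmod (l2_inner M (b i) f)\<bar> * \<bar>l2_norm M (T (b i))\<bar>)"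
        by (simp add: sum_distrib_left)
      also have "\<dots> \<le> l2_norm M g * (l2_norm M f * sqrt t)"
      proof (intro mult_left_mono order_trans[OF L2_set_mult_ineq] mult_mono)
        show "L2_set (\<lambda>i. cmod (l2_inner M (b i) f)) (S \<inter> J) \<le> l2_norm M f"
          unfolding L2_set_def using Bessel[OF o _ _ f, of "S \<inter> J"] S by (intro real_le_lsqrt) auto
        show "L2_set (\<lambda>i. l2_norm M (T (b i))) (S \<inter> J) \<le> sqrt t"
          unfolding L2_set_def using t[of "S \<inter> J"] S by (intro real_sqrt_le_mono) auto
      qed (auto simp: L2_set_nonneg)
      finally show "norm (\<Sum>i\<in>S. l2_inner M (b i) f * l2_inner M g (T (b i))) \<le> l2_norm M g * (l2_norm M f * sqrt t)" .
    qed
  qed simp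
  then have le: "l2_norm M g * l2_norm M g \<le> l2_norm M g * (l2_norm M f * sqrt t)"
    unfolding g_def[symmetric] l2_inner_self by (simp add: power2_eq_square norm_mult)
  have "l2_norm M g \<le> l2_norm M f * sqrt t"
  proof (cases "l2_norm M g = 0")
    case False
    then have "0 < l2_norm M g" using l2_norm_nonneg[of M g] by linarith
    with le show ?thesis by (rule mult_left_le_imp_le)
  qed (use t0 in simp)
  then have "(l2_norm M g)\<^sup>2 \<le> (l2_norm M f * sqrt t)\<^sup>2" by (intro power_mono) auto
  then show ?thesis using t0 by (simp add: g_def power_mult_distrib mult.commute)
qed

text \<open>The inner product of \<open>(T / s)^(2 * m) b\<close> and \<open>(T / s)^(2 * n) b\<close> depends only on \<open>m + n\<close>, so that
  convergence of norms makes the sequence of iterates Cauchy.\<close>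

lemma power_iteration_limit:
  assumes T: "bounded_op M T" and sa: "selfadjoint_op M T" and s: "0 < s" and b: "b \<in> L2 M"
    and le: "\<And>n. l2_norm M ((T ^^ Suc n) b) \<le> s * l2_norm M ((T ^^ n) b)"
    and nz: "\<not> (\<lambda>n. l2_norm M ((T ^^ n) b) / s ^ n) \<longlonglongrightarrow> 0"
  shows "\<exists>g\<in>L2 M. \<not> vec_eq M g (\<lambda>_. 0) \<and> vec_eq M (T (T g)) (\<lambda>x. of_real (s\<^sup>2) * g x) \<and>
    (\<lambda>n. l2_norm M (\<lambda>x. g x - of_real (inverse (s ^ (2 * n))) * (T ^^ (2 * n)) b x)) \<longlonglongrightarrow> 0"
proof -
  define a where "a n = (l2_norm M ((T ^^ n) b) / s ^ n)\<^sup>2" for n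
  have Tn: "(T ^^ n) b \<in> L2 M" for n using bounded_op_funpow[OF T] b by auto
  \<comment> \<open>By \<open>le\<close> the normalized norms decrease, so they converge, and
    \<open>nz\<close> excludes the limit 0.\<close>
  have "decseq (\<lambda>n. l2_norm M ((T ^^ n) b) / s ^ n)"
  proof (rule decseq_SucI)
    show "l2_norm M ((T ^^ Suc n) b) / s ^ Suc n \<le> l2_norm M ((T ^^ n) b) / s ^ n" for n
      using le[of n] s by (simp add: field_simps del: funpow.simps)
  qed
  then obtain l where l: "(\<lambda>n. l2_norm M ((T ^^ n) b) / s ^ n) \<longlonglongrightarrow> l"
    using decseq_convergent[of "\<lambda>n. l2_norm M ((T ^^ n) b) / s ^ n" 0] s by fastforce
  with nz have l0: "l \<noteq> 0" by auto
  have a: "a \<longlonglongrightarrow> l\<^sup>2" unfolding a_def by (intro tendsto_intros l)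
  define u where "u n x = of_real (inverse (s ^ (2 * n))) * (T ^^ (2 * n)) b x" for n x
  have u: "u n \<in> L2 M" for n unfolding u_def using Tn by auto
  have uu: "l2_inner M (u m) (u n) = of_real (a (m + n))" for m n
  proof -
    have "l2_inner M ((T ^^ (2 * m)) b) ((T ^^ (2 * n)) b) = l2_inner M b ((T ^^ (2 * m)) ((T ^^ (2 * n)) b))"
      by (rule selfadjoint_op_funpow[OF T sa b Tn, symmetric])
    also have "(T ^^ (2 * m)) ((T ^^ (2 * n)) b) = (T ^^ (m + n)) ((T ^^ (m + n)) b)"
      by (metis comp_apply funpow_add add.assoc add.commute mult_2)
    also have "l2_inner M b \<dots> = l2_inner M ((T ^^ (m + n)) b) ((T ^^ (m + n)) b)"
      by (rule selfadjoint_op_funpow[OF T sa b Tn])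
    finally have "l2_inner M ((T ^^ (2 * m)) b) ((T ^^ (2 * n)) b) = of_real ((l2_norm M ((T ^^ (m + n)) b))\<^sup>2)"
      by (simp only: l2_inner_self)
    then show ?thesis
      unfolding u_def l2_inner_cmult_left l2_inner_cmult_right a_def
      by (simp add: power_divide power_add power_mult power2_eq_square field_simps)
  qed
  have diff: "(l2_norm M (\<lambda>x. u m x - u n x))\<^sup>2 = a (2 * m) + a (2 * n) - 2 * a (m + n)" for m n
  proof -
    have "l2_inner M (\<lambda>x. u m x - u n x) (\<lambda>x. u m x - u n x) = of_real (a (2 * m) + a (2 * n) - 2 * a (m + n))"
      unfolding l2_inner_diff_left[OF L2_diff[OF u u] u u] l2_inner_diff_right[OF u u u] uu
        mult_2[of m] mult_2[of n] add.commute[of n m] by simp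
    then show ?thesis by (simp only: l2_inner_self of_real_eq_iff)
  qed
  have "\<exists>N. \<forall>m\<ge>N. \<forall>n\<ge>N. l2_norm M (\<lambda>x. u m x - u n x) < \<epsilon>" if \<epsilon>: "\<epsilon> > 0" for \<epsilon>
  proof -
    \<comment> \<open>The right-hand side of \<open>diff\<close> contains four deviations of
      \<open>a\<close> from its limit, counted with multiplicity, while the limits cancel.\<close>
    have "\<epsilon>\<^sup>2 / 4 > 0" using \<epsilon> by simp
    from LIMSEQ_D[OF a this] obtain N where N: "\<And>n. n \<ge> N \<Longrightarrow> \<bar>a n - l\<^sup>2\<bar> < \<epsilon>\<^sup>2 / 4"
      by auto
    have "l2_norm M (\<lambda>x. u m x - u n x) < \<epsilon>" if "m \<ge> N" "n \<ge> N" for m n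
    proof (rule power2_less_imp_less)
      show "(l2_norm M (\<lambda>x. u m x - u n x))\<^sup>2 < \<epsilon>\<^sup>2"
        unfolding diff using N[of "2 * m"] N[of "2 * n"] N[of "m + n"] that by linarith
    qed (use \<epsilon> in simp)
    then show ?thesis by blast
  qed
  from L2_complete[OF u this] obtain g where g: "g \<in> L2 M" "(\<lambda>n. l2_norm M (\<lambda>x. g x - u n x)) \<longlonglongrightarrow> 0"
    by blast
  have "\<not> vec_eq M g (\<lambda>_. 0)"
  proof
    assume g0: "vec_eq M g (\<lambda>_. 0)"
    have "l2_norm M (\<lambda>x. g x - u n x) = l2_norm M (\<lambda>x. 0 - u n x)" for n
      using g0 unfolding vec_eq_def
      by (intro l2_norm_cong_AE L2_measurable L2_diff g(1) u L2_zero) (auto simp: vec_eq_def)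
    then have "l2_norm M (\<lambda>x. g x - u n x) = l2_norm M (u n)" for n
      using l2_norm_minus_commute[of M "\<lambda>_. 0" "u n"] by simp
    then have "(\<lambda>n. (l2_norm M (u n))\<^sup>2) \<longlonglongrightarrow> 0\<^sup>2" using g(2) by (intro tendsto_power) simp
    moreover have "(l2_norm M (u n))\<^sup>2 = a (2 * n)" for n
      using uu[of n n] unfolding l2_inner_self mult_2 using of_real_eq_iff by blast
    ultimately have "(\<lambda>n. a (2 * n)) \<longlonglongrightarrow> 0" by simp
    moreover have "(\<lambda>n. a (2 * n)) \<longlonglongrightarrow> l\<^sup>2"
      by (rule LIMSEQ_subseq_LIMSEQ[OF a, unfolded comp_def]) (simp add: strict_mono_def)
    ultimately show False using l0 LIMSEQ_unique by fastforce
  qed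
  moreover have "vec_eq M (T (T g)) (\<lambda>x. of_real (s\<^sup>2) * g x)"
  proof -
    obtain C where C: "0 \<le> C" "\<And>f. f \<in> L2 M \<Longrightarrow> l2_norm M ((T ^^ 2) f) \<le> C * l2_norm M f"
      using bounded_op_bound[OF bounded_op_funpow[OF T]] by blast
    \<comment> \<open>The defect of the eigenvalue equation. Since \<open>T ^^ 2\<close> maps
      \<open>u n\<close> to \<open>s\<^sup>2\<close> times \<open>u (Suc n)\<close>, it is bounded
      by the distances from \<open>g\<close> to \<open>u n\<close> and \<open>u (Suc n)\<close>,
      which tend to 0.\<close>
    define w where "w x = (T ^^ 2) g x - of_real (s\<^sup>2) * g x" for x
    have sg: "(\<lambda>x. of_real (s\<^sup>2) * f x) \<in> L2 M" if "f \<in> L2 M" for f using that by auto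
    have TT: "(T ^^ 2) f \<in> L2 M" if "f \<in> L2 M" for f using that bounded_op_funpow[OF T] by auto
    have w: "w \<in> L2 M" unfolding w_def by (intro L2_diff TT sg g(1))
    have "l2_norm M w \<le> C * l2_norm M (\<lambda>x. g x - u n x) + s\<^sup>2 * l2_norm M (\<lambda>x. g x - u (Suc n) x)" for n
    proof -
      have "vec_eq M ((T ^^ 2) (u n)) (\<lambda>x. of_real (inverse (s ^ (2 * n))) * (T ^^ 2) ((T ^^ (2 * n)) b) x)"
        unfolding u_def by (rule bounded_op_cmult[OF bounded_op_funpow[OF T] Tn])
      moreover have "of_real (inverse (s ^ (2 * n))) * (T ^^ 2) ((T ^^ (2 * n)) b) x = of_real (s\<^sup>2) * u (Suc n) x" for x
        unfolding u_def using s by (simp add: funpow_add[symmetric] numeral_2_eq_2 power2_eq_square field_simps)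
      ultimately have "vec_eq M ((T ^^ 2) (u n)) (\<lambda>x. of_real (s\<^sup>2) * u (Suc n) x)" by simp
      moreover have "vec_eq M ((T ^^ 2) (\<lambda>x. g x - u n x)) (\<lambda>x. (T ^^ 2) g x - (T ^^ 2) (u n) x)"
        by (rule bounded_op_diff[OF bounded_op_funpow[OF T] g(1) u])
      ultimately have 1: "vec_eq M w (\<lambda>x. (T ^^ 2) (\<lambda>x. g x - u n x) x + of_real (- (s\<^sup>2)) * (g x - u (Suc n) x))"
        unfolding vec_eq_def w_def by eventually_elim (simp add: algebra_simps)
      have 2: "(\<lambda>x. of_real (- (s\<^sup>2)) * (g x - u (Suc n) x)) \<in> L2 M"
        by (intro L2_cmult L2_diff g(1) u)
      have "l2_norm M w = l2_norm M (\<lambda>x. (T ^^ 2) (\<lambda>x. g x - u n x) x + of_real (- (s\<^sup>2)) * (g x - u (Suc n) x))"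
        by (rule l2_norm_cong_AE[OF _ _ 1]; intro L2_measurable w L2_add TT L2_diff g(1) u 2)
      also have "\<dots> \<le> l2_norm M ((T ^^ 2) (\<lambda>x. g x - u n x)) + l2_norm M (\<lambda>x. of_real (- (s\<^sup>2)) * (g x - u (Suc n) x))"
        by (intro l2_norm_triangle TT L2_diff g(1) u 2)
      also have "\<dots> \<le> C * l2_norm M (\<lambda>x. g x - u n x) + s\<^sup>2 * l2_norm M (\<lambda>x. g x - u (Suc n) x)"
        using C(2)[OF L2_diff[OF g(1) u]] by (simp only: l2_norm_cmult norm_of_real) simp
      finally show ?thesis .
    qed
    moreover have "(\<lambda>n. C * l2_norm M (\<lambda>x. g x - u n x) + s\<^sup>2 * l2_norm M (\<lambda>x. g x - u (Suc n) x)) \<longlonglongrightarrow> C * 0 + s\<^sup>2 * 0"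
      by (intro tendsto_intros g(2) LIMSEQ_Suc[OF g(2)])
    ultimately have "l2_norm M w \<le> 0"
      by (intro LIMSEQ_le_const) auto
    then have "vec_eq M w (\<lambda>_. 0)" using l2_norm_eq_0_iff[OF w] l2_norm_nonneg[of M w] by simp
    then show ?thesis unfolding w_def vec_eq_diff_iff by (simp add: numeral_2_eq_2)
  qed
  ultimately show ?thesis using g unfolding u_def by blast
qed

text \<open>Let \<open>s\<close> be the norm of \<open>T\<close> on the complement of \<open>E\<close>. If \<open>(T / s)^n b\<close> tended to 0 for all \<open>b\<close> in \<open>B - E\<close>,
  then so would its Hilbert-Schmidt norm on the complement, by dominated convergence; but this norm is at
  least 1 for \<open>n = 2^k\<close>, since \<open>\<parallel>(T / s)^(2 * n) f\<parallel> \<ge> \<parallel>(T / s)^n f\<parallel>\<^sup>2\<close> for unit vectors \<open>f\<close>.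
  A limit \<open>g\<close> with \<open>T (T g) = s\<^sup>2 g\<close> yields the eigenvector \<open>g\<close> or \<open>T g + s g\<close>.\<close>

lemma eigenvector_in_complement:
  assumes T: "bounded_op M T" and sa: "selfadjoint_op M T"
    and E: "\<And>e. e \<in> E \<Longrightarrow> e \<in> L2 M" "\<And>e. e \<in> E \<Longrightarrow> \<exists>r::real. vec_eq M (T e) (\<lambda>x. of_real r * e x)"
    and B: "basis_family M B id" "E \<subseteq> B" "e0 \<in> B - E"
    and HS: "(\<lambda>b. (l2_norm M (T b))\<^sup>2) summable_on B"
  shows "\<exists>g\<in>L2 M. \<not> vec_eq M g (\<lambda>_. 0) \<and> (\<forall>e\<in>E. l2_inner M e g = 0) \<and>
    (\<exists>r::real. vec_eq M (T g) (\<lambda>x. of_real r * g x))"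
proof -
  note o = basis_family_ortho[OF B(1)]
  define H where "H = {f \<in> L2 M. \<forall>e\<in>E. l2_inner M e f = 0}"
  have HL2: "f \<in> L2 M" if "f \<in> H" for f using that by (simp add: H_def)
  have TH: "T f \<in> H" if f: "f \<in> H" for f
  proof -
    have "l2_inner M e (T f) = 0" if e: "e \<in> E" for e
    proof -
      obtain r :: real where r: "vec_eq M (T e) (\<lambda>x. of_real r * e x)" using E(2)[OF e] by blast
      have "l2_inner M e (T f) = l2_inner M (T e) f"
        by (rule selfadjoint_op_inner[OF sa E(1)[OF e] HL2[OF f]])
      also have "\<dots> = l2_inner M (\<lambda>x. of_real r * e x) f"
        using r E(1)[OF e] HL2[OF f] T by (intro l2_inner_cong_AE) (auto intro!: L2_measurable L2_cmult)
      also have "\<dots> = 0" using f e by (simp add: l2_inner_cmult_left H_def)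
      finally show ?thesis .
    qed
    then show ?thesis using T HL2[OF f] by (auto simp: H_def)
  qed
  have TnH: "(T ^^ n) f \<in> H" if "f \<in> H" for f n
    using that by (induction n) (auto intro: TH)
  have BH: "b \<in> H" if "b \<in> B - E" for b
    using that B(2) ortho_family_inner[OF o] ortho_family_L2[OF o] unfolding H_def
    by (auto simp: subset_iff)
  \<comment> \<open>Vectors of norm 0 contribute the quotient 0 by the convention on division and do
    not disturb the supremum.\<close>
  define s where "s = (SUP f\<in>H. l2_norm M (T f) / l2_norm M f)"
  obtain C where C: "0 \<le> C" "\<And>f. f \<in> L2 M \<Longrightarrow> l2_norm M (T f) \<le> C * l2_norm M f"
    using bounded_op_bound[OF T] by blast
  have ratio_le: "l2_norm M (T f) / l2_norm M f \<le> C" if "f \<in> H" for f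
    using C(2)[OF HL2[OF that]] C(1)
    by (cases "l2_norm M f = 0") (auto simp: divide_le_eq less_le)
  then have bdd: "bdd_above ((\<lambda>f. l2_norm M (T f) / l2_norm M f) ` H)" by (auto simp: bdd_above_def)
  have s_le: "l2_norm M (T f) \<le> s * l2_norm M f" if f: "f \<in> H" for f
  proof (cases "l2_norm M f = 0")
    case True
    then show ?thesis using C(2)[OF HL2[OF f]] by simp
  next
    case False
    then have "0 < l2_norm M f" using l2_norm_nonneg[of M f] by linarith
    moreover have "l2_norm M (T f) / l2_norm M f \<le> s"
      unfolding s_def by (rule cSUP_upper[OF f bdd])
    ultimately show ?thesis by (simp add: divide_le_eq)
  qed
  have e0: "e0 \<in> H" "e0 \<in> L2 M" "l2_norm M e0 = 1"
    using BH[OF B(3)] HL2 ortho_family_norm[OF o, of e0] B(3) by auto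
  have s0: "0 \<le> s" using order_trans[OF l2_norm_nonneg s_le[OF e0(1)]] e0(3) by simp
  show ?thesis
  proof (cases "s = 0")
    case True
    then have "l2_norm M (T e0) = 0" using s_le[OF e0(1)] l2_norm_nonneg[of M "T e0"] by simp
    then have "vec_eq M (T e0) (\<lambda>x. of_real 0 * e0 x)"
      using l2_norm_eq_0_iff[OF bounded_op_L2[OF T e0(2)]] by simp
    moreover have "\<not> vec_eq M e0 (\<lambda>_. 0)" using e0 l2_norm_eq_0_iff[of e0 M] by simp
    ultimately show ?thesis using e0 unfolding H_def by blast
  next
    case False
    with s0 have s: "0 < s" by simp
    have step: "l2_norm M ((T ^^ Suc n) f) \<le> s * l2_norm M ((T ^^ n) f)" if "f \<in> H" for f n
      using s_le[OF TnH[OF that]] by simp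
    have "\<exists>b\<in>B - E. \<not> (\<lambda>n. l2_norm M ((T ^^ n) b) / s ^ n) \<longlonglongrightarrow> 0"
    proof (rule ccontr)
      assume "\<not> ?thesis"
      then have lim: "(\<lambda>n. l2_norm M ((T ^^ n) b) / s ^ n) \<longlonglongrightarrow> 0" if "b \<in> B - E" for b
        using that by blast
      define q where "q n b = (l2_norm M ((T ^^ n) b) / s ^ n)\<^sup>2" for n b
      have q1: "q (Suc n) b \<le> q (Suc 0) b" if "b \<in> H" for n b
      proof (induction n)
        case (Suc n)
        have "q (Suc (Suc n)) b \<le> q (Suc n) b"
          unfolding q_def using step[OF that, of "Suc n"] s
          by (intro power_mono) (simp_all add: field_simps del: funpow.simps)
        with Suc show ?case by linarith
      qed simp
      have "(\<lambda>b. q (Suc 0) b) summable_on B"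
        using summable_on_cmult_right[OF HS, of "inverse (s\<^sup>2)"]
        by (simp add: q_def power_mult_distrib power_inverse divide_inverse mult.commute)
      then have sum1: "(\<lambda>b. q (Suc 0) b) summable_on (B - E)"
        by (rule summable_on_subset) auto
      obtain F where F: "finite F" "F \<subseteq> B - E"
        "dist (sum (q (Suc 0)) F) (infsum (q (Suc 0)) (B - E)) \<le> 1 / 8"
        using infsum_finite_approximation[OF sum1, of "1/8"] by auto
      have "(\<lambda>n. \<Sum>b\<in>F. q n b) \<longlonglongrightarrow> (\<Sum>b\<in>F. 0\<^sup>2)"
        unfolding q_def using F(2) lim by (intro tendsto_intros) auto
      then have "\<forall>\<^sub>F n in sequentially. (\<Sum>b\<in>F. q n b) < 1 / 8"
        by (rule order_tendstoD) simp
      then obtain n0 where n0: "\<And>n. n \<ge> n0 \<Longrightarrow> (\<Sum>b\<in>F. q n b) < 1 / 8"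
        unfolding eventually_sequentially by blast
      \<comment> \<open>A power of two, because \<open>pow\<close> is obtained by repeated doubling;
        at the same time it is at least \<open>n0\<close>.\<close>
      define n :: nat where "n = 2 ^ n0"
      have n: "n \<ge> n0" "n > 0" unfolding n_def using less_exp[of n0] by auto
      \<comment> \<open>In units of \<open>s ^ (2 * n)\<close>: \<open>F\<close> contributes 1/8 by
        the choice of \<open>n\<close>, and the remaining indices contribute 1/8 because there
        \<open>q n\<close> is dominated by \<open>q (Suc 0)\<close>, whose tail is small.\<close>
      have tail: "(\<Sum>b\<in>S. (l2_norm M ((T ^^ n) b))\<^sup>2) \<le> s ^ (2 * n) / 4" if S: "finite S" "S \<subseteq> B - E" for S
      proof -
        have "sum (q n) S \<le> sum (q n) (F \<union> (S - F))"
          using F S by (intro sum_mono2) (auto simp: q_def)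
        also have "\<dots> = sum (q n) F + sum (q n) (S - F)"
          using F S by (intro sum.union_disjoint) auto
        also have "sum (q n) F \<le> 1 / 8" using n0[OF n(1)] by simp
        also have "sum (q n) (S - F) \<le> sum (q (Suc 0)) (S - F)"
        proof (rule sum_mono)
          fix b assume "b \<in> S - F"
          then have "b \<in> H" using S BH by auto
          from q1[OF this, of "n - 1"] show "q n b \<le> q (Suc 0) b" using n(2) by simp
        qed
        also have "sum (q (Suc 0)) (S - F) \<le> 1 / 8"
        proof -
          have "sum (q (Suc 0)) F + sum (q (Suc 0)) (S - F) = sum (q (Suc 0)) (F \<union> (S - F))"
            using F S by (intro sum.union_disjoint[symmetric]) auto
          also have "\<dots> \<le> infsum (q (Suc 0)) (B - E)"
            using F S by (intro finite_sum_le_infsum sum1) (auto simp: q_def)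
          finally show ?thesis using F(3) unfolding dist_real_def by linarith
        qed
        finally have "sum (q n) S \<le> 1 / 4" by simp
        moreover have "sum (q n) S = (\<Sum>b\<in>S. (l2_norm M ((T ^^ n) b))\<^sup>2) / s ^ (2 * n)"
          by (simp add: q_def power_divide sum_divide_distrib power_mult[symmetric] mult.commute)
        ultimately show ?thesis using s by (simp add: field_simps)
      qed
      \<comment> \<open>A vector whose ratio exceeds \<open>c * s\<close> has its norm multiplied by
        more than \<open>s ^ n / 2\<close> under \<open>T ^^ n\<close>. The square of this factor is
        exactly the bound in \<open>tail\<close>, whence the contradiction.\<close>
      define c where "c = root n (1/2)"
      have c: "c < 1" "c ^ n = 1/2" "0 \<le> c"
        unfolding c_def using n(2) by (simp_all add: real_root_lt_1_iff real_root_pow_pos2)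
      have "c * s < s" using c(1) s by simp
      then have "\<exists>f\<in>H. c * s < l2_norm M (T f) / l2_norm M f"
        unfolding s_def using less_cSUP_iff[OF _ bdd, of "c * s"] e0(1) s_def by blast
      then obtain f where f: "f \<in> H" "c * s < l2_norm M (T f) / l2_norm M f" by blast
      have fL: "f \<in> L2 M" by (rule HL2[OF f(1)])
      have "l2_norm M f \<noteq> 0" using f(2) mult_nonneg_nonneg[OF c(3) s0] by auto
      then have fn: "l2_norm M f > 0" using l2_norm_nonneg[of M f] by linarith
      have pow: "(l2_norm M (T f) / l2_norm M f) ^ (2 ^ k) \<le> l2_norm M ((T ^^ (2 ^ k)) f) / l2_norm M f" for k
      proof (induction k)
        case (Suc k)
        define N :: nat where "N = 2 ^ k"
        have TNf: "(T ^^ N) f \<in> L2 M" "(T ^^ (N + N)) f \<in> L2 M"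
          using bounded_op_funpow[OF T] fL by auto
        have "l2_inner M ((T ^^ N) f) ((T ^^ N) f) = l2_inner M f ((T ^^ (N + N)) f)"
          using selfadjoint_op_funpow[OF T sa fL TNf(1), of N] by (simp add: funpow_add)
        then have "(l2_norm M ((T ^^ N) f))\<^sup>2 = cmod (l2_inner M f ((T ^^ (N + N)) f))"
          unfolding l2_inner_self by (metis abs_power2 norm_of_real)
        also have "\<dots> \<le> l2_norm M f * l2_norm M ((T ^^ (N + N)) f)"
          by (rule l2_Cauchy_Schwarz[OF fL TNf(2)])
        finally have 1: "(l2_norm M ((T ^^ N) f) / l2_norm M f)\<^sup>2 \<le> l2_norm M ((T ^^ (N + N)) f) / l2_norm M f"
          using fn by (simp add: power2_eq_square field_simps)
        have "(l2_norm M (T f) / l2_norm M f) ^ (2 ^ Suc k) = ((l2_norm M (T f) / l2_norm M f) ^ N)\<^sup>2"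
          by (simp add: N_def power_mult[symmetric] mult.commute)
        also have "\<dots> \<le> (l2_norm M ((T ^^ N) f) / l2_norm M f)\<^sup>2"
          using Suc by (intro power_mono) (auto simp: N_def)
        finally show ?case using 1 by (simp add: N_def mult_2)
      qed simp
      have "(c * s) ^ n < (l2_norm M (T f) / l2_norm M f) ^ n"
        using f(2) c s n(2) by (intro power_strict_mono) auto
      also have "\<dots> \<le> l2_norm M ((T ^^ n) f) / l2_norm M f" unfolding n_def by (rule pow)
      finally have "s ^ n / 2 * l2_norm M f < l2_norm M ((T ^^ n) f)"
        using fn c(2) by (simp add: power_mult_distrib pos_less_divide_eq)
      then have "(s ^ n / 2 * l2_norm M f)\<^sup>2 < (l2_norm M ((T ^^ n) f))\<^sup>2"
        using s by (intro power_strict_mono) auto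
      also have "\<dots> \<le> s ^ (2 * n) / 4 * (l2_norm M f)\<^sup>2"
      proof (rule basis_op_norm_le[OF B(1) bounded_op_funpow[OF T] fL, where J = "B - E"])
        show "l2_inner M (id e) f = 0" if "e \<in> B - (B - E)" for e using that f(1) by (auto simp: H_def)
        show "(\<Sum>b\<in>S. (l2_norm M ((T ^^ n) (id b)))\<^sup>2) \<le> s ^ (2 * n) / 4"
          if "finite S" "S \<subseteq> B \<inter> (B - E)" for S
          using tail[of S] that by auto
      qed
      also have "\<dots> = (s ^ n / 2 * l2_norm M f)\<^sup>2"
        by (simp add: power_mult_distrib power_divide power_mult[symmetric] mult.commute)
      finally show False by simp
    qed
    then obtain b where b: "b \<in> B - E" "\<not> (\<lambda>n. l2_norm M ((T ^^ n) b) / s ^ n) \<longlonglongrightarrow> 0" by blast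
    have bH: "b \<in> H" by (rule BH[OF b(1)])
    obtain g where g: "g \<in> L2 M" "\<not> vec_eq M g (\<lambda>_. 0)" "vec_eq M (T (T g)) (\<lambda>x. of_real (s\<^sup>2) * g x)"
      "(\<lambda>n. l2_norm M (\<lambda>x. g x - of_real (inverse (s ^ (2 * n))) * (T ^^ (2 * n)) b x)) \<longlonglongrightarrow> 0"
      using power_iteration_limit[OF T sa s HL2[OF bH] step[OF bH] b(2)] by blast
    have gH: "g \<in> H"
    proof -
      have "l2_inner M e g = 0" if e: "e \<in> E" for e
      proof -
        have "cmod (l2_inner M e g) \<le> l2_norm M e * l2_norm M (\<lambda>x. g x - of_real (inverse (s ^ (2 * n))) * (T ^^ (2 * n)) b x)" for n
        proof -
          have Tb: "(T ^^ (2 * n)) b \<in> H" by (rule TnH[OF bH])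
          have cTb: "(\<lambda>x. of_real (inverse (s ^ (2 * n))) * (T ^^ (2 * n)) b x) \<in> L2 M"
            by (rule L2_cmult[OF HL2[OF Tb]])
          have "l2_inner M e (\<lambda>x. g x - of_real (inverse (s ^ (2 * n))) * (T ^^ (2 * n)) b x) = l2_inner M e g"
            unfolding l2_inner_diff_right[OF E(1)[OF e] g(1) cTb] l2_inner_cmult_right
            using Tb e by (simp add: H_def)
          with l2_Cauchy_Schwarz[OF E(1)[OF e] L2_diff[OF g(1) cTb]] show ?thesis by metis
        qed
        then have "cmod (l2_inner M e g) \<le> l2_norm M e * 0"
          by (intro LIMSEQ_le_const[OF tendsto_mult[OF tendsto_const g(4)]]) blast
        then show ?thesis by simp
      qed
      with g(1) show ?thesis by (simp add: H_def)
    qed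
    have Tg: "T g \<in> L2 M" using T g(1) by auto
    \<comment> \<open>From \<open>(T - s) (T + s) g = 0\<close>: either \<open>h\<close> is an
      eigenvector for \<open>s\<close>, or \<open>h\<close> vanishes and \<open>g\<close> is one for
      \<open>- s\<close>.\<close>
    define h where "h x = T g x + of_real s * g x" for x
    have h: "h \<in> L2 M" unfolding h_def by (intro L2_add Tg L2_cmult g(1))
    show ?thesis
    proof (cases "vec_eq M h (\<lambda>_. 0)")
      case True
      then have "vec_eq M (T g) (\<lambda>x. of_real (- s) * g x)"
        unfolding vec_eq_def h_def by eventually_elim (simp add: eq_neg_iff_add_eq_0)
      with g(1,2) gH show ?thesis unfolding H_def by blast
    next
      case False
      have "vec_eq M (T (\<lambda>x. T g x + of_real s * g x)) (\<lambda>x. T (T g) x + T (\<lambda>x. of_real s * g x) x)"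
        by (rule bounded_op_add[OF T Tg L2_cmult[OF g(1)]])
      with bounded_op_cmult[OF T g(1), of "of_real s"] g(3)
      have "vec_eq M (T h) (\<lambda>x. of_real s * h x)"
        unfolding vec_eq_def h_def[abs_def] by eventually_elim (simp add: algebra_simps power2_eq_square)
      moreover have "l2_inner M e h = 0" if "e \<in> E" for e
        unfolding h_def using l2_inner_add_right[OF E(1)[OF that] Tg L2_cmult[OF g(1)]] TH[OF gH] gH that
        by (simp add: H_def l2_inner_cmult_right)
      ultimately show ?thesis using h False by blast
    qed
  qed
qed

section \<open>Diagonalization of density operators\<close>

lemma eigenvalue_of_eq:
  assumes e: "e \<in> L2 M" "l2_inner M e e = 1" and T: "bounded_op M T"
    and r: "vec_eq M (T e) (\<lambda>x. of_real r * e x)"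
  shows "eigenvalue_of M T e = r"
proof -
  have "l2_inner M e (T e) = l2_inner M e (\<lambda>x. of_real r * e x)"
    by (rule l2_inner_cong_right[OF e(1) bounded_op_L2[OF T e(1)] L2_cmult[OF e(1)] r])
  then show ?thesis by (simp add: eigenvalue_of_def l2_inner_cmult_right e(2))
qed

text \<open>By \<open>nonneg_op_norm_le\<close> the squared norms are dominated by a multiple of the
  diagonal elements, whose sum is the trace.\<close>

lemma density_op_Hilbert_Schmidt:
  assumes "density_op M \<gamma>" "orthonormal_basis M B"
  shows "(\<lambda>b. (l2_norm M (\<gamma> b))\<^sup>2) summable_on B"
proof -
  have T: "bounded_op M \<gamma>" and sa: "selfadjoint_op M \<gamma>" and nn: "nonneg_op M \<gamma>" and tr: "has_trace M \<gamma> 1"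
    using assms(1) by (auto simp: density_op_def)
  obtain C0 where C0: "0 \<le> C0" "\<And>f. f \<in> L2 M \<Longrightarrow> l2_norm M (\<gamma> f) \<le> C0 * l2_norm M f"
    using bounded_op_bound[OF T] by blast
  \<comment> \<open>Strict positivity is required since \<open>nonneg_op_norm_le\<close> divides by
    the constant.\<close>
  define C where "C = C0 + 1"
  have C: "0 < C" "l2_norm M (\<gamma> f) \<le> C * l2_norm M f" if "f \<in> L2 M" for f
    using C0(1) add_mono[OF C0(2)[OF that] l2_norm_nonneg[of M f]] by (auto simp: C_def distrib_right)
  have BL: "b \<in> L2 M" if "b \<in> B" for b using assms(2) that by (auto simp: orthonormal_basis_def)
  have "((\<lambda>b. l2_inner M b (\<gamma> b)) has_sum 1) B" using tr assms(2) by (auto simp: has_trace_def)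
  then have "(\<lambda>b. Re (l2_inner M b (\<gamma> b))) summable_on B"
    by (intro summable_on_Re) (rule has_sum_imp_summable)
  then have "(\<lambda>b. C * Re (l2_inner M b (\<gamma> b))) summable_on B" by (rule summable_on_cmult_right)
  then show ?thesis
  proof (rule summable_on_comparison_test)
    show "(l2_norm M (\<gamma> b))\<^sup>2 \<le> C * Re (l2_inner M b (\<gamma> b))" if "b \<in> B" for b
      using nonneg_op_norm_le[OF T sa nn C(2) C(1) BL[OF that]] BL[OF that] by blast
  qed simp
qed

text \<open>A maximal orthonormal set \<open>E\<close> of eigenvectors is completed to a basis
  \<open>B\<close>. A member of \<open>B\<close> outside \<open>E\<close> shows that the complement
  of \<open>E\<close> is nontrivial, and a normalized eigenvector found there would contradict
  maximality.\<close>

lemma density_op_eigenbasis_ex: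
  assumes "density_op M \<gamma>"
  shows "\<exists>E. orthonormal_basis M E \<and> (\<forall>e\<in>E. vec_eq M (\<gamma> e) (\<lambda>x. complex_of_real (eigenvalue_of M \<gamma> e) * e x))"
proof -
  have T: "bounded_op M \<gamma>" and sa: "selfadjoint_op M \<gamma>"
    using assms by (auto simp: density_op_def)
  define Q where "Q = {f \<in> L2 M. \<exists>r::real. vec_eq M (\<gamma> f) (\<lambda>x. of_real r * f x)}"
  obtain E where E: "E \<subseteq> Q" "ortho_family M E id"
    "\<And>f. f \<in> Q \<Longrightarrow> \<forall>e\<in>E. l2_inner M e f = 0 \<Longrightarrow> l2_inner M f f \<noteq> 1"
    using maximal_orthonormal_extension[of "{}" Q M] by (auto simp: Q_def ortho_family_def)
  obtain B where B: "E \<subseteq> B" "orthonormal_basis M B"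
    using orthonormal_basis_extension[OF E(2)] by blast
  have "B \<subseteq> E"
  proof (rule ccontr)
    assume "\<not> B \<subseteq> E"
    then obtain e0 where e0: "e0 \<in> B - E" by blast
    have EL: "e \<in> L2 M" "\<exists>r::real. vec_eq M (\<gamma> e) (\<lambda>x. of_real r * e x)" if "e \<in> E" for e
      using E(1) that by (auto simp: Q_def)
    obtain g and r :: real where g: "g \<in> L2 M" "\<not> vec_eq M g (\<lambda>_. 0)" "\<forall>e\<in>E. l2_inner M e g = 0"
      and r: "vec_eq M (\<gamma> g) (\<lambda>x. of_real r * g x)"
      using eigenvector_in_complement[OF T sa EL _ B(1) e0 density_op_Hilbert_Schmidt[OF assms B(2)]]
        B(2) by (auto simp: orthonormal_basis_iff)
    define k where "k = complex_of_real (inverse (l2_norm M g))"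
    have "vec_eq M (\<gamma> (\<lambda>x. k * g x)) (\<lambda>x. of_real r * (k * g x))"
      using bounded_op_cmult[OF T g(1), of k] r unfolding vec_eq_def by eventually_elim simp
    then have "(\<lambda>x. k * g x) \<in> Q" using g(1) by (auto simp: Q_def)
    moreover have "\<forall>e\<in>E. l2_inner M e (\<lambda>x. k * g x) = 0"
      using g(3) by (simp add: l2_inner_cmult_right)
    ultimately have "l2_inner M (\<lambda>x. k * g x) (\<lambda>x. k * g x) \<noteq> 1" by (rule E(3))
    then show False using l2_normalize[OF g(1,2)] by (simp add: k_def)
  qed
  with B have ON: "orthonormal_basis M E" by simp
  moreover have "vec_eq M (\<gamma> e) (\<lambda>x. complex_of_real (eigenvalue_of M \<gamma> e) * e x)" if e: "e \<in> E" for e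
  proof -
    obtain r :: real where r: "vec_eq M (\<gamma> e) (\<lambda>x. of_real r * e x)" using E(1) e by (auto simp: Q_def)
    have "e \<in> L2 M" "l2_inner M e e = 1" using ON e by (auto simp: orthonormal_basis_def)
    from eigenvalue_of_eq[OF this T r] r show ?thesis by simp
  qed
  ultimately show ?thesis by blast
qed

text \<open>The choice in \<open>eigenbasis\<close> is hereby justified, and with it the meaning of
  \<open>log_op\<close> and \<open>one_body_density\<close>.\<close>

lemma
  assumes "density_op M \<gamma>"
  shows eigenbasis_orthonormal: "orthonormal_basis M (eigenbasis M \<gamma>)"
    and eigenbasis_eigenvector:
      "\<And>e. e \<in> eigenbasis M \<gamma> \<Longrightarrow> vec_eq M (\<gamma> e) (\<lambda>x. complex_of_real (eigenvalue_of M \<gamma> e) * e x)"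
  using someI_ex[OF density_op_eigenbasis_ex[OF assms]] unfolding eigenbasis_def by blast+

section \<open>Traces against a diagonal operator\<close>

lemma summable_on_norm_bound:
  fixes f :: "'i \<Rightarrow> 'b::banach"
  assumes "\<And>S. finite S \<Longrightarrow> S \<subseteq> I \<Longrightarrow> (\<Sum>i\<in>S. norm (f i)) \<le> B"
  shows "f summable_on I"
  by (rule abs_summable_summable, subst abs_summable_iff_bdd_above)
    (auto intro!: bdd_aboveI2 assms)

lemma has_sum_eq_trans:
  "(f has_sum s) A \<Longrightarrow> (\<And>x. x \<in> A \<Longrightarrow> f x = g x) \<Longrightarrow> s = t \<Longrightarrow> (g has_sum t) A"
  using has_sum_cong[of A f g] by auto

text \<open>The double series converges absolutely by \<open>|q r| \<le> (|q|\<^sup>2 + |r|\<^sup>2) / 2\<close>.\<close>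

lemma weighted_sum_swap:
  fixes w :: "'k \<Rightarrow> real" and q r :: "'k \<Rightarrow> 'e \<Rightarrow> complex"
  assumes w: "\<And>k. k \<in> K \<Longrightarrow> 0 \<le> w k" "w summable_on K"
    and q: "\<And>k S. k \<in> K \<Longrightarrow> finite S \<Longrightarrow> S \<subseteq> E \<Longrightarrow> (\<Sum>e\<in>S. (cmod (q k e))\<^sup>2) \<le> A"
    and r: "\<And>k S. k \<in> K \<Longrightarrow> finite S \<Longrightarrow> S \<subseteq> E \<Longrightarrow> (\<Sum>e\<in>S. (cmod (r k e))\<^sup>2) \<le> B"
    and s: "\<And>e. e \<in> E \<Longrightarrow> ((\<lambda>k. of_real (w k) * (q k e * r k e)) has_sum s e) K"
    and t: "\<And>k. k \<in> K \<Longrightarrow> ((\<lambda>e. q k e * r k e) has_sum t k) E"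
  shows "\<exists>z. (s has_sum z) E \<and> ((\<lambda>k. of_real (w k) * t k) has_sum z) K"
proof -
  define f where "f = (\<lambda>(k, e). of_real (w k) * (q k e * r k e))"
  have "f summable_on K \<times> E"
  proof (rule summable_on_norm_bound)
    fix X assume X: "finite X" "X \<subseteq> K \<times> E"
    define Y Z where "Y = fst ` X" and "Z = snd ` X"
    have YZ: "finite Y" "Y \<subseteq> K" "finite Z" "Z \<subseteq> E" "X \<subseteq> Y \<times> Z"
      using X by (auto simp: Y_def Z_def image_iff) (force, force)
    have "(\<Sum>x\<in>X. norm (f x)) \<le> (\<Sum>x\<in>Y \<times> Z. norm (f x))"
      using YZ by (intro sum_mono2) auto
    also have "\<dots> = (\<Sum>k\<in>Y. \<Sum>e\<in>Z. norm (f (k, e)))"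
      by (simp add: sum.cartesian_product)
    also have "\<dots> \<le> (\<Sum>k\<in>Y. w k * ((A + B) / 2))"
    proof (rule sum_mono)
      fix k assume "k \<in> Y"
      then have k: "k \<in> K" using YZ by auto
      have "(\<Sum>e\<in>Z. norm (f (k, e))) = w k * (\<Sum>e\<in>Z. cmod (q k e) * cmod (r k e))"
        using w(1)[OF k] by (simp add: f_def norm_mult sum_distrib_left)
      also have "\<dots> \<le> w k * (\<Sum>e\<in>Z. ((cmod (q k e))\<^sup>2 + (cmod (r k e))\<^sup>2) / 2)"
      proof (intro mult_left_mono sum_mono w(1)[OF k])
        show "cmod (q k e) * cmod (r k e) \<le> ((cmod (q k e))\<^sup>2 + (cmod (r k e))\<^sup>2) / 2" for e
          using sum_squares_bound[of "cmod (q k e)" "cmod (r k e)"] by simp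
      qed
      also have "\<dots> = w k * (((\<Sum>e\<in>Z. (cmod (q k e))\<^sup>2) + (\<Sum>e\<in>Z. (cmod (r k e))\<^sup>2)) / 2)"
        unfolding sum.distrib[symmetric] sum_divide_distrib ..
      also have "\<dots> \<le> w k * ((A + B) / 2)"
        using q[OF k YZ(3,4)] r[OF k YZ(3,4)] by (intro mult_left_mono w(1)[OF k]) simp
      finally show "(\<Sum>e\<in>Z. norm (f (k, e))) \<le> w k * ((A + B) / 2)" .
    qed
    also have "\<dots> = (\<Sum>k\<in>Y. w k) * ((A + B) / 2)" by (simp add: sum_distrib_right)
    also have "\<dots> \<le> infsum w K * ((A + B) / 2)"
    \<comment> \<open>That \<open>A + B\<close> is nonnegative is seen only by testing the
      hypotheses on some member of \<open>K\<close>.\<close>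
    proof (cases "K = {}")
      case False
      then obtain k where "k \<in> K" by blast
      then have "0 \<le> A + B" using q[of k "{}"] r[of k "{}"] by simp
      then show ?thesis
        using YZ w by (intro mult_right_mono finite_sum_le_infsum) auto
    qed (use YZ in auto)
    finally show "(\<Sum>x\<in>X. norm (f x)) \<le> infsum w K * ((A + B) / 2)" .
  qed
  then obtain z where z: "(f has_sum z) (K \<times> E)" by (auto simp: summable_on_def)
  have "((\<lambda>k. of_real (w k) * t k) has_sum z) K"
    by (rule has_sum_SigmaD[OF z]) (auto simp: f_def intro!: has_sum_cmult_right t)
  moreover have "(s has_sum z) E"
    by (rule has_sum_SigmaD[OF has_sum_swap[THEN iffD1, OF z]]) (auto simp: f_def s)
  ultimately show ?thesis by blast
qed

text \<open>Transports the trace from the eigenbasis of \<open>G\<close> to an arbitrary basis.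
  Inserting \<open>b\<close> between \<open>G\<close> and \<open>A\<close> gives a double sum over
  \<open>e\<close> and \<open>k\<close>; after the exchange, the sum over \<open>e\<close> is the
  expansion of the diagonal element of \<open>A\<close> at \<open>b k\<close>. Bessel and
  \<open>dual_Bessel\<close> provide the two square-summable factors.\<close>

lemma has_trace_diagonal:
  assumes b: "basis_family M K b" and G: "bounded_op M G" and A: "bounded_op M A"
    and w: "\<And>k. k \<in> K \<Longrightarrow> 0 \<le> w k" "w summable_on K"
    and diag: "\<And>f k. f \<in> L2 M \<Longrightarrow> k \<in> K \<Longrightarrow> l2_inner M f (G (b k)) = of_real (w k) * l2_inner M f (b k)"
    and z: "((\<lambda>k. of_real (w k) * l2_inner M (b k) (A (b k))) has_sum z) K"
  shows "has_trace M (G \<circ> A) z"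
  unfolding has_trace_def
proof (intro allI impI)
  fix E assume "orthonormal_basis M E"
  then have E: "basis_family M E id" by (simp add: orthonormal_basis_iff)
  note oE = basis_family_ortho[OF E] and ob = basis_family_ortho[OF b]
  have bL: "b k \<in> L2 M" if "k \<in> K" for k using ob that by auto
  have eL: "e \<in> L2 M" if "e \<in> E" for e using ortho_family_L2[OF oE that] by simp
  obtain C where C: "0 \<le> C" "\<And>f. f \<in> L2 M \<Longrightarrow> l2_norm M (A f) \<le> C * l2_norm M f"
    using bounded_op_bound[OF A] by blast
  have "\<exists>z. ((\<lambda>e. l2_inner M e ((G \<circ> A) e)) has_sum z) E \<and>
      ((\<lambda>k. of_real (w k) * l2_inner M (b k) (A (b k))) has_sum z) K"
  proof (rule weighted_sum_swap[OF w, where q = "\<lambda>k e. l2_inner M e (b k)" and r = "\<lambda>k e. l2_inner M (b k) (A e)"])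
    fix k S assume k: "k \<in> K" and S: "finite S" "S \<subseteq> E"
    show "(\<Sum>e\<in>S. (cmod (l2_inner M e (b k)))\<^sup>2) \<le> 1\<^sup>2"
      using Bessel[OF oE S bL[OF k]] by (simp add: ortho_family_norm[OF ob k])
    show "(\<Sum>e\<in>S. (cmod (l2_inner M (b k) (A e)))\<^sup>2) \<le> (C * 1)\<^sup>2"
      using dual_Bessel[OF oE A C(2,1) bL[OF k] S] by (simp add: ortho_family_norm[OF ob k])
  next
    fix e assume e: "e \<in> E"
    have "((\<lambda>k. l2_inner M (b k) (A e) * l2_inner M e (G (b k))) has_sum l2_inner M e (G (A e))) K"
      by (rule basis_op_expansion[OF b G eL[OF e] bounded_op_L2[OF A eL[OF e]]])
    then show "((\<lambda>k. of_real (w k) * (l2_inner M e (b k) * l2_inner M (b k) (A e))) has_sum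
        l2_inner M e ((G \<circ> A) e)) K"
      by (rule has_sum_eq_trans) (simp_all add: diag eL e)
  next
    fix k assume k: "k \<in> K"
    show "((\<lambda>e. l2_inner M e (b k) * l2_inner M (b k) (A e)) has_sum l2_inner M (b k) (A (b k))) E"
      using basis_op_expansion[OF E A bL[OF k] bL[OF k]] by simp
  qed
  then show "((\<lambda>e. l2_inner M e ((G \<circ> A) e)) has_sum z) E"
    using has_sum_unique[OF z] by blast
qed

section \<open>Operators acting trivially on a tensor factor\<close>

text \<open>The basis is indexed by pairs \<open>(e, \<mu>)\<close>, with \<open>e\<close> labelling the distinguished tensor factor.
  A block operator has the form \<open>1 \<otimes> Y\<close>.\<close>

definition block_op ::
  "'a measure \<Rightarrow> 'e set \<Rightarrow> 'k set \<Rightarrow> ('e \<times> 'k \<Rightarrow> 'a \<Rightarrow> complex) \<Rightarrow> 'a operator \<Rightarrow> bool" where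
  "block_op M E K b Y \<longleftrightarrow> bounded_op M Y \<and> (\<exists>y. \<forall>e\<in>E. \<forall>e'\<in>E. \<forall>\<mu>\<in>K. \<forall>\<nu>\<in>K.
     l2_inner M (b (e, \<mu>)) (Y (b (e', \<nu>))) = (if e = e' then y \<mu> \<nu> else 0))"

lemma block_op_id: 
  assumes "basis_family M (E \<times> K) b" shows "block_op M E K b id"
  unfolding block_op_def
  using ortho_family_inner[OF basis_family_ortho[OF assms]]
  by (auto intro!: exI[of _ "\<lambda>\<mu> \<nu>. if \<mu> = \<nu> then 1 else 0"])

lemma has_sum_slice:
  fixes f :: "'e \<times> 'k \<Rightarrow> complex"
  assumes "e \<in> E" "\<And>e' k. e' \<in> E \<Longrightarrow> e' \<noteq> e \<Longrightarrow> k \<in> K \<Longrightarrow> f (e', k) = 0"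
  shows "(f has_sum s) (E \<times> K) \<longleftrightarrow> ((\<lambda>k. f (e, k)) has_sum s) K"
proof -
  have "(f has_sum s) (E \<times> K) \<longleftrightarrow> (f has_sum s) (Pair e ` K)"
    using assms by (intro has_sum_cong_neutral) auto
  also have "\<dots> \<longleftrightarrow> ((f \<circ> Pair e) has_sum s) K"
    by (rule has_sum_reindex) (simp add: inj_on_def)
  finally show ?thesis by (simp add: comp_def)
qed

text \<open>Matrix multiplication block by block: with the basis inserted between \<open>Y\<close>
  and \<open>Z\<close>, only the block of \<open>e\<close> survives, and the resulting entry no
  longer mentions \<open>e\<close>.\<close>

lemma block_op_comp:
  assumes b: "basis_family M (E \<times> K) b" and Y: "block_op M E K b Y" and Z: "block_op M E K b Z"
  shows "block_op M E K b (Y \<circ> Z)"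
proof -
  have bY: "bounded_op M Y" and bZ: "bounded_op M Z" using Y Z by (auto simp: block_op_def)
  obtain y where y: "\<And>e e' \<mu> \<nu>. e \<in> E \<Longrightarrow> e' \<in> E \<Longrightarrow> \<mu> \<in> K \<Longrightarrow> \<nu> \<in> K \<Longrightarrow>
      l2_inner M (b (e, \<mu>)) (Y (b (e', \<nu>))) = (if e = e' then y \<mu> \<nu> else 0)"
    using Y unfolding block_op_def by blast
  obtain z where z: "\<And>e e' \<mu> \<nu>. e \<in> E \<Longrightarrow> e' \<in> E \<Longrightarrow> \<mu> \<in> K \<Longrightarrow> \<nu> \<in> K \<Longrightarrow>
      l2_inner M (b (e, \<mu>)) (Z (b (e', \<nu>))) = (if e = e' then z \<mu> \<nu> else 0)"
    using Z unfolding block_op_def by blast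
  have bL: "b (e, \<mu>) \<in> L2 M" if "e \<in> E" "\<mu> \<in> K" for e \<mu>
    using ortho_family_L2[OF basis_family_ortho[OF b]] that by auto
  have "l2_inner M (b (e, \<mu>)) ((Y \<circ> Z) (b (e', \<nu>))) = (if e = e' then infsum (\<lambda>\<kappa>. z \<kappa> \<nu> * y \<mu> \<kappa>) K else 0)"
    if i: "e \<in> E" "e' \<in> E" "\<mu> \<in> K" "\<nu> \<in> K" for e e' \<mu> \<nu>
  proof -
    have "((\<lambda>k. l2_inner M (b k) (Z (b (e', \<nu>))) * l2_inner M (b (e, \<mu>)) (Y (b k))) has_sum
        l2_inner M (b (e, \<mu>)) (Y (Z (b (e', \<nu>))))) (E \<times> K)"
      by (rule basis_op_expansion[OF b bY bL[OF i(1,3)] bounded_op_L2[OF bZ bL[OF i(2,4)]]])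
    then have "((\<lambda>k. l2_inner M (b (e, k)) (Z (b (e', \<nu>))) * l2_inner M (b (e, \<mu>)) (Y (b (e, k)))) has_sum
        l2_inner M (b (e, \<mu>)) (Y (Z (b (e', \<nu>))))) K"
      by (subst (asm) has_sum_slice[OF i(1)]) (auto simp: y i)
    then have *: "((\<lambda>\<kappa>. (if e = e' then z \<kappa> \<nu> else 0) * y \<mu> \<kappa>) has_sum
        l2_inner M (b (e, \<mu>)) (Y (Z (b (e', \<nu>))))) K"
      by (rule has_sum_eq_trans) (simp_all add: y z i)
    show ?thesis
    proof (cases "e = e'")
      case True
      with * show ?thesis by (simp add: infsumI)
    next
      case False
      with * have "((\<lambda>\<kappa>. 0) has_sum l2_inner M (b (e, \<mu>)) (Y (Z (b (e', \<nu>))))) K" by simp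
      then show ?thesis using False has_sum_unique[OF has_sum_0_simp] by fastforce
    qed
  qed
  then show ?thesis
    unfolding block_op_def using bounded_op_comp[OF bY bZ]
    by (intro conjI exI[of _ "\<lambda>\<mu> \<nu>. infsum (\<lambda>\<kappa>. z \<kappa> \<nu> * y \<mu> \<kappa>) K"]) auto
qed

lemma sum_slice_le:
  fixes f :: "'e \<times> 'k \<Rightarrow> real"
  assumes "\<And>S. finite S \<Longrightarrow> S \<subseteq> E \<times> K \<Longrightarrow> sum f S \<le> C" "e \<in> E" "finite S" "S \<subseteq> K"
  shows "(\<Sum>k\<in>S. f (e, k)) \<le> C"
proof -
  have "sum f (Pair e ` S) \<le> C" using assms by (intro assms(1)) auto
  then show ?thesis by (subst (asm) sum.reindex) (auto simp: inj_on_def)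
qed

text \<open>The blocks of \<open>P\<close> and \<open>Q\<close> do not depend on \<open>e\<close>,
  so the weighted sum over \<open>e\<close> can be drawn past them onto \<open>X\<close>, where it
  vanishes. This is done in two exchanges: first for \<open>P\<close> and \<open>X\<close>, then for
  \<open>P \<circ> X\<close> and \<open>Q\<close>.\<close>

lemma partial_trace_block_zero:
  assumes b: "basis_family M (E \<times> K) b" and P: "block_op M E K b P" and Q: "block_op M E K b Q"
    and X: "bounded_op M X"
    and w: "\<And>e. e \<in> E \<Longrightarrow> 0 \<le> w e" "w summable_on E"
    and zero: "\<And>\<mu> \<nu>. \<mu> \<in> K \<Longrightarrow> \<nu> \<in> K \<Longrightarrow>
      ((\<lambda>e. of_real (w e) * l2_inner M (b (e, \<mu>)) (X (b (e, \<nu>)))) has_sum 0) E"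
    and \<kappa>: "\<kappa> \<in> K"
  shows "((\<lambda>e. of_real (w e) * l2_inner M (b (e, \<kappa>)) (P (X (Q (b (e, \<kappa>)))))) has_sum 0) E"
proof -
  have bP: "bounded_op M P" and bQ: "bounded_op M Q" using P Q by (auto simp: block_op_def)
  obtain p where p: "\<And>e e' \<mu> \<nu>. e \<in> E \<Longrightarrow> e' \<in> E \<Longrightarrow> \<mu> \<in> K \<Longrightarrow> \<nu> \<in> K \<Longrightarrow>
      l2_inner M (b (e, \<mu>)) (P (b (e', \<nu>))) = (if e = e' then p \<mu> \<nu> else 0)"
    using P unfolding block_op_def by blast
  obtain q where q: "\<And>e e' \<mu> \<nu>. e \<in> E \<Longrightarrow> e' \<in> E \<Longrightarrow> \<mu> \<in> K \<Longrightarrow> \<nu> \<in> K \<Longrightarrow>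
      l2_inner M (b (e, \<mu>)) (Q (b (e', \<nu>))) = (if e = e' then q \<mu> \<nu> else 0)"
    using Q unfolding block_op_def by blast
  note o = basis_family_ortho[OF b]
  have bL: "b (e, \<mu>) \<in> L2 M" if "e \<in> E" "\<mu> \<in> K" for e \<mu>
    using ortho_family_L2[OF o] that by auto
  have bn: "l2_norm M (b (e, \<mu>)) = 1" if "e \<in> E" "\<mu> \<in> K" for e \<mu>
    using ortho_family_norm[OF o] that by auto
  \<comment> \<open>Rows come from \<open>dual_Bessel\<close> and columns from Bessel. What matters
    is uniformity in \<open>e\<close>, the weighted index in
    \<open>weighted_sum_swap\<close>.\<close>
  have row: "\<exists>C. \<forall>e\<in>E. \<forall>\<mu>\<in>K. \<forall>S. finite S \<and> S \<subseteq> K \<longrightarrow>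
      (\<Sum>\<nu>\<in>S. (cmod (l2_inner M (b (e, \<mu>)) (T (b (e, \<nu>)))))\<^sup>2) \<le> C" if T: "bounded_op M T" for T
  proof -
    obtain C where C: "0 \<le> C" "\<And>f. f \<in> L2 M \<Longrightarrow> l2_norm M (T f) \<le> C * l2_norm M f"
      using bounded_op_bound[OF T] by blast
    have "(\<Sum>\<nu>\<in>S. (cmod (l2_inner M (b (e, \<mu>)) (T (b (e, \<nu>)))))\<^sup>2) \<le> C\<^sup>2"
      if i: "e \<in> E" "\<mu> \<in> K" "finite S" "S \<subseteq> K" for e \<mu> S
      using dual_Bessel[OF o T C(2,1) bL[OF i(1,2)]] bn[OF i(1,2)]
      by (intro sum_slice_le[where E = E and K = K and f = "\<lambda>k. (cmod (l2_inner M (b (e, \<mu>)) (T (b k))))\<^sup>2"] i) auto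
    then show ?thesis by blast
  qed
  have col: "\<exists>C. \<forall>e\<in>E. \<forall>\<nu>\<in>K. \<forall>S. finite S \<and> S \<subseteq> K \<longrightarrow>
      (\<Sum>\<mu>\<in>S. (cmod (l2_inner M (b (e, \<mu>)) (T (b (e, \<nu>)))))\<^sup>2) \<le> C" if T: "bounded_op M T" for T
  proof -
    obtain C where C: "0 \<le> C" "\<And>f. f \<in> L2 M \<Longrightarrow> l2_norm M (T f) \<le> C * l2_norm M f"
      using bounded_op_bound[OF T] by blast
    have "(\<Sum>\<mu>\<in>S. (cmod (l2_inner M (b (e, \<mu>)) (T (b (e, \<nu>)))))\<^sup>2) \<le> C\<^sup>2"
      if i: "e \<in> E" "\<nu> \<in> K" "finite S" "S \<subseteq> K" for e \<nu> S
    proof (rule sum_slice_le[where E = E and K = K and f = "\<lambda>k. (cmod (l2_inner M (b k) (T (b (e, \<nu>)))))\<^sup>2"])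
      have TL: "T (b (e, \<nu>)) \<in> L2 M" using T bL[OF i(1,2)] by auto
      have "(l2_norm M (T (b (e, \<nu>))))\<^sup>2 \<le> C\<^sup>2"
        using C(2)[OF bL[OF i(1,2)]] bn[OF i(1,2)] by (intro power_mono) auto
      then show "(\<Sum>k\<in>S. (cmod (l2_inner M (b k) (T (b (e, \<nu>)))))\<^sup>2) \<le> C\<^sup>2"
        if "finite S" "S \<subseteq> E \<times> K" for S
        using Bessel[OF o that TL] by linarith
    qed (use i in auto)
    then show ?thesis by blast
  qed
  have PX: "bounded_op M (P \<circ> X)" by (rule bounded_op_comp[OF bP X])
  have PXzero: "((\<lambda>e. of_real (w e) * l2_inner M (b (e, \<kappa>)) (P (X (b (e, \<nu>))))) has_sum 0) E"
    if \<nu>: "\<nu> \<in> K" for \<nu>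
  proof -
    from row[OF bP] obtain A where A: "\<forall>e\<in>E. \<forall>\<mu>\<in>K. \<forall>S. finite S \<and> S \<subseteq> K \<longrightarrow>
        (\<Sum>\<nu>\<in>S. (cmod (l2_inner M (b (e, \<mu>)) (P (b (e, \<nu>)))))\<^sup>2) \<le> A"
      by (rule exE)
    from col[OF X] obtain B where B: "\<forall>e\<in>E. \<forall>\<nu>\<in>K. \<forall>S. finite S \<and> S \<subseteq> K \<longrightarrow>
        (\<Sum>\<mu>\<in>S. (cmod (l2_inner M (b (e, \<mu>)) (X (b (e, \<nu>)))))\<^sup>2) \<le> B"
      by (rule exE)
    have "\<exists>z. ((\<lambda>\<mu>. 0) has_sum z) K \<and>
        ((\<lambda>e. of_real (w e) * l2_inner M (b (e, \<kappa>)) (P (X (b (e, \<nu>))))) has_sum z) E"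
    proof (rule weighted_sum_swap[OF w,
          where A = A and B = B and q = "\<lambda>e \<mu>. l2_inner M (b (e, \<kappa>)) (P (b (e, \<mu>)))" and r = "\<lambda>e \<mu>. l2_inner M (b (e, \<mu>)) (X (b (e, \<nu>)))"])
      fix \<mu> assume \<mu>: "\<mu> \<in> K"
      have "((\<lambda>e. p \<kappa> \<mu> * (of_real (w e) * l2_inner M (b (e, \<mu>)) (X (b (e, \<nu>))))) has_sum p \<kappa> \<mu> * 0) E"
        by (intro has_sum_cmult_right zero \<mu> \<nu>)
      then show "((\<lambda>e. of_real (w e) * (l2_inner M (b (e, \<kappa>)) (P (b (e, \<mu>))) *
          l2_inner M (b (e, \<mu>)) (X (b (e, \<nu>))))) has_sum 0) E"
        by (rule has_sum_eq_trans) (simp_all add: p \<kappa> \<mu>)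
    next
      fix e assume e: "e \<in> E"
      have "((\<lambda>k. l2_inner M (b k) (X (b (e, \<nu>))) * l2_inner M (b (e, \<kappa>)) (P (b k))) has_sum
          l2_inner M (b (e, \<kappa>)) (P (X (b (e, \<nu>))))) (E \<times> K)"
        by (rule basis_op_expansion[OF b bP bL[OF e \<kappa>] bounded_op_L2[OF X bL[OF e \<nu>]]])
      then show "((\<lambda>\<mu>. l2_inner M (b (e, \<kappa>)) (P (b (e, \<mu>))) * l2_inner M (b (e, \<mu>)) (X (b (e, \<nu>)))) has_sum
          l2_inner M (b (e, \<kappa>)) (P (X (b (e, \<nu>))))) K"
        by (subst (asm) has_sum_slice[OF e]) (auto simp: p e \<kappa> mult.commute)
    qed (use A B \<kappa> \<nu> in auto)
    then show ?thesis using has_sum_unique[OF has_sum_0_simp[of K]] by auto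
  qed
  from col[OF bQ] obtain A where A: "\<forall>e\<in>E. \<forall>\<nu>\<in>K. \<forall>S. finite S \<and> S \<subseteq> K \<longrightarrow>
      (\<Sum>\<mu>\<in>S. (cmod (l2_inner M (b (e, \<mu>)) (Q (b (e, \<nu>)))))\<^sup>2) \<le> A"
      by (rule exE)
  from row[OF PX] obtain B where B: "\<forall>e\<in>E. \<forall>\<mu>\<in>K. \<forall>S. finite S \<and> S \<subseteq> K \<longrightarrow>
      (\<Sum>\<nu>\<in>S. (cmod (l2_inner M (b (e, \<mu>)) ((P \<circ> X) (b (e, \<nu>)))))\<^sup>2) \<le> B"
      by (rule exE)
  have "\<exists>z. ((\<lambda>\<nu>. 0) has_sum z) K \<and>
      ((\<lambda>e. of_real (w e) * l2_inner M (b (e, \<kappa>)) (P (X (Q (b (e, \<kappa>)))))) has_sum z) E"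
  proof (rule weighted_sum_swap[OF w,
        where A = A and B = B and q = "\<lambda>e \<nu>. l2_inner M (b (e, \<nu>)) (Q (b (e, \<kappa>)))" and r = "\<lambda>e \<nu>. l2_inner M (b (e, \<kappa>)) ((P \<circ> X) (b (e, \<nu>)))"])
    fix \<nu> assume \<nu>: "\<nu> \<in> K"
    have "((\<lambda>e. q \<nu> \<kappa> * (of_real (w e) * l2_inner M (b (e, \<kappa>)) (P (X (b (e, \<nu>)))))) has_sum q \<nu> \<kappa> * 0) E"
      by (intro has_sum_cmult_right PXzero \<nu>)
    then show "((\<lambda>e. of_real (w e) * (l2_inner M (b (e, \<nu>)) (Q (b (e, \<kappa>))) *
        l2_inner M (b (e, \<kappa>)) ((P \<circ> X) (b (e, \<nu>))))) has_sum 0) E"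
      by (rule has_sum_eq_trans) (simp_all add: q \<kappa> \<nu>)
  next
    fix e assume e: "e \<in> E"
    have "((\<lambda>k. l2_inner M (b k) (Q (b (e, \<kappa>))) * l2_inner M (b (e, \<kappa>)) ((P \<circ> X) (b k))) has_sum
        l2_inner M (b (e, \<kappa>)) ((P \<circ> X) (Q (b (e, \<kappa>))))) (E \<times> K)"
      by (rule basis_op_expansion[OF b PX bL[OF e \<kappa>] bounded_op_L2[OF bQ bL[OF e \<kappa>]]])
    then show "((\<lambda>\<nu>. l2_inner M (b (e, \<nu>)) (Q (b (e, \<kappa>))) * l2_inner M (b (e, \<kappa>)) ((P \<circ> X) (b (e, \<nu>)))) has_sum
        l2_inner M (b (e, \<kappa>)) (P (X (Q (b (e, \<kappa>)))))) K"
      by (subst (asm) has_sum_slice[OF e]) (auto simp: q e \<kappa>)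
  qed (use A B \<kappa> in auto)
  then show ?thesis using has_sum_unique[OF has_sum_0_simp[of K]] by auto
qed

text \<open>Diagonal elements of a bounded operator are bounded, so the diagonal sum converges
  absolutely against the product weights and may be computed with the sum over \<open>e\<close>
  innermost, where it is 0 for every \<mu>. The result is valid in all bases by
  \<open>has_trace_diagonal\<close>.\<close>

lemma has_trace_block_zero:
  assumes b: "basis_family M (E \<times> K) b" and P: "block_op M E K b P" and Q: "block_op M E K b Q"
    and X: "bounded_op M X" and G: "bounded_op M G"
    and w: "\<And>e. e \<in> E \<Longrightarrow> 0 \<le> w e" "w summable_on E"
    and v: "\<And>\<mu>. \<mu> \<in> K \<Longrightarrow> 0 \<le> v \<mu>" "v summable_on K"
    and diag: "\<And>f e \<mu>. f \<in> L2 M \<Longrightarrow> e \<in> E \<Longrightarrow> \<mu> \<in> K \<Longrightarrow>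
      l2_inner M f (G (b (e, \<mu>))) = of_real (w e * v \<mu>) * l2_inner M f (b (e, \<mu>))"
    and zero: "\<And>\<mu> \<nu>. \<mu> \<in> K \<Longrightarrow> \<nu> \<in> K \<Longrightarrow>
      ((\<lambda>e. of_real (w e) * l2_inner M (b (e, \<mu>)) (X (b (e, \<nu>)))) has_sum 0) E"
  shows "has_trace M (G \<circ> (P \<circ> X \<circ> Q)) 0"
proof -
  define A where "A = P \<circ> X \<circ> Q"
  have bA: "bounded_op M A"
    using P Q X unfolding A_def block_op_def by (intro bounded_op_comp) auto
  note o = basis_family_ortho[OF b]
  obtain C where C: "0 \<le> C" "\<And>f. f \<in> L2 M \<Longrightarrow> l2_norm M (A f) \<le> C * l2_norm M f"
    using bounded_op_bound[OF bA] by blast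
  define u where "u = (\<lambda>k. w (fst k) * v (snd k))"
  have le: "cmod (l2_inner M (b k) (A (b k))) \<le> C" if "k \<in> E \<times> K" for k
    using order_trans[OF l2_Cauchy_Schwarz[of "b k" M "A (b k)"]
        mult_left_mono[OF C(2) l2_norm_nonneg[of M "b k"]]] bA
      ortho_family_L2[OF o that] ortho_family_norm[OF o that] by auto
  have u: "0 \<le> u k" if "k \<in> E \<times> K" for k using that w v by (auto simp: u_def)
  have us: "u summable_on E \<times> K"
    by (rule summable_on_SigmaI[where g = "\<lambda>e. w e * infsum v K"])
      (auto simp: u_def intro!: has_sum_cmult_right has_sum_infsum summable_on_cmult_left mult_nonneg_nonneg w v)
  have "(\<lambda>k. of_real (u k) * l2_inner M (b k) (A (b k))) summable_on E \<times> K"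
  proof (rule abs_summable_summable, rule summable_on_comparison_test)
    show "(\<lambda>k. C * u k) summable_on E \<times> K" by (rule summable_on_cmult_right[OF us])
    show "norm (of_real (u k) * l2_inner M (b k) (A (b k))) \<le> C * u k" if "k \<in> E \<times> K" for k
      using mult_right_mono[OF le[OF that] u[OF that]] u[OF that] by (simp add: norm_mult mult.commute)
  qed simp
  then obtain z where z: "((\<lambda>k. of_real (u k) * l2_inner M (b k) (A (b k))) has_sum z) (E \<times> K)"
    by (auto simp: summable_on_def)
  have "((\<lambda>\<mu>. 0) has_sum z) K"
  proof (rule has_sum_SigmaD[OF has_sum_swap[THEN iffD1, OF z]])
    fix \<mu> assume \<mu>: "\<mu> \<in> K"
    have "((\<lambda>e. of_real (v \<mu>) * (of_real (w e) * l2_inner M (b (e, \<mu>)) (P (X (Q (b (e, \<mu>))))))) has_sum of_real (v \<mu>) * 0) E"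
      by (intro has_sum_cmult_right partial_trace_block_zero[OF b P Q X w zero \<mu>])
    then show "((\<lambda>e. case (\<mu>, e) of (x, y) \<Rightarrow> of_real (u (y, x)) * l2_inner M (b (y, x)) (A (b (y, x)))) has_sum 0) E"
      by (simp add: u_def A_def mult_ac)
  qed
  then have "z = 0" using has_sum_unique[OF has_sum_0_simp[of K]] by blast
  then have "has_trace M (G \<circ> A) 0"
    using z diag by (intro has_trace_diagonal[OF b G bA u us]) (auto simp: u_def)
  then show ?thesis by (simp add: A_def)
qed

section \<open>Factorizations of a measure space into a product\<close>

text \<open>\<open>C\<close> is identified with \<open>A \<Otimes>\<^sub>M B\<close> through \<open>m\<close>, with coordinate projections \<open>p\<close> and \<open>r\<close>.\<close>

locale factorization = pair_sigma_finite A B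
  for A :: "'a measure" and B :: "'b measure" +
  fixes C :: "'c measure" and m :: "'a \<times> 'b \<Rightarrow> 'c" and p :: "'c \<Rightarrow> 'a" and r :: "'c \<Rightarrow> 'b"
  assumes m_measurable [measurable]: "m \<in> measurable (A \<Otimes>\<^sub>M B) C"
    and p_measurable [measurable]: "p \<in> measurable C A"
    and r_measurable [measurable]: "r \<in> measurable C B"
    and distr_m: "distr (A \<Otimes>\<^sub>M B) C m = C"
    and p_m: "\<And>x y. x \<in> space A \<Longrightarrow> y \<in> space B \<Longrightarrow> p (m (x, y)) = x"
    and r_m: "\<And>x y. x \<in> space A \<Longrightarrow> y \<in> space B \<Longrightarrow> r (m (x, y)) = y"
begin

definition tensor :: "('a \<Rightarrow> complex) \<Rightarrow> ('b \<Rightarrow> complex) \<Rightarrow> 'c \<Rightarrow> complex" where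
  "tensor \<phi> \<xi> z = \<phi> (p z) * \<xi> (r z)"

text \<open>The partial inner product over the second factor; by \<open>inner_slice\<close> it is
  the adjoint of tensoring with \<xi>.\<close>

definition slice :: "('b \<Rightarrow> complex) \<Rightarrow> ('c \<Rightarrow> complex) \<Rightarrow> 'a \<Rightarrow> complex" where
  "slice \<xi> F x = (\<integral>y. cnj (\<xi> y) * F (m (x, y)) \<partial>B)"

lemma nn_integral_factor:
  assumes [measurable]: "f \<in> borel_measurable C"
  shows "(\<integral>\<^sup>+z. f z \<partial>C) = (\<integral>\<^sup>+x. \<integral>\<^sup>+y. f (m (x, y)) \<partial>B \<partial>A)"
proof -
  have "(\<integral>\<^sup>+z. f z \<partial>C) = (\<integral>\<^sup>+z. f z \<partial>distr (A \<Otimes>\<^sub>M B) C m)" by (simp only: distr_m)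
  also have "\<dots> = (\<integral>\<^sup>+w. f (m w) \<partial>(A \<Otimes>\<^sub>M B))" by (rule nn_integral_distr) measurable
  also have "\<dots> = (\<integral>\<^sup>+x. \<integral>\<^sup>+y. f (m (x, y)) \<partial>B \<partial>A)"
    by (rule M2.nn_integral_fst[symmetric]) measurable
  finally show ?thesis .
qed

lemma integrable_factor:
  fixes f :: "'c \<Rightarrow> complex"
  assumes "integrable C f"
  shows "integrable (A \<Otimes>\<^sub>M B) (\<lambda>w. f (m w))"
  using assms integrable_distr[OF m_measurable, of f] by (simp add: distr_m)

lemma integral_factor:
  fixes f :: "'c \<Rightarrow> complex"
  assumes f: "integrable C f"
  shows "(\<integral>z. f z \<partial>C) = (\<integral>x. \<integral>y. f (m (x, y)) \<partial>B \<partial>A)"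
proof -
  have [measurable]: "f \<in> borel_measurable C" using f by auto
  have "(\<integral>z. f z \<partial>C) = (\<integral>z. f z \<partial>distr (A \<Otimes>\<^sub>M B) C m)" by (simp only: distr_m)
  also have "\<dots> = (\<integral>w. f (m w) \<partial>(A \<Otimes>\<^sub>M B))" by (rule integral_distr) measurable
  also have "\<dots> = (\<integral>x. \<integral>y. f (m (x, y)) \<partial>B \<partial>A)"
    using integral_fst'[OF integrable_factor[OF f]] by simp
  finally show ?thesis .
qed

lemma tensor_L2 [intro]:
  assumes \<phi>: "\<phi> \<in> L2 A" and \<xi>: "\<xi> \<in> L2 B"
  shows "tensor \<phi> \<xi> \<in> L2 C"
proof -
  have [measurable]: "\<phi> \<in> borel_measurable A" "\<xi> \<in> borel_measurable B"
    using \<phi> \<xi> by (auto dest: L2_measurable)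
  have t [measurable]: "tensor \<phi> \<xi> \<in> borel_measurable C"
    unfolding tensor_def[abs_def] by measurable
  have "(\<integral>\<^sup>+z. ennreal ((cmod (tensor \<phi> \<xi> z))\<^sup>2) \<partial>C)
      = (\<integral>\<^sup>+x. \<integral>\<^sup>+y. ennreal ((cmod (tensor \<phi> \<xi> (m (x, y))))\<^sup>2) \<partial>B \<partial>A)"
    by (rule nn_integral_factor) measurable
  also have "\<dots> = (\<integral>\<^sup>+x. \<integral>\<^sup>+y. ennreal ((cmod (\<phi> x))\<^sup>2) * ennreal ((cmod (\<xi> y))\<^sup>2) \<partial>B \<partial>A)"
    by (intro nn_integral_cong) (simp add: tensor_def p_m r_m norm_mult power_mult_distrib ennreal_mult)
  also have "\<dots> = ennreal ((l2_norm A \<phi>)\<^sup>2) * ennreal ((l2_norm B \<xi>)\<^sup>2)"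
    by (simp add: nn_integral_cmult nn_integral_multc nn_integral_L2[OF \<phi>] nn_integral_L2[OF \<xi>])
  also have "\<dots> = ennreal ((l2_norm A \<phi>)\<^sup>2 * (l2_norm B \<xi>)\<^sup>2)" by (simp add: ennreal_mult)
  finally show ?thesis by (intro L2I_nn_integral[OF t]) (rule eq_refl)
qed

lemma section_L2:
  assumes F: "F \<in> L2 C"
  shows "AE x in A. (\<lambda>y. F (m (x, y))) \<in> L2 B"
proof -
  have [measurable]: "F \<in> borel_measurable C" using F by (rule L2_measurable)
  have "(\<integral>\<^sup>+x. \<integral>\<^sup>+y. ennreal ((cmod (F (m (x, y))))\<^sup>2) \<partial>B \<partial>A) = ennreal ((l2_norm C F)\<^sup>2)"
    using nn_integral_L2[OF F] nn_integral_factor[of "\<lambda>z. ennreal ((cmod (F z))\<^sup>2)"] by simp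
  then have ne: "(\<integral>\<^sup>+x. \<integral>\<^sup>+y. ennreal ((cmod (F (m (x, y))))\<^sup>2) \<partial>B \<partial>A) \<noteq> \<infinity>" by simp
  have "AE x in A. (\<integral>\<^sup>+y. ennreal ((cmod (F (m (x, y))))\<^sup>2) \<partial>B) \<noteq> \<infinity>"
    by (rule nn_integral_PInf_AE[OF _ ne]) measurable
  then show ?thesis
  proof (rule AE_mp, intro AE_I2 impI)
    fix x assume [measurable]: "x \<in> space A" and fin: "(\<integral>\<^sup>+y. ennreal ((cmod (F (m (x, y))))\<^sup>2) \<partial>B) \<noteq> \<infinity>"
    have "(\<integral>\<^sup>+y. ennreal ((cmod (F (m (x, y))))\<^sup>2) \<partial>B)
        \<le> ennreal (enn2real (\<integral>\<^sup>+y. ennreal ((cmod (F (m (x, y))))\<^sup>2) \<partial>B))"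
      using fin by (subst ennreal_enn2real) (auto simp: less_top)
    then show "(\<lambda>y. F (m (x, y))) \<in> L2 B"
      by (rule L2I_nn_integral[rotated]) measurable
  qed
qed

lemma slice_eq_inner: "slice \<xi> F x = l2_inner B \<xi> (\<lambda>y. F (m (x, y)))"
  by (simp add: slice_def l2_inner_def)

text \<open>Cauchy-Schwarz in the second variable followed by Tonelli; sections are square
  integrable only for almost every \<open>x\<close>, hence the almost everywhere comparison of
  integrands.\<close>

lemma slice_L2 [intro]:
  assumes \<xi>: "\<xi> \<in> L2 B" and F: "F \<in> L2 C"
  shows "slice \<xi> F \<in> L2 A"
proof -
  have [measurable]: "F \<in> borel_measurable C" "\<xi> \<in> borel_measurable B"
    using F \<xi> by (auto dest: L2_measurable)
  have s [measurable]: "slice \<xi> F \<in> borel_measurable A"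
    unfolding slice_def[abs_def] by measurable
  have "(\<integral>\<^sup>+x. ennreal ((cmod (slice \<xi> F x))\<^sup>2) \<partial>A)
      \<le> (\<integral>\<^sup>+x. ennreal ((l2_norm B \<xi>)\<^sup>2) * (\<integral>\<^sup>+y. ennreal ((cmod (F (m (x, y))))\<^sup>2) \<partial>B) \<partial>A)"
  proof (rule nn_integral_mono_AE, rule AE_mp[OF section_L2[OF F]], intro AE_I2 impI)
    fix x assume h: "(\<lambda>y. F (m (x, y))) \<in> L2 B"
    have "(cmod (slice \<xi> F x))\<^sup>2 \<le> (l2_norm B \<xi> * l2_norm B (\<lambda>y. F (m (x, y))))\<^sup>2"
      unfolding slice_eq_inner by (intro power_mono l2_Cauchy_Schwarz \<xi> h) simp
    then show "ennreal ((cmod (slice \<xi> F x))\<^sup>2)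
        \<le> ennreal ((l2_norm B \<xi>)\<^sup>2) * (\<integral>\<^sup>+y. ennreal ((cmod (F (m (x, y))))\<^sup>2) \<partial>B)"
      unfolding nn_integral_L2[OF h] by (simp add: power_mult_distrib ennreal_leI flip: ennreal_mult)
  qed
  also have "\<dots> = ennreal ((l2_norm B \<xi>)\<^sup>2) * ennreal ((l2_norm C F)\<^sup>2)"
    using nn_integral_L2[OF F] nn_integral_factor[of "\<lambda>z. ennreal ((cmod (F z))\<^sup>2)"]
    by (subst nn_integral_cmult) simp_all
  also have "\<dots> = ennreal ((l2_norm B \<xi>)\<^sup>2 * (l2_norm C F)\<^sup>2)" by (simp add: ennreal_mult)
  finally show ?thesis by (rule L2I_nn_integral[OF s])
qed

lemma inner_slice:
  assumes \<phi>: "\<phi> \<in> L2 A" and \<xi>: "\<xi> \<in> L2 B" and F: "F \<in> L2 C"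
  shows "l2_inner A \<phi> (slice \<xi> F) = l2_inner C (tensor \<phi> \<xi>) F"
proof -
  have "l2_inner C (tensor \<phi> \<xi>) F = (\<integral>x. \<integral>y. cnj (tensor \<phi> \<xi> (m (x, y))) * F (m (x, y)) \<partial>B \<partial>A)"
    unfolding l2_inner_def by (rule integral_factor[OF L2_inner_integrable[OF tensor_L2[OF \<phi> \<xi>] F]])
  also have "\<dots> = (\<integral>x. \<integral>y. cnj (\<phi> x) * (cnj (\<xi> y) * F (m (x, y))) \<partial>B \<partial>A)"
    by (intro Bochner_Integration.integral_cong refl) (simp add: tensor_def p_m r_m)
  also have "\<dots> = l2_inner A \<phi> (slice \<xi> F)"
    by (simp add: l2_inner_def slice_def)
  finally show ?thesis by simp
qed

lemma tensor_inner:
  assumes \<phi>: "\<phi> \<in> L2 A" and \<xi>: "\<xi> \<in> L2 B" and \<phi>': "\<phi>' \<in> L2 A" and \<xi>': "\<xi>' \<in> L2 B"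
  shows "l2_inner C (tensor \<phi> \<xi>) (tensor \<phi>' \<xi>') = l2_inner A \<phi> \<phi>' * l2_inner B \<xi> \<xi>'"
proof -
  have "l2_inner C (tensor \<phi> \<xi>) (tensor \<phi>' \<xi>') = l2_inner A \<phi> (slice \<xi> (tensor \<phi>' \<xi>'))"
    by (rule inner_slice[OF \<phi> \<xi> tensor_L2[OF \<phi>' \<xi>'], symmetric])
  also have "\<dots> = (\<integral>x. cnj (\<phi> x) * (\<phi>' x * l2_inner B \<xi> \<xi>') \<partial>A)"
    unfolding l2_inner_def[of A]
  proof (intro Bochner_Integration.integral_cong refl)
    fix x assume x: "x \<in> space A"
    have "slice \<xi> (tensor \<phi>' \<xi>') x = (\<integral>y. \<phi>' x * (cnj (\<xi> y) * \<xi>' y) \<partial>B)"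
      unfolding slice_def by (intro Bochner_Integration.integral_cong refl) (simp add: tensor_def p_m r_m x)
    then show "cnj (\<phi> x) * slice \<xi> (tensor \<phi>' \<xi>') x = cnj (\<phi> x) * (\<phi>' x * l2_inner B \<xi> \<xi>')"
      by (simp add: l2_inner_def)
  qed
  also have "\<dots> = (\<integral>x. (cnj (\<phi> x) * \<phi>' x) * l2_inner B \<xi> \<xi>' \<partial>A)"
    by (simp only: mult.assoc)
  also have "\<dots> = l2_inner A \<phi> \<phi>' * l2_inner B \<xi> \<xi>'"
    unfolding l2_inner_def[of A] by (rule Bochner_Integration.integral_mult_left_zero)
  finally show ?thesis .
qed

section \<open>Bases and operators on a product space\<close>

text \<open>For completeness, let \<open>F\<close> be orthogonal to all product vectors. Then each
  slice of \<open>F\<close> along \<open>c j\<close> is null, and countability of \<open>J\<close>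
  gives a common null set. Outside it the sections of \<open>F\<close> are orthogonal to all
  \<open>c j\<close>, hence null, and Tonelli finishes.\<close>

lemma tensor_basis:
  assumes b: "basis_family A I b" and c: "basis_family B J c" and J: "countable J"
  shows "basis_family C (I \<times> J) (\<lambda>k. tensor (b (fst k)) (c (snd k)))"
proof -
  have bL: "b i \<in> L2 A" if "i \<in> I" for i using basis_family_ortho[OF b] that by auto
  have cL: "c j \<in> L2 B" if "j \<in> J" for j using basis_family_ortho[OF c] that by auto
  have "vec_eq C F (\<lambda>_. 0)"
    if F: "F \<in> L2 C" and z: "\<And>i j. i \<in> I \<Longrightarrow> j \<in> J \<Longrightarrow> l2_inner C (tensor (b i) (c j)) F = 0" for F
  proof -
    have [measurable]: "F \<in> borel_measurable C" using F by (rule L2_measurable)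
    have "vec_eq A (slice (c j) F) (\<lambda>_. 0)" if j: "j \<in> J" for j
      by (rule basis_family_unique[OF b slice_L2[OF cL[OF j] F] L2_zero])
        (simp add: inner_slice[OF bL cL[OF j] F] z j)
    then have "AE x in A. \<forall>j\<in>J. slice (c j) F x = 0"
      unfolding vec_eq_def using J by (subst AE_ball_countable) auto
    then have "AE x in A. (\<integral>\<^sup>+y. ennreal ((cmod (F (m (x, y))))\<^sup>2) \<partial>B) = 0"
      using section_L2[OF F]
    proof eventually_elim
      case (elim x)
      have "vec_eq B (\<lambda>y. F (m (x, y))) (\<lambda>_. 0)"
        by (rule basis_family_unique[OF c elim(2) L2_zero]) (use elim(1) in \<open>simp add: slice_eq_inner\<close>)
      then have "l2_norm B (\<lambda>y. F (m (x, y))) = 0" using l2_norm_eq_0_iff[OF elim(2)] by simp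
      then show ?case unfolding nn_integral_L2[OF elim(2)] by simp
    qed
    then have "(\<integral>\<^sup>+x. \<integral>\<^sup>+y. ennreal ((cmod (F (m (x, y))))\<^sup>2) \<partial>B \<partial>A) = (\<integral>\<^sup>+x. 0 \<partial>A)"
      by (rule nn_integral_cong_AE)
    then have "ennreal ((l2_norm C F)\<^sup>2) = 0"
      using nn_integral_L2[OF F] nn_integral_factor[of "\<lambda>z. ennreal ((cmod (F z))\<^sup>2)"] by simp
    then have "l2_norm C F = 0" by (simp add: ennreal_eq_0_iff)
    then show ?thesis using l2_norm_eq_0_iff[OF F] by simp
  qed
  then show ?thesis
    unfolding basis_family_def ortho_family_def
    using bL cL ortho_family_inner[OF basis_family_ortho[OF b]] ortho_family_inner[OF basis_family_ortho[OF c]]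
    by (auto simp: tensor_inner)
qed

text \<open>Construction of \<open>T \<otimes> 1\<close>: the coefficient at \<open>(i, j)\<close>
  is that of \<open>T\<close> applied to the slice along \<open>c j\<close>. Bessel in
  \<open>i\<close> leaves the norms of the slices, and their squares sum over \<open>j\<close> to
  the squared norm of \<open>F\<close>.\<close>

lemma tensor_op_ex:
  assumes b: "basis_family A I b" and c: "basis_family B J c" and J: "countable J" and T: "bounded_op A T"
  shows "\<exists>Y. bounded_op C Y \<and> (\<forall>\<phi>\<in>L2 A. \<forall>\<xi>\<in>L2 B. vec_eq C (Y (tensor \<phi> \<xi>)) (tensor (T \<phi>) \<xi>))"
proof -
  have bL: "b i \<in> L2 A" if "i \<in> I" for i using basis_family_ortho[OF b] that by auto
  have cL: "c j \<in> L2 B" if "j \<in> J" for j using basis_family_ortho[OF c] that by auto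
  note t = tensor_basis[OF b c J]
  obtain D where D: "0 \<le> D" "\<And>f. f \<in> L2 A \<Longrightarrow> l2_norm A (T f) \<le> D * l2_norm A f"
    using bounded_op_bound[OF T] by blast
  define q where "q k F = l2_inner A (b (fst k)) (T (slice (c (snd k)) F))" for k F
  have "\<exists>Y. bounded_op C Y \<and>
    (\<forall>F\<in>L2 C. \<forall>k\<in>I \<times> J. l2_inner C (tensor (b (fst k)) (c (snd k))) (Y F) = q k F)"
  proof (rule bounded_op_from_coefficients[OF t _ _ _ D(1)])
    fix k F G assume k: "k \<in> I \<times> J" and F: "F \<in> L2 C" and G: "G \<in> L2 C"
    then have k': "fst k \<in> I" "snd k \<in> J" by auto
    note sF = slice_L2[OF cL[OF k'(2)] F] and sG = slice_L2[OF cL[OF k'(2)] G]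
    \<comment> \<open>Additivity of slices can fail at points whose sections are not integrable, so
      it is proved on coefficients. Homogeneity below holds at every point.\<close>
    have "vec_eq A (slice (c (snd k)) (\<lambda>z. F z + G z)) (\<lambda>x. slice (c (snd k)) F x + slice (c (snd k)) G x)"
      by (rule basis_family_unique[OF b slice_L2[OF cL[OF k'(2)] L2_add[OF F G]] L2_add[OF sF sG]])
        (simp add: inner_slice bL cL k' F G L2_add l2_inner_add_right sF sG tensor_L2)
    from bounded_op_cong[OF T slice_L2[OF cL[OF k'(2)] L2_add[OF F G]] L2_add[OF sF sG] this]
    show "q k (\<lambda>z. F z + G z) = q k F + q k G"
      unfolding q_def l2_inner_op_add[OF T bL[OF k'(1)] sF sG, symmetric]
      by (intro l2_inner_cong_right bL k' bounded_op_L2[OF T] slice_L2 cL L2_add F G)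
  next
    fix k F a assume k: "k \<in> I \<times> J" and F: "F \<in> L2 C"
    then have k': "fst k \<in> I" "snd k \<in> J" by auto
    have "slice (c (snd k)) (\<lambda>z. a * F z) = (\<lambda>x. a * slice (c (snd k)) F x)"
      unfolding slice_eq_inner by (simp add: l2_inner_cmult_right)
    then show "q k (\<lambda>z. a * F z) = a * q k F"
      unfolding q_def using l2_inner_op_cmult[OF T bL[OF k'(1)] slice_L2[OF cL[OF k'(2)] F]] by simp
  next
    fix S F assume S: "finite S" "S \<subseteq> I \<times> J" and F: "F \<in> L2 C"
    define Y Z where "Y = fst ` S" and "Z = snd ` S"
    have YZ: "finite Y" "Y \<subseteq> I" "finite Z" "Z \<subseteq> J" "S \<subseteq> Y \<times> Z"
      using S by (auto simp: Y_def Z_def image_iff) (force, force)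
    \<comment> \<open>Parseval on the product, regrouped by \<open>j\<close>; Parseval on the first
      factor then identifies each inner sum as the squared norm of a slice.\<close>
    have "((\<lambda>(j, i). (cmod (l2_inner C (tensor (b i) (c j)) F))\<^sup>2) has_sum (l2_norm C F)\<^sup>2) (J \<times> I)"
      using has_sum_swap[THEN iffD1, OF Parseval[OF t F]] by simp
    then have sl: "((\<lambda>j. (l2_norm A (slice (c j) F))\<^sup>2) has_sum (l2_norm C F)\<^sup>2) J"
    proof (rule has_sum_SigmaD)
      fix j assume j: "j \<in> J"
      show "((\<lambda>i. case (j, i) of (j, i) \<Rightarrow> (cmod (l2_inner C (tensor (b i) (c j)) F))\<^sup>2) has_sum
          (l2_norm A (slice (c j) F))\<^sup>2) I"
        by (rule has_sum_eq_trans[OF Parseval[OF b slice_L2[OF cL[OF j] F]]])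
          (simp_all add: inner_slice bL cL j F)
    qed
    have "(\<Sum>k\<in>S. (cmod (q k F))\<^sup>2) \<le> (\<Sum>k\<in>Y \<times> Z. (cmod (q k F))\<^sup>2)"
      using YZ by (intro sum_mono2) auto
    also have "\<dots> = (\<Sum>j\<in>Z. \<Sum>i\<in>Y. (cmod (l2_inner A (b i) (T (slice (c j) F))))\<^sup>2)"
      unfolding q_def by (subst sum.swap) (simp add: sum.cartesian_product case_prod_beta)
    also have "\<dots> \<le> (\<Sum>j\<in>Z. D\<^sup>2 * (l2_norm A (slice (c j) F))\<^sup>2)"
    proof (rule sum_mono)
      fix j assume "j \<in> Z"
      then have "j \<in> J" using YZ by auto
      then have s: "slice (c j) F \<in> L2 A" by (intro slice_L2 cL F)
      have "(\<Sum>i\<in>Y. (cmod (l2_inner A (b i) (T (slice (c j) F))))\<^sup>2) \<le> (l2_norm A (T (slice (c j) F)))\<^sup>2"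
        by (rule Bessel[OF basis_family_ortho[OF b] YZ(1,2) bounded_op_L2[OF T s]])
      also have "\<dots> \<le> (D * l2_norm A (slice (c j) F))\<^sup>2"
        by (intro power_mono D(2) s) simp
      finally show "(\<Sum>i\<in>Y. (cmod (l2_inner A (b i) (T (slice (c j) F))))\<^sup>2) \<le> D\<^sup>2 * (l2_norm A (slice (c j) F))\<^sup>2"
        by (simp add: power_mult_distrib)
    qed
    also have "\<dots> \<le> D\<^sup>2 * (l2_norm C F)\<^sup>2"
      unfolding sum_distrib_left[symmetric]
      using YZ by (intro mult_left_mono finite_sum_le_has_sum[OF sl]) auto
    finally show "(\<Sum>k\<in>S. (cmod (q k F))\<^sup>2) \<le> (D * l2_norm C F)\<^sup>2"
      by (simp add: power_mult_distrib)
  qed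
  then obtain Y where Y: "bounded_op C Y"
    "\<And>F i j. F \<in> L2 C \<Longrightarrow> i \<in> I \<Longrightarrow> j \<in> J \<Longrightarrow> l2_inner C (tensor (b i) (c j)) (Y F) = q (i, j) F"
    by auto
  have "vec_eq C (Y (tensor \<phi> \<xi>)) (tensor (T \<phi>) \<xi>)" if \<phi>: "\<phi> \<in> L2 A" and \<xi>: "\<xi> \<in> L2 B" for \<phi> \<xi>
  proof (rule basis_family_unique[OF t])
    show "Y (tensor \<phi> \<xi>) \<in> L2 C" "tensor (T \<phi>) \<xi> \<in> L2 C" using Y(1) T \<phi> \<xi> by auto
    fix k assume "k \<in> I \<times> J"
    then have k: "fst k \<in> I" "snd k \<in> J" by auto
    note s = slice_L2[OF cL[OF k(2)] tensor_L2[OF \<phi> \<xi>]]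
    have "vec_eq A (slice (c (snd k)) (tensor \<phi> \<xi>)) (\<lambda>x. l2_inner B (c (snd k)) \<xi> * \<phi> x)"
      by (rule basis_family_unique[OF b s L2_cmult[OF \<phi>]])
        (simp add: inner_slice tensor_inner tensor_L2 bL cL k \<phi> \<xi> l2_inner_cmult_right)
    from bounded_op_cong[OF T s L2_cmult[OF \<phi>] this]
    have "q k (tensor \<phi> \<xi>) = l2_inner A (b (fst k)) (T (\<lambda>x. l2_inner B (c (snd k)) \<xi> * \<phi> x))"
      unfolding q_def by (intro l2_inner_cong_right bL k bounded_op_L2[OF T] s L2_cmult \<phi>)
    also have "\<dots> = l2_inner C (tensor (b (fst k)) (c (snd k))) (tensor (T \<phi>) \<xi>)"
      using l2_inner_op_cmult[OF T bL[OF k(1)] \<phi>] tensor_inner[OF bL[OF k(1)] cL[OF k(2)] bounded_op_L2[OF T \<phi>] \<xi>]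
      by simp
    finally show "l2_inner C (tensor (b (fst k)) (c (snd k))) (Y (tensor \<phi> \<xi>))
        = l2_inner C (tensor (b (fst k)) (c (snd k))) (tensor (T \<phi>) \<xi>)"
      using Y(2)[OF tensor_L2[OF \<phi> \<xi>] k] by simp
  qed
  with Y(1) show ?thesis by blast
qed

end

section \<open>Finite powers of a measure space\<close>

definition prod_fun :: "'i set \<Rightarrow> ('i \<Rightarrow> 'a \<Rightarrow> complex) \<Rightarrow> ('i \<Rightarrow> 'a) \<Rightarrow> complex" where
  "prod_fun I f x = (\<Prod>k\<in>I. f k (x k))"

lemma prod_fun_restrict: "prod_fun J (restrict f J) x = prod_fun J f x" "prod_fun J f (restrict x J) = prod_fun J f x"
  by (simp_all add: prod_fun_def)

lemma prod_fun_single: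
  "finite I \<Longrightarrow> i \<in> I \<Longrightarrow> prod_fun I f = (\<lambda>x. f i (x i) * prod_fun (I - {i}) f (restrict x (I - {i})))"
  by (simp add: prod_fun_def prod.remove[of I i] fun_eq_iff)

lemma prod_fun_pair:
  assumes "finite I" "i \<in> I" "j \<in> I" "i \<noteq> j"
  shows "prod_fun I f = (\<lambda>x. (f i (x i) * f j (x j)) * prod_fun (I - {i, j}) f (restrict x (I - {i, j})))"
proof -
  have "I - {i} - {j} = I - {i, j}" by auto
  with assms show ?thesis
    by (simp add: prod_fun_def prod.remove[of I i] prod.remove[of "I - {i}" j] fun_eq_iff mult.assoc)
qed

lemma bij_betw_PiE_insert:
  assumes "i \<notin> J"
  shows "bij_betw (\<lambda>f. (f i, restrict f J)) (PiE (insert i J) (\<lambda>_. E)) (E \<times> PiE J (\<lambda>_. E))"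
    and "bij_betw (\<lambda>k. (snd k)(i := fst k)) (E \<times> PiE J (\<lambda>_. E)) (PiE (insert i J) (\<lambda>_. E))"
proof -
  let ?g = "\<lambda>f. (f i, restrict f J)" and ?h = "\<lambda>k. (snd k)(i := fst k)"
  have g: "?g \<in> PiE (insert i J) (\<lambda>_. E) \<rightarrow> E \<times> PiE J (\<lambda>_. E)"
    by auto
  have h: "?h \<in> E \<times> PiE J (\<lambda>_. E) \<rightarrow> PiE (insert i J) (\<lambda>_. E)"
    by (intro Pi_I PiE_I) (auto intro: PiE_arb)
  have hg: "?h (?g f) = f" if "f \<in> PiE (insert i J) (\<lambda>_. E)" for f
  proof
    fix x show "?h (?g f) x = f x"
      using PiE_arb[OF that, of x] by (cases "x \<in> insert i J") auto
  qed
  have gh: "?g (?h k) = k" if "k \<in> E \<times> PiE J (\<lambda>_. E)" for k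
  proof -
    have "snd k \<in> PiE J (\<lambda>_. E)" using that by auto
    then have "restrict (?h k) J x = snd k x" for x
      using PiE_arb[of "snd k" J "\<lambda>_. E" x] assms by (cases "x \<in> J") auto
    then show ?thesis by (simp add: prod_eq_iff fun_eq_iff)
  qed
  show "bij_betw ?g (PiE (insert i J) (\<lambda>_. E)) (E \<times> PiE J (\<lambda>_. E))"
    by (rule bij_betwI[OF g h]; erule hg gh)
  show "bij_betw ?h (E \<times> PiE J (\<lambda>_. E)) (PiE (insert i J) (\<lambda>_. E))"
    by (rule bij_betwI[OF h g]; erule hg gh)
qed

context sigma_finite_measure
begin

lemma product_sigma_finite_const: "product_sigma_finite (\<lambda>_. M)"
  by standard

lemma sigma_finite_PiM_const: "finite I \<Longrightarrow> sigma_finite_measure (PiM I (\<lambda>_. M))"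
  by (rule product_sigma_finite.sigma_finite[OF product_sigma_finite_const])

lemma sigma_finite_pair: "sigma_finite_measure (M \<Otimes>\<^sub>M M)"
  by (intro sigma_finite_pair_measure sigma_finite_measure_axioms)

lemma factorization_pair: "factorization M M (M \<Otimes>\<^sub>M M) id fst snd"
proof -
  interpret pair_sigma_finite M M
    by (intro pair_sigma_finite.intro sigma_finite_measure_axioms)
  show ?thesis by unfold_locales (auto simp: distr_id id_def)
qed

text \<open>The image measure is compared with the product measure on boxes, which determine a
  finite product of sigma-finite measures.\<close>

lemma factorization_PiM_single:
  assumes I: "finite I" "i \<in> I"
  shows "factorization M (PiM (I - {i}) (\<lambda>_. M)) (PiM I (\<lambda>_. M)) (\<lambda>(x, y). y(i := x))
    (\<lambda>z. z i) (\<lambda>z. restrict z (I - {i}))"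
proof -
  interpret P: product_sigma_finite "\<lambda>_. M" by (rule product_sigma_finite_const)
  interpret R: sigma_finite_measure "PiM (I - {i}) (\<lambda>_. M)" using I by (intro sigma_finite_PiM_const) auto
  interpret pair_sigma_finite M "PiM (I - {i}) (\<lambda>_. M)" ..
  have I': "I = insert i (I - {i})" using I by auto
  have m: "(\<lambda>(x, y). y(i := x)) \<in> measurable (M \<Otimes>\<^sub>M PiM (I - {i}) (\<lambda>_. M)) (PiM I (\<lambda>_. M))"
    by (subst (2) I', unfold case_prod_beta) (rule measurable_fun_upd[where J = "I - {i}"]; (simp | measurable))
  show ?thesis
  proof (unfold_locales)
    show "(\<lambda>(x, y). y(i := x)) \<in> measurable (M \<Otimes>\<^sub>M PiM (I - {i}) (\<lambda>_. M)) (PiM I (\<lambda>_. M))" by (rule m)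
    show "(\<lambda>z. z i) \<in> measurable (PiM I (\<lambda>_. M)) M" using I by measurable
    show "(\<lambda>z. restrict z (I - {i})) \<in> measurable (PiM I (\<lambda>_. M)) (PiM (I - {i}) (\<lambda>_. M))"
      by (rule measurable_restrict_subset) auto
    show "distr (M \<Otimes>\<^sub>M PiM (I - {i}) (\<lambda>_. M)) (PiM I (\<lambda>_. M)) (\<lambda>(x, y). y(i := x)) = PiM I (\<lambda>_. M)"
    proof (rule P.PiM_eqI[OF I(1)])
      fix A assume A: "\<And>j. j \<in> I \<Longrightarrow> A j \<in> sets M"
      have vim: "(\<lambda>(x, y). y(i := x)) -` Pi\<^sub>E I A \<inter> space (M \<Otimes>\<^sub>M PiM (I - {i}) (\<lambda>_. M))
          = A i \<times> Pi\<^sub>E (I - {i}) A"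
        using I A[THEN sets.sets_into_space]
        by (auto simp: space_pair_measure space_PiM PiE_iff extensional_def split: if_splits)
      have "emeasure (PiM (I - {i}) (\<lambda>_. M)) (Pi\<^sub>E (I - {i}) A) = (\<Prod>i\<in>I - {i}. emeasure M (A i))"
        using A I by (intro P.emeasure_PiM) auto
      moreover have "Pi\<^sub>E I A \<in> sets (PiM I (\<lambda>_. M))" "Pi\<^sub>E (I - {i}) A \<in> sets (PiM (I - {i}) (\<lambda>_. M))"
        using A I by (auto intro!: sets_PiM_I_finite)
      ultimately show "emeasure (distr (M \<Otimes>\<^sub>M PiM (I - {i}) (\<lambda>_. M)) (PiM I (\<lambda>_. M)) (\<lambda>(x, y). y(i := x))) (Pi\<^sub>E I A)
          = (\<Prod>i\<in>I. emeasure M (A i))"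
        using I A[OF I(2)] by (simp only: emeasure_distr[OF m] vim R.emeasure_pair_measure_Times prod.remove[of I i])
    qed simp
    fix x y assume "x \<in> space M" "y \<in> space (PiM (I - {i}) (\<lambda>_. M))"
    then show "(case (x, y) of (x, y) \<Rightarrow> y(i := x)) i = x"
      "restrict (case (x, y) of (x, y) \<Rightarrow> y(i := x)) (I - {i}) = y"
      by (auto simp: space_PiM PiE_iff extensional_def fun_eq_iff)
  qed
qed

text \<open>A two-body operator need not be a product, so the two coordinates on which it acts are
  split off together.\<close>

lemma factorization_PiM_pair:
  assumes I: "finite I" "i \<in> I" "j \<in> I" "i \<noteq> j"
  shows "factorization (M \<Otimes>\<^sub>M M) (PiM (I - {i, j}) (\<lambda>_. M)) (PiM I (\<lambda>_. M)) (\<lambda>(x, y). y(i := fst x, j := snd x))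
    (\<lambda>z. (z i, z j)) (\<lambda>z. restrict z (I - {i, j}))"
proof -
  note M = sigma_finite_measure_axioms
  interpret P: product_sigma_finite "\<lambda>_. M" by (rule product_sigma_finite_const)
  interpret MM: sigma_finite_measure "M \<Otimes>\<^sub>M M" by (rule sigma_finite_pair)
  interpret R: sigma_finite_measure "PiM (I - {i, j}) (\<lambda>_. M)" using I by (intro sigma_finite_PiM_const) auto
  interpret pair_sigma_finite "M \<Otimes>\<^sub>M M" "PiM (I - {i, j}) (\<lambda>_. M)" ..
  have I': "I = insert j (insert i (I - {i, j}))" using I by auto
  have m: "(\<lambda>(x, y). y(i := fst x, j := snd x)) \<in> measurable ((M \<Otimes>\<^sub>M M) \<Otimes>\<^sub>M PiM (I - {i, j}) (\<lambda>_. M)) (PiM I (\<lambda>_. M))"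
    by (subst (2) I', unfold case_prod_beta)
      (rule measurable_fun_upd[where J = "insert i (I - {i, j})"], simp,
        rule measurable_fun_upd[where J = "I - {i, j}"]; (simp | measurable))
  show ?thesis
  proof (unfold_locales)
    show "(\<lambda>(x, y). y(i := fst x, j := snd x)) \<in> measurable ((M \<Otimes>\<^sub>M M) \<Otimes>\<^sub>M PiM (I - {i, j}) (\<lambda>_. M)) (PiM I (\<lambda>_. M))"
      by (rule m)
    show "(\<lambda>z. (z i, z j)) \<in> measurable (PiM I (\<lambda>_. M)) (M \<Otimes>\<^sub>M M)" using I by measurable
    show "(\<lambda>z. restrict z (I - {i, j})) \<in> measurable (PiM I (\<lambda>_. M)) (PiM (I - {i, j}) (\<lambda>_. M))"
      by (rule measurable_restrict_subset) auto
    show "distr ((M \<Otimes>\<^sub>M M) \<Otimes>\<^sub>M PiM (I - {i, j}) (\<lambda>_. M)) (PiM I (\<lambda>_. M)) (\<lambda>(x, y). y(i := fst x, j := snd x))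
        = PiM I (\<lambda>_. M)"
    proof (rule P.PiM_eqI[OF I(1)])
      fix A assume A: "\<And>j. j \<in> I \<Longrightarrow> A j \<in> sets M"
      have vim: "(\<lambda>(x, y). y(i := fst x, j := snd x)) -` Pi\<^sub>E I A \<inter> space ((M \<Otimes>\<^sub>M M) \<Otimes>\<^sub>M PiM (I - {i, j}) (\<lambda>_. M))
          = (A i \<times> A j) \<times> Pi\<^sub>E (I - {i, j}) A"
        using I A[THEN sets.sets_into_space]
        by (auto simp: space_pair_measure space_PiM PiE_iff extensional_def split: if_splits)
      have "(\<Prod>i\<in>I. emeasure M (A i)) = emeasure M (A i) * (emeasure M (A j) * (\<Prod>i\<in>I - {i} - {j}. emeasure M (A i)))"
        using I prod.remove[of "I - {i}" j "\<lambda>i. emeasure M (A i)"] by (simp add: prod.remove[of I i])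
      moreover have "I - {i} - {j} = I - {i, j}" by auto
      moreover have "emeasure (PiM (I - {i, j}) (\<lambda>_. M)) (Pi\<^sub>E (I - {i, j}) A) = (\<Prod>i\<in>I - {i, j}. emeasure M (A i))"
        using A I by (intro P.emeasure_PiM) auto
      moreover have "Pi\<^sub>E I A \<in> sets (PiM I (\<lambda>_. M))"
          "Pi\<^sub>E (I - {i, j}) A \<in> sets (PiM (I - {i, j}) (\<lambda>_. M))" "A i \<times> A j \<in> sets (M \<Otimes>\<^sub>M M)"
        using A I by (auto intro!: sets_PiM_I_finite)
      ultimately show "emeasure (distr ((M \<Otimes>\<^sub>M M) \<Otimes>\<^sub>M PiM (I - {i, j}) (\<lambda>_. M)) (PiM I (\<lambda>_. M)) (\<lambda>(x, y). y(i := fst x, j := snd x))) (Pi\<^sub>E I A)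
          = (\<Prod>i\<in>I. emeasure M (A i))"
        using A[OF I(2)] A[OF I(3)]
        by (simp only: emeasure_distr[OF m] vim R.emeasure_pair_measure_Times
            sigma_finite_measure.emeasure_pair_measure_Times[OF M] mult.assoc)
    qed simp
    fix x y assume "x \<in> space (M \<Otimes>\<^sub>M M)" "y \<in> space (PiM (I - {i, j}) (\<lambda>_. M))"
    then show "(\<lambda>z. (z i, z j)) (case (x, y) of (x, y) \<Rightarrow> y(i := fst x, j := snd x)) = x"
      "restrict (case (x, y) of (x, y) \<Rightarrow> y(i := fst x, j := snd x)) (I - {i, j}) = y"
      using I by (auto simp: space_PiM PiE_iff extensional_def fun_eq_iff)
  qed
qed

lemma prod_fun_insert:
  fixes f :: "'i \<Rightarrow> 'a \<Rightarrow> complex"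
  assumes "finite I" "i \<notin> I"
  shows "factorization M (PiM I (\<lambda>_. M)) (PiM (insert i I) (\<lambda>_. M)) (\<lambda>(x, y). y(i := x))
      (\<lambda>z. z i) (\<lambda>z. restrict z I)" (is ?F)
    and "prod_fun (insert i I) f = factorization.tensor (\<lambda>z. z i) (\<lambda>z. restrict z I) (f i) (prod_fun I f)"
proof -
  have D: "insert i I - {i} = I" using assms(2) by auto
  show ?F
    using factorization_PiM_single[of "insert i I" i] assms(1) unfolding D by simp
  then interpret F: factorization M "PiM I (\<lambda>_. M)" "PiM (insert i I) (\<lambda>_. M)" "\<lambda>(x, y). y(i := x)"
      "\<lambda>z. z i" "\<lambda>z. restrict z I" .
  show "prod_fun (insert i I) f = F.tensor (f i) (prod_fun I f)"
    using prod_fun_single[of "insert i I" i f] assms(1) unfolding D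
    by (simp add: F.tensor_def fun_eq_iff)
qed

lemma prod_fun_L2:
  assumes "finite I" "\<And>k. k \<in> I \<Longrightarrow> f k \<in> L2 M"
  shows "prod_fun I f \<in> L2 (PiM I (\<lambda>_. M))"
  using assms
proof (induction I)
  case empty
  show ?case
    by (simp add: prod_fun_def[abs_def] L2_def PiM_empty integrable_count_space)
next
  case (insert i I)
  interpret F: factorization M "PiM I (\<lambda>_. M)" "PiM (insert i I) (\<lambda>_. M)" "\<lambda>(x, y). y(i := x)"
      "\<lambda>z. z i" "\<lambda>z. restrict z I"
    by (rule prod_fun_insert(1)[OF insert.hyps])
  show ?case
    unfolding prod_fun_insert(2)[OF insert.hyps] by (intro F.tensor_L2 insert) auto
qed

lemma prod_fun_inner:
  assumes "finite I" "\<And>k. k \<in> I \<Longrightarrow> f k \<in> L2 M" "\<And>k. k \<in> I \<Longrightarrow> g k \<in> L2 M"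
  shows "l2_inner (PiM I (\<lambda>_. M)) (prod_fun I f) (prod_fun I g) = (\<Prod>k\<in>I. l2_inner M (f k) (g k))"
  using assms
proof (induction I)
  case empty
  show ?case
    by (simp add: prod_fun_def[abs_def] l2_inner_def PiM_empty lebesgue_integral_count_space_finite)
next
  case (insert i I)
  interpret F: factorization M "PiM I (\<lambda>_. M)" "PiM (insert i I) (\<lambda>_. M)" "\<lambda>(x, y). y(i := x)"
      "\<lambda>z. z i" "\<lambda>z. restrict z I"
    by (rule prod_fun_insert(1)[OF insert.hyps])
  have "l2_inner (PiM I (\<lambda>_. M)) (prod_fun I f) (prod_fun I g) = (\<Prod>k\<in>I. l2_inner M (f k) (g k))"
    by (intro insert.IH insert.prems) auto
  moreover have "l2_inner (PiM (insert i I) (\<lambda>_. M)) (F.tensor (f i) (prod_fun I f)) (F.tensor (g i) (prod_fun I g))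
      = l2_inner M (f i) (g i) * l2_inner (PiM I (\<lambda>_. M)) (prod_fun I f) (prod_fun I g)"
    by (intro F.tensor_inner prod_fun_L2 insert.hyps insert.prems) auto
  ultimately show ?case
    unfolding prod_fun_insert(2)[OF insert.hyps] using insert.hyps by simp
qed

text \<open>Induction over the factors through \<open>tensor_basis\<close>, where the tuples already
  built form the countable second index set.\<close>

lemma prod_fun_basis:
  assumes E: "basis_family M E id" "countable E" and I: "finite I"
  shows "basis_family (PiM I (\<lambda>_. M)) (PiE I (\<lambda>_. E)) (prod_fun I)"
  using I
proof (induction I)
  case empty
  \<comment> \<open>The empty product is counting measure on the single point
    \<open>\<lambda>_. undefined\<close>, and the empty product function is the constant 1.\<close>
  have "vec_eq (count_space {\<lambda>_. undefined}) f (\<lambda>_. 0)"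
    if "l2_inner (count_space {\<lambda>_. undefined}) (prod_fun {} (\<lambda>_. undefined)) f = 0" for f
    using that by (simp add: prod_fun_def[abs_def] l2_inner_def lebesgue_integral_count_space_finite
        vec_eq_def AE_count_space)
  then show ?case
    unfolding basis_family_def ortho_family_def
    by (auto simp: PiM_empty prod_fun_def[abs_def] L2_def l2_inner_def integrable_count_space
        lebesgue_integral_count_space_finite)
next
  case (insert i I)
  interpret F: factorization M "PiM I (\<lambda>_. M)" "PiM (insert i I) (\<lambda>_. M)" "\<lambda>(x, y). y(i := x)"
      "\<lambda>z. z i" "\<lambda>z. restrict z I"
    by (rule prod_fun_insert(1)[OF insert.hyps])
  have t: "F.tensor (id (f i)) (prod_fun I (restrict f I)) = prod_fun (insert i I) f" for f
    unfolding prod_fun_insert(2)[OF insert.hyps] by (simp add: F.tensor_def fun_eq_iff prod_fun_restrict)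
  have cnt: "countable (PiE I (\<lambda>_. E))" using insert.hyps E(2) by (intro countable_PiE) auto
  from basis_family_reindex[OF F.tensor_basis[OF E(1) insert.IH cnt] bij_betw_PiE_insert(1)[OF insert.hyps(2)]]
  show ?case by (simp only: fst_conv snd_conv t)
qed

text \<open>The same product basis, with one slot made into the block label that
  \<open>block_op\<close> expects.\<close>

lemma prod_fun_basis_split:
  assumes E: "basis_family M E id" "countable E" and I: "finite I" and i: "i \<in> I"
  shows "basis_family (PiM I (\<lambda>_. M)) (E \<times> PiE (I - {i}) (\<lambda>_. E)) (\<lambda>k. prod_fun I ((snd k)(i := fst k)))"
  using basis_family_reindex[OF prod_fun_basis[OF E I], of "\<lambda>k. (snd k)(i := fst k)"
      "E \<times> PiE (I - {i}) (\<lambda>_. E)"] bij_betw_PiE_insert(2)[of i "I - {i}" E]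
  unfolding insert_Diff[OF i] by simp

end

section \<open>The spectral data of a faithful density operator\<close>

definition tens2 :: "('a \<Rightarrow> complex) \<Rightarrow> ('a \<Rightarrow> complex) \<Rightarrow> 'a \<times> 'a \<Rightarrow> complex" where
  "tens2 f g z = f (fst z) * g (snd z)"

definition split_basis :: "nat \<Rightarrow> nat \<Rightarrow> ('a \<Rightarrow> complex) \<times> (nat \<Rightarrow> 'a \<Rightarrow> complex) \<Rightarrow> (nat \<Rightarrow> 'a) \<Rightarrow> complex" where
  "split_basis N a k = prod_fun {1..N} ((snd k)(a := fst k))"

lemma foldr_comp_id: "foldr (\<lambda>\<nu> T. Y \<nu> \<circ> T) ns S = foldr (\<lambda>\<nu> T. Y \<nu> \<circ> T) ns id \<circ> S"
  by (induction ns) (auto simp: comp_assoc)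

text \<open>Over a general sigma-finite space, so that torus and Euclidean space are treated at once
  and geometry enters only in the final theorem.\<close>

locale faithful_density = sigma_finite_measure M for M :: "'a measure" +
  fixes \<gamma> :: "'a operator"
  assumes density: "density_op M \<gamma>" and faithful: "faithful_op M \<gamma>"
begin

abbreviation "E \<equiv> eigenbasis M \<gamma>"
abbreviation "ev \<equiv> eigenvalue_of M \<gamma>"

lemma E_onb: "orthonormal_basis M E"
  by (rule eigenbasis_orthonormal[OF density])

lemma E_basis: "basis_family M E id"
  using E_onb by (simp add: orthonormal_basis_iff)

lemma E_L2: "e \<in> E \<Longrightarrow> e \<in> L2 M"
  using E_onb by (auto simp: orthonormal_basis_def)

lemma E_inner: "e \<in> E \<Longrightarrow> f \<in> E \<Longrightarrow> l2_inner M e f = (if e = f then 1 else 0)"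
  using E_onb by (auto simp: orthonormal_basis_def)

lemma bounded_density: "bounded_op M \<gamma>"
  using density by (simp add: density_op_def)

lemma selfadjoint_density: "selfadjoint_op M \<gamma>"
  using density by (simp add: density_op_def)

lemma ev_nonneg: "e \<in> E \<Longrightarrow> 0 \<le> ev e"
  using density E_L2 by (simp add: density_op_def nonneg_op_def eigenvalue_of_def)

lemma ev_sum: "(ev has_sum 1) E"
proof -
  have "((\<lambda>e. l2_inner M e (\<gamma> e)) has_sum 1) E"
    using density E_onb by (auto simp: density_op_def has_trace_def)
  then show ?thesis
    using has_sum_Re by (fastforce simp: eigenvalue_of_def[abs_def])
qed

lemma ev_le_1: "e \<in> E \<Longrightarrow> ev e \<le> 1"
  using finite_sum_le_has_sum[OF ev_sum, of "{e}"] ev_nonneg by auto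

lemma ev_neq_0:
  assumes e: "e \<in> E" shows "ev e \<noteq> 0"
proof
  assume "ev e = 0"
  then have "vec_eq M (\<gamma> e) (\<lambda>_. 0)" using eigenbasis_eigenvector[OF density e] by simp
  then have "vec_eq M e (\<lambda>_. 0)" using faithful E_L2[OF e] by (auto simp: faithful_op_def)
  then have "l2_norm M e = 0" using l2_norm_eq_0_iff[OF E_L2[OF e]] by simp
  then show False using ortho_family_norm[OF basis_family_ortho[OF E_basis] e] by simp
qed

text \<open>A summable family has at most countably many nonzero terms, and by faithfulness no
  eigenvalue is 0. The basis stems from Zorn's lemma, so its size has to be controlled in this
  way.\<close>

lemma E_countable: "countable E"
proof -
  have "countable {e \<in> E. ev e \<noteq> 0}"
    by (rule summable_countable_real[OF has_sum_imp_summable[OF ev_sum]])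
  also have "{e \<in> E. ev e \<noteq> 0} = E" using ev_neq_0 by auto
  finally show ?thesis .
qed

lemma inner_E_density:
  assumes e: "e \<in> E" and f: "f \<in> L2 M"
  shows "l2_inner M e (\<gamma> f) = of_real (ev e) * l2_inner M e f"
proof -
  have "l2_inner M e (\<gamma> f) = l2_inner M (\<gamma> e) f"
    by (rule selfadjoint_op_inner[OF selfadjoint_density E_L2[OF e] f])
  also have "\<dots> = l2_inner M (\<lambda>x. of_real (ev e) * e x) f"
    using bounded_density E_L2[OF e] f
    by (intro l2_inner_cong_AE eigenbasis_eigenvector[OF density e]) (auto intro!: L2_measurable L2_cmult)
  finally show ?thesis by (simp add: l2_inner_cmult_left)
qed

lemma eigenvector_log:
  "e \<in> E \<Longrightarrow> (e, \<lambda>x. complex_of_real (ln (ev e)) * e x) \<in> log_op M \<gamma>"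
  using E_inner E_L2 by (auto simp: log_op_def l2_inner_cmult_right)

section \<open>The operator \<open>\<gamma>\<^sup>\<otimes>\<^sup>N\<close>\<close>

definition weight :: "nat set \<Rightarrow> (nat \<Rightarrow> 'a \<Rightarrow> complex) \<Rightarrow> real" where
  "weight I \<kappa> = (\<Prod>k\<in>I. ev (\<kappa> k))"

lemma weight_nonneg: "\<kappa> \<in> PiE I (\<lambda>_. E) \<Longrightarrow> 0 \<le> weight I \<kappa>"
  unfolding weight_def by (intro prod_nonneg) (auto intro: ev_nonneg)

lemma weight_le_1: "\<kappa> \<in> PiE I (\<lambda>_. E) \<Longrightarrow> weight I \<kappa> \<le> 1"
  unfolding weight_def by (intro prod_le_1) (auto intro: ev_nonneg ev_le_1)

text \<open>The sum of all weights is the trace of the tensor power: over a full grid, a sum of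
  products is a product of sums of eigenvalues, each at most 1.\<close>

lemma weight_summable:
  assumes I: "finite I" shows "weight I summable_on PiE I (\<lambda>_. E)"
proof (rule nonneg_bounded_partial_sums_imp_summable_on[where C = 1])
  show "\<forall>\<^sub>F S in finite_subsets_at_top (PiE I (\<lambda>_. E)). sum (weight I) S \<le> 1"
  proof (rule eventually_finite_subsets_at_top_weakI)
    fix S assume S: "finite S" "S \<subseteq> PiE I (\<lambda>_. E)"
    \<comment> \<open>All entries of the tuples in \<open>S\<close>; the finite grid over
      \<open>Y\<close> contains \<open>S\<close>.\<close>
    define Y where "Y = (\<Union>\<kappa>\<in>S. \<kappa> ` I)"
    have Y: "finite Y" "Y \<subseteq> E" "S \<subseteq> PiE I (\<lambda>_. Y)"
      using S I by (auto simp: Y_def PiE_iff subset_iff)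
    have "sum (weight I) S \<le> sum (weight I) (PiE I (\<lambda>_. Y))"
      using Y I weight_nonneg by (intro sum_mono2 finite_PiE) (auto simp: PiE_iff subset_iff)
    also have "\<dots> = (\<Prod>k\<in>I. sum ev Y)"
      unfolding weight_def using Y I by (intro prod_sum_PiE[symmetric]) auto
    also have "\<dots> \<le> 1"
      using Y finite_sum_le_has_sum[OF ev_sum, of Y] ev_nonneg
      by (intro prod_le_1) (auto intro!: sum_nonneg)
    finally show "sum (weight I) S \<le> 1" .
  qed
qed (use weight_nonneg in auto)

lemma prod_fun_L2_E: "finite I \<Longrightarrow> \<kappa> \<in> PiE I (\<lambda>_. E) \<Longrightarrow> prod_fun I \<kappa> \<in> L2 (PiM I (\<lambda>_. M))"
  by (intro prod_fun_L2) (auto intro: E_L2)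

lemma inner_prod_fun_density:
  assumes I: "finite I" and \<kappa>: "\<kappa> \<in> PiE I (\<lambda>_. E)" and f: "\<And>k. k \<in> I \<Longrightarrow> f k \<in> L2 M"
  shows "l2_inner (PiM I (\<lambda>_. M)) (prod_fun I \<kappa>) (prod_fun I (\<lambda>k. \<gamma> (f k)))
    = of_real (weight I \<kappa>) * l2_inner (PiM I (\<lambda>_. M)) (prod_fun I \<kappa>) (prod_fun I f)"
proof -
  have k: "\<kappa> k \<in> E" if "k \<in> I" for k using \<kappa> that by auto
  have "(\<Prod>k\<in>I. l2_inner M (\<kappa> k) (\<gamma> (f k))) = (\<Prod>k\<in>I. of_real (ev (\<kappa> k)) * l2_inner M (\<kappa> k) (f k))"
    by (intro prod.cong refl inner_E_density k f)
  then show ?thesis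
    using I k f E_L2 bounded_op_L2[OF bounded_density]
    by (simp add: prod_fun_inner weight_def prod.distrib)
qed

text \<open>Justifies the choice in \<open>tensor_power_op\<close>: the operator that is diagonal in
  the product eigenbasis with the weights as eigenvalues is bounded, the weights lying between 0 and
  1, and it acts factorwise because \<gamma> does so on coefficients.\<close>

lemma tensor_power_op_spec:
  shows tensor_power_op_bounded: "bounded_op (Pow_measure M N) (tensor_power_op M N \<gamma>)"
    and tensor_power_op_prod_fun: "\<And>f. (\<And>k. k \<in> {1..N} \<Longrightarrow> f k \<in> L2 M) \<Longrightarrow>
      vec_eq (Pow_measure M N) (tensor_power_op M N \<gamma> (prod_fun {1..N} f)) (prod_fun {1..N} (\<lambda>k. \<gamma> (f k)))"
proof -
  let ?I = "{1..N}"
  have fin: "finite ?I" by simp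
  note b = prod_fun_basis[OF E_basis E_countable fin]
  define c where "c \<kappa> F = of_real (weight ?I \<kappa>) * l2_inner (Pow_measure M N) (prod_fun ?I \<kappa>) F" for \<kappa> F
  have "\<exists>G. bounded_op (Pow_measure M N) G \<and>
    (\<forall>F\<in>L2 (Pow_measure M N). \<forall>\<kappa>\<in>PiE ?I (\<lambda>_. E). l2_inner (Pow_measure M N) (prod_fun ?I \<kappa>) (G F) = c \<kappa> F)"
  proof (rule bounded_op_from_coefficients[OF b, where C = 1])
    fix S F assume S: "finite S" "S \<subseteq> PiE ?I (\<lambda>_. E)" and F: "F \<in> L2 (Pow_measure M N)"
    have "(\<Sum>\<kappa>\<in>S. (cmod (c \<kappa> F))\<^sup>2) \<le> (\<Sum>\<kappa>\<in>S. (cmod (l2_inner (Pow_measure M N) (prod_fun ?I \<kappa>) F))\<^sup>2)"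
    proof (rule sum_mono)
      fix \<kappa> assume "\<kappa> \<in> S"
      then have "0 \<le> weight ?I \<kappa>" "weight ?I \<kappa> \<le> 1" using S weight_nonneg weight_le_1 by auto
      then show "(cmod (c \<kappa> F))\<^sup>2 \<le> (cmod (l2_inner (Pow_measure M N) (prod_fun ?I \<kappa>) F))\<^sup>2"
        by (intro power_mono) (auto simp: c_def norm_mult intro!: mult_left_le_one_le)
    qed
    also have "\<dots> \<le> (1 * l2_norm (Pow_measure M N) F)\<^sup>2"
      using Bessel[OF basis_family_ortho[OF b] S F] by simp
    finally show "(\<Sum>\<kappa>\<in>S. (cmod (c \<kappa> F))\<^sup>2) \<le> (1 * l2_norm (Pow_measure M N) F)\<^sup>2" .
  qed (auto simp: c_def l2_inner_add_right prod_fun_L2_E distrib_left l2_inner_cmult_right)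
  then obtain G where G: "bounded_op (Pow_measure M N) G"
    "\<And>F \<kappa>. F \<in> L2 (Pow_measure M N) \<Longrightarrow> \<kappa> \<in> PiE ?I (\<lambda>_. E) \<Longrightarrow>
      l2_inner (Pow_measure M N) (prod_fun ?I \<kappa>) (G F) = c \<kappa> F" by blast
  have "vec_eq (Pow_measure M N) (G (prod_fun ?I f)) (prod_fun ?I (\<lambda>k. \<gamma> (f k)))"
    if f: "\<forall>k\<in>?I. f k \<in> L2 M" for f
  proof (rule basis_family_unique[OF b])
    have fL: "prod_fun ?I f \<in> L2 (Pow_measure M N)" using f by (intro prod_fun_L2) auto
    then show "G (prod_fun ?I f) \<in> L2 (Pow_measure M N)" using G(1) by auto
    show "prod_fun ?I (\<lambda>k. \<gamma> (f k)) \<in> L2 (Pow_measure M N)"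
      using f by (intro prod_fun_L2) (auto intro: bounded_op_L2[OF bounded_density])
    show "l2_inner (Pow_measure M N) (prod_fun ?I \<kappa>) (G (prod_fun ?I f)) =
        l2_inner (Pow_measure M N) (prod_fun ?I \<kappa>) (prod_fun ?I (\<lambda>k. \<gamma> (f k)))" if "\<kappa> \<in> PiE ?I (\<lambda>_. E)" for \<kappa>
      unfolding G(2)[OF fL that] c_def using inner_prod_fun_density[OF fin that, of f] f by simp
  qed
  with G(1) have ex: "\<exists>G. bounded_op (Pow_measure M N) G \<and>
        (\<forall>f. (\<forall>k\<in>?I. f k \<in> L2 M) \<longrightarrow>
           vec_eq (Pow_measure M N) (G (\<lambda>x. \<Prod>k\<in>?I. f k (x k))) (\<lambda>x. \<Prod>k\<in>?I. \<gamma> (f k) (x k)))"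
    unfolding prod_fun_def[abs_def] by blast
  from someI_ex[OF ex]
  have spec: "bounded_op (Pow_measure M N) (tensor_power_op M N \<gamma>) \<and>
        (\<forall>f. (\<forall>k\<in>?I. f k \<in> L2 M) \<longrightarrow>
           vec_eq (Pow_measure M N) (tensor_power_op M N \<gamma> (\<lambda>x. \<Prod>k\<in>?I. f k (x k))) (\<lambda>x. \<Prod>k\<in>?I. \<gamma> (f k) (x k)))"
    unfolding tensor_power_op_def .
  then show "bounded_op (Pow_measure M N) (tensor_power_op M N \<gamma>)" by blast
  show "vec_eq (Pow_measure M N) (tensor_power_op M N \<gamma> (prod_fun ?I f)) (prod_fun ?I (\<lambda>k. \<gamma> (f k)))"
    if "\<And>k. k \<in> ?I \<Longrightarrow> f k \<in> L2 M" for f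
    using spec that unfolding prod_fun_def[abs_def] by blast
qed

text \<open>The eigenvalue equation in weak form, as consumed by \<open>has_trace_diagonal\<close>;
  as functions the two sides agree only almost everywhere.\<close>

lemma tensor_power_op_diagonal:
  assumes F: "F \<in> L2 (Pow_measure M N)" and \<kappa>: "\<kappa> \<in> PiE {1..N} (\<lambda>_. E)"
  shows "l2_inner (Pow_measure M N) F (tensor_power_op M N \<gamma> (prod_fun {1..N} \<kappa>))
    = of_real (weight {1..N} \<kappa>) * l2_inner (Pow_measure M N) F (prod_fun {1..N} \<kappa>)"
proof -
  let ?I = "{1..N}"
  have fin: "finite ?I" by simp
  note b = prod_fun_basis[OF E_basis E_countable fin]
  have \<kappa>L: "\<kappa> k \<in> L2 M" if "k \<in> ?I" for k using \<kappa> that by (auto intro: E_L2)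
  have L: "prod_fun ?I (\<lambda>k. \<gamma> (\<kappa> k)) \<in> L2 (Pow_measure M N)" "prod_fun ?I \<kappa> \<in> L2 (Pow_measure M N)"
    by (intro prod_fun_L2 fin bounded_op_L2[OF bounded_density] \<kappa>L; assumption)+
  have "vec_eq (Pow_measure M N) (prod_fun ?I (\<lambda>k. \<gamma> (\<kappa> k))) (\<lambda>x. of_real (weight ?I \<kappa>) * prod_fun ?I \<kappa> x)"
  proof (rule basis_family_unique[OF b L(1) L2_cmult[OF L(2)]])
    fix \<mu> assume \<mu>: "\<mu> \<in> PiE ?I (\<lambda>_. E)"
    show "l2_inner (Pow_measure M N) (prod_fun ?I \<mu>) (prod_fun ?I (\<lambda>k. \<gamma> (\<kappa> k))) =
      l2_inner (Pow_measure M N) (prod_fun ?I \<mu>) (\<lambda>x. of_real (weight ?I \<kappa>) * prod_fun ?I \<kappa> x)"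
      using inner_prod_fun_density[OF fin \<mu> \<kappa>L] ortho_family_inner[OF basis_family_ortho[OF b] \<mu> \<kappa>]
      by (simp add: l2_inner_cmult_right)
  qed
  then have "vec_eq (Pow_measure M N) (tensor_power_op M N \<gamma> (prod_fun ?I \<kappa>)) (\<lambda>x. of_real (weight ?I \<kappa>) * prod_fun ?I \<kappa> x)"
    by (rule vec_eq_trans[rotated]) (rule tensor_power_op_prod_fun, rule \<kappa>L)
  then have "l2_inner (Pow_measure M N) F (tensor_power_op M N \<gamma> (prod_fun ?I \<kappa>))
      = l2_inner (Pow_measure M N) F (\<lambda>x. of_real (weight ?I \<kappa>) * prod_fun ?I \<kappa> x)"
    by (intro l2_inner_cong_right F bounded_op_L2[OF tensor_power_op_bounded] L2_cmult L)
  then show ?thesis by (simp add: l2_inner_cmult_right)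
qed

section \<open>The operators \<open>X\<^sub>i\<^sub>j\<close>\<close>

lemma tens2_L2: "f \<in> L2 M \<Longrightarrow> g \<in> L2 M \<Longrightarrow> tens2 f g \<in> L2 (M \<Otimes>\<^sub>M M)"
proof -
  interpret F: factorization M M "M \<Otimes>\<^sub>M M" id fst snd by (rule factorization_pair)
  show "f \<in> L2 M \<Longrightarrow> g \<in> L2 M \<Longrightarrow> tens2 f g \<in> L2 (M \<Otimes>\<^sub>M M)"
    using F.tensor_L2[of f g] by (simp add: F.tensor_def[abs_def] tens2_def[abs_def])
qed

lemma tens2_basis: "basis_family (M \<Otimes>\<^sub>M M) (E \<times> E) (\<lambda>k. tens2 (fst k) (snd k))"
proof -
  interpret F: factorization M M "M \<Otimes>\<^sub>M M" id fst snd by (rule factorization_pair)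
  show ?thesis
    using F.tensor_basis[OF E_basis E_basis E_countable]
    by (simp add: F.tensor_def[abs_def] tens2_def[abs_def])
qed

text \<open>Justifies the choice in \<open>pair_op\<close>: \<open>tensor_op_ex\<close> is applied
  with slots \<open>i\<close> and \<open>j\<close> as the first factor and all other slots as the
  second.\<close>

lemma pair_op_spec:
  assumes X: "bounded_op (M \<Otimes>\<^sub>M M) X" and ij: "i \<in> {1..N}" "j \<in> {1..N}" "i \<noteq> j"
  shows pair_op_bounded: "bounded_op (Pow_measure M N) (pair_op M N X i j)"
    and pair_op_apply: "\<And>\<phi> \<xi>. \<phi> \<in> L2 (M \<Otimes>\<^sub>M M) \<Longrightarrow> \<xi> \<in> L2 (PiM ({1..N} - {i, j}) (\<lambda>_. M)) \<Longrightarrow>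
      vec_eq (Pow_measure M N)
        (pair_op M N X i j (\<lambda>x. \<phi> (x i, x j) * \<xi> (restrict x ({1..N} - {i, j}))))
        (\<lambda>x. X \<phi> (x i, x j) * \<xi> (restrict x ({1..N} - {i, j})))"
proof -
  interpret F: factorization "M \<Otimes>\<^sub>M M" "PiM ({1..N} - {i, j}) (\<lambda>_. M)" "Pow_measure M N"
      "\<lambda>(x, y). y(i := fst x, j := snd x)" "\<lambda>z. (z i, z j)" "\<lambda>z. restrict z ({1..N} - {i, j})"
    using ij by (intro factorization_PiM_pair) auto
  have c: "countable (PiE ({1..N} - {i, j}) (\<lambda>_. E))"
    by (intro countable_PiE E_countable) auto
  have ex: "\<exists>Y. bounded_op (Pow_measure M N) Y \<and>
        (\<forall>\<phi>\<in>L2 (M \<Otimes>\<^sub>M M). \<forall>\<xi>\<in>L2 (Pi\<^sub>M ({1..N} - {i, j}) (\<lambda>_. M)).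
           vec_eq (Pow_measure M N)
             (Y (\<lambda>x. \<phi> (x i, x j) * \<xi> (restrict x ({1..N} - {i, j}))))
             (\<lambda>x. X \<phi> (x i, x j) * \<xi> (restrict x ({1..N} - {i, j}))))"
    using F.tensor_op_ex[OF tens2_basis prod_fun_basis[OF E_basis E_countable] c X]
    unfolding F.tensor_def[abs_def] by simp
  from someI_ex[OF ex]
  show "bounded_op (Pow_measure M N) (pair_op M N X i j)"
    "\<And>\<phi> \<xi>. \<phi> \<in> L2 (M \<Otimes>\<^sub>M M) \<Longrightarrow> \<xi> \<in> L2 (PiM ({1..N} - {i, j}) (\<lambda>_. M)) \<Longrightarrow>
      vec_eq (Pow_measure M N)
        (pair_op M N X i j (\<lambda>x. \<phi> (x i, x j) * \<xi> (restrict x ({1..N} - {i, j}))))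
        (\<lambda>x. X \<phi> (x i, x j) * \<xi> (restrict x ({1..N} - {i, j})))"
    unfolding pair_op_def by blast+
qed

text \<open>\<open>X\<close> acts on the slots \<open>i\<close> and \<open>j\<close>, the identity
  on the rest. The Kronecker factors stay a product over single slots, so that one of them can be
  extracted later.\<close>

lemma pair_op_matrix:
  assumes X: "bounded_op (M \<Otimes>\<^sub>M M) X" and ij: "i \<in> {1..N}" "j \<in> {1..N}" "i \<noteq> j"
    and \<mu>: "\<mu> \<in> PiE {1..N} (\<lambda>_. E)" and \<nu>: "\<nu> \<in> PiE {1..N} (\<lambda>_. E)"
  shows "l2_inner (Pow_measure M N) (prod_fun {1..N} \<mu>) (pair_op M N X i j (prod_fun {1..N} \<nu>))
    = l2_inner (M \<Otimes>\<^sub>M M) (tens2 (\<mu> i) (\<mu> j)) (X (tens2 (\<nu> i) (\<nu> j)))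
      * (\<Prod>k\<in>{1..N} - {i, j}. if \<mu> k = \<nu> k then 1 else 0)"
proof -
  let ?R = "{1..N} - {i, j}"
  interpret F: factorization "M \<Otimes>\<^sub>M M" "PiM ?R (\<lambda>_. M)" "Pow_measure M N"
      "\<lambda>(x, y). y(i := fst x, j := snd x)" "\<lambda>z. (z i, z j)" "\<lambda>z. restrict z ?R"
    using ij by (intro factorization_PiM_pair) auto
  have t: "prod_fun {1..N} \<kappa> = (\<lambda>x. tens2 (\<kappa> i) (\<kappa> j) (x i, x j) * prod_fun ?R \<kappa> (restrict x ?R))" for \<kappa>
    using prod_fun_pair[OF _ ij] by (simp add: tens2_def)
  have L: "tens2 (\<kappa> i) (\<kappa> j) \<in> L2 (M \<Otimes>\<^sub>M M)" "prod_fun ?R \<kappa> \<in> L2 (PiM ?R (\<lambda>_. M))"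
    if "\<kappa> \<in> PiE {1..N} (\<lambda>_. E)" for \<kappa>
    using that ij by (auto intro!: tens2_L2 prod_fun_L2 E_L2)
  have tt: "prod_fun {1..N} \<kappa> = F.tensor (tens2 (\<kappa> i) (\<kappa> j)) (prod_fun ?R \<kappa>)" for \<kappa>
    by (rule ext) (simp only: t[of \<kappa>] F.tensor_def)
  have pL: "prod_fun {1..N} \<mu> \<in> L2 (Pow_measure M N)" "prod_fun {1..N} \<nu> \<in> L2 (Pow_measure M N)"
    using \<mu> \<nu> by (auto intro: prod_fun_L2_E)
  have XL: "X (tens2 (\<nu> i) (\<nu> j)) \<in> L2 (M \<Otimes>\<^sub>M M)"
    by (rule bounded_op_L2[OF X L(1)[OF \<nu>]])
  have v: "vec_eq (Pow_measure M N) (pair_op M N X i j (prod_fun {1..N} \<nu>))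
      (F.tensor (X (tens2 (\<nu> i) (\<nu> j))) (prod_fun ?R \<nu>))"
    unfolding t[of \<nu>] F.tensor_def[abs_def] by (rule pair_op_apply[OF X ij L[OF \<nu>]])
  have "(\<Prod>k\<in>?R. l2_inner M (\<mu> k) (\<nu> k)) = (\<Prod>k\<in>?R. if \<mu> k = \<nu> k then 1 else 0)"
    using \<mu> \<nu> by (intro prod.cong refl E_inner) auto
  moreover have "l2_inner (PiM ?R (\<lambda>_. M)) (prod_fun ?R \<mu>) (prod_fun ?R \<nu>) = (\<Prod>k\<in>?R. l2_inner M (\<mu> k) (\<nu> k))"
    using \<mu> \<nu> by (intro prod_fun_inner) (auto intro!: E_L2)
  moreover have "l2_inner (Pow_measure M N) (prod_fun {1..N} \<mu>) (F.tensor (X (tens2 (\<nu> i) (\<nu> j))) (prod_fun ?R \<nu>))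
      = l2_inner (M \<Otimes>\<^sub>M M) (tens2 (\<mu> i) (\<mu> j)) (X (tens2 (\<nu> i) (\<nu> j)))
        * l2_inner (PiM ?R (\<lambda>_. M)) (prod_fun ?R \<mu>) (prod_fun ?R \<nu>)"
    unfolding tt[of \<mu>] by (rule F.tensor_inner[OF L(1)[OF \<mu>] L(2)[OF \<mu>] XL L(2)[OF \<nu>]])
  moreover have "l2_inner (Pow_measure M N) (prod_fun {1..N} \<mu>) (pair_op M N X i j (prod_fun {1..N} \<nu>))
      = l2_inner (Pow_measure M N) (prod_fun {1..N} \<mu>) (F.tensor (X (tens2 (\<nu> i) (\<nu> j))) (prod_fun ?R \<nu>))"
    by (rule l2_inner_cong_right[OF pL(1) bounded_op_L2[OF pair_op_bounded[OF X ij] pL(2)]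
        F.tensor_L2[OF XL L(2)[OF \<nu>]] v])
  ultimately show ?thesis by (simp only:)
qed

lemma basis_family_split_basis:
  "a \<in> {1..N} \<Longrightarrow> basis_family (Pow_measure M N) (E \<times> PiE ({1..N} - {a}) (\<lambda>_. E)) (split_basis N a)"
  unfolding split_basis_def[abs_def] by (rule prod_fun_basis_split[OF E_basis E_countable]) auto

lemma upd_PiE: 
  assumes "a \<in> {1..N}" "e \<in> E" "\<mu> \<in> PiE ({1..N} - {a}) (\<lambda>_. E)"
  shows "\<mu>(a := e) \<in> PiE {1..N} (\<lambda>_. E)"
  using PiE_fun_upd[OF assms(2,3), of a] unfolding insert_Diff[OF assms(1)] .

text \<open>Slot \<open>a\<close> is a spectator, so one of the Kronecker factors compares
  \<open>e\<close> with \<open>f\<close>, and what remains does not involve the entries at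
  \<open>a\<close>.\<close>

lemma pair_op_block:
  assumes X: "bounded_op (M \<Otimes>\<^sub>M M) X" and ij: "i \<in> {1..N}" "j \<in> {1..N}" "i \<noteq> j"
    and a: "a \<in> {1..N}" "a \<noteq> i" "a \<noteq> j"
  shows "block_op (Pow_measure M N) E (PiE ({1..N} - {a}) (\<lambda>_. E)) (split_basis N a) (pair_op M N X i j)"
proof -
  let ?R = "{1..N} - {i, j}"
  define y where "y \<mu> \<nu> = l2_inner (M \<Otimes>\<^sub>M M) (tens2 (\<mu> i) (\<mu> j)) (X (tens2 (\<nu> i) (\<nu> j)))
      * (\<Prod>k\<in>?R - {a}. if \<mu> k = \<nu> k then 1 else 0)" for \<mu> \<nu> :: "nat \<Rightarrow> 'a \<Rightarrow> complex"
  have "l2_inner (Pow_measure M N) (split_basis N a (e, \<mu>)) (pair_op M N X i j (split_basis N a (f, \<nu>)))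
      = (if e = f then y \<mu> \<nu> else 0)"
    if "e \<in> E" "f \<in> E" "\<mu> \<in> PiE ({1..N} - {a}) (\<lambda>_. E)" "\<nu> \<in> PiE ({1..N} - {a}) (\<lambda>_. E)" for e f \<mu> \<nu>
  proof -
    have "(\<Prod>k\<in>?R. if (\<mu>(a := e)) k = (\<nu>(a := f)) k then 1 else 0 :: complex)
        = (if e = f then 1 else 0) * (\<Prod>k\<in>?R - {a}. if (\<mu>(a := e)) k = (\<nu>(a := f)) k then 1 else 0)"
      using a by (subst prod.remove[of ?R a]) auto
    also have "(\<Prod>k\<in>?R - {a}. if (\<mu>(a := e)) k = (\<nu>(a := f)) k then 1 else 0 :: complex)
        = (\<Prod>k\<in>?R - {a}. if \<mu> k = \<nu> k then 1 else 0)"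
      by (intro prod.cong) auto
    finally show ?thesis
      unfolding split_basis_def fst_conv snd_conv
        pair_op_matrix[OF X ij upd_PiE[OF a(1) that(1,3)] upd_PiE[OF a(1) that(2,4)]] y_def
      using a by (simp del: prod_eq_1_iff prod.neutral)
  qed
  then show ?thesis
    unfolding block_op_def using pair_op_bounded[OF X ij] by blast
qed

text \<open>The vanishing partial trace of \<gamma>\<open>X\<close>, lifted to all slots. The
  alternatives in \<open>a\<close> concern two-body matrix elements only: for \<open>a = i\<close>
  each term vanishes, for \<open>a = j\<close> only the weighted sum does. The spectator slots
  contribute the constant factor \<open>d\<close>.\<close>

lemma pair_op_trace_factor:
  assumes X: "bounded_op (M \<Otimes>\<^sub>M M) X" and ij: "i \<in> {1..N}" "j \<in> {1..N}" "i \<noteq> j"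
    and a: "a = i \<and> (\<forall>e\<in>E. \<forall>f\<in>E. \<forall>g\<in>E. l2_inner (M \<Otimes>\<^sub>M M) (tens2 e f) (X (tens2 e g)) = 0) \<or>
      a = j \<and> (\<forall>f\<in>E. \<forall>g\<in>E. ((\<lambda>e. of_real (ev e) * l2_inner (M \<Otimes>\<^sub>M M) (tens2 f e) (X (tens2 g e))) has_sum 0) E)"
    and \<mu>: "\<mu> \<in> PiE ({1..N} - {a}) (\<lambda>_. E)" and \<nu>: "\<nu> \<in> PiE ({1..N} - {a}) (\<lambda>_. E)"
  shows "((\<lambda>e. of_real (ev e) * l2_inner (Pow_measure M N) (split_basis N a (e, \<mu>))
      (pair_op M N X i j (split_basis N a (e, \<nu>)))) has_sum 0) E"
proof -
  let ?R = "{1..N} - {i, j}"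
  have aN: "a \<in> {1..N}" using a ij by auto
  have aR: "a \<notin> ?R" using a by auto
  define d :: complex where "d = (\<Prod>k\<in>?R. if \<mu> k = \<nu> k then 1 else 0)"
  have eq: "l2_inner (Pow_measure M N) (split_basis N a (e, \<mu>)) (pair_op M N X i j (split_basis N a (e, \<nu>)))
      = l2_inner (M \<Otimes>\<^sub>M M) (tens2 ((\<mu>(a := e)) i) ((\<mu>(a := e)) j)) (X (tens2 ((\<nu>(a := e)) i) ((\<nu>(a := e)) j))) * d"
    if "e \<in> E" for e
  proof -
    have "(\<Prod>k\<in>?R. if (\<mu>(a := e)) k = (\<nu>(a := e)) k then 1 else 0) = d"
      unfolding d_def using aR by (intro prod.cong) auto
    then show ?thesis
      unfolding split_basis_def fst_conv snd_conv
        pair_op_matrix[OF X ij upd_PiE[OF aN that \<mu>] upd_PiE[OF aN that \<nu>]] by simp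
  qed
  from a show ?thesis
  proof (elim disjE conjE)
    assume ai: "a = i" and zero: "\<forall>e\<in>E. \<forall>f\<in>E. \<forall>g\<in>E. l2_inner (M \<Otimes>\<^sub>M M) (tens2 e f) (X (tens2 e g)) = 0"
    have "j \<in> {1..N} - {a}" using ij ai by simp
    then have "\<mu> j \<in> E" "\<nu> j \<in> E" by (rule PiE_mem[OF \<mu>], rule PiE_mem[OF \<nu>])
    then have "l2_inner (Pow_measure M N) (split_basis N a (e, \<mu>)) (pair_op M N X i j (split_basis N a (e, \<nu>))) = 0"
      if "e \<in> E" for e
      unfolding eq[OF that] using zero ij(3) ai that by simp
    then show ?thesis by (intro has_sum_0) simp
  next
    assume aj: "a = j" and zero: "\<forall>f\<in>E. \<forall>g\<in>E. ((\<lambda>e. of_real (ev e) * l2_inner (M \<Otimes>\<^sub>M M) (tens2 f e) (X (tens2 g e))) has_sum 0) E"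
    have "i \<in> {1..N} - {a}" using ij aj by simp
    then have "\<mu> i \<in> E" "\<nu> i \<in> E" by (rule PiE_mem[OF \<mu>], rule PiE_mem[OF \<nu>])
    then have "((\<lambda>e. of_real (ev e) * l2_inner (M \<Otimes>\<^sub>M M) (tens2 (\<mu> i) e) (X (tens2 (\<nu> i) e)) * d) has_sum 0 * d) E"
      using zero by (intro has_sum_cmult_left) auto
    then show ?thesis
    proof (rule has_sum_eq_trans)
      fix e assume e: "e \<in> E"
      show "of_real (ev e) * l2_inner (M \<Otimes>\<^sub>M M) (tens2 (\<mu> i) e) (X (tens2 (\<nu> i) e)) * d
        = of_real (ev e) * l2_inner (Pow_measure M N) (split_basis N a (e, \<mu>)) (pair_op M N X i j (split_basis N a (e, \<nu>)))"
        unfolding eq[OF e] using ij(3) aj by (simp add: mult.assoc)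
    qed simp
  qed
qed

text \<open>Both cases of the theorem in common form: \<open>a\<close> is the particle label that
  occurs once, \<open>n\<close> the position of the factor containing it.\<close>

lemma has_trace_pair_op_product:
  assumes X: "bounded_op (M \<Otimes>\<^sub>M M) X"
    and ij: "\<And>\<nu>. \<nu> \<in> {1..m} \<Longrightarrow> i \<nu> \<in> {1..N} \<and> j \<nu> \<in> {1..N} \<and> i \<nu> \<noteq> j \<nu>"
    and n: "n \<in> {1..m}"
    and a: "a = i n \<and> (\<forall>e\<in>E. \<forall>f\<in>E. \<forall>g\<in>E. l2_inner (M \<Otimes>\<^sub>M M) (tens2 e f) (X (tens2 e g)) = 0) \<or>
      a = j n \<and> (\<forall>f\<in>E. \<forall>g\<in>E. ((\<lambda>e. of_real (ev e) * l2_inner (M \<Otimes>\<^sub>M M) (tens2 f e) (X (tens2 g e))) has_sum 0) E)"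
    and other: "\<And>\<nu>. \<nu> \<in> {1..m} \<Longrightarrow> \<nu> \<noteq> n \<Longrightarrow> a \<noteq> i \<nu> \<and> a \<noteq> j \<nu>"
  shows "has_trace (Pow_measure M N) (tensor_power_op M N \<gamma> \<circ> pair_op_product M N X m i j) 0"
proof -
  define Y where "Y \<nu> = pair_op M N X (i \<nu>) (j \<nu>)" for \<nu>
  define prd where "prd ns = foldr (\<lambda>\<nu> T. Y \<nu> \<circ> T) ns id" for ns
  let ?K = "PiE ({1..N} - {a}) (\<lambda>_. E)"
  have aN: "a \<in> {1..N}" using a ij[OF n] by auto
  note b = basis_family_split_basis[OF aN]
  have blk: "block_op (Pow_measure M N) E ?K (split_basis N a) (prd ns)"
    if "set ns \<subseteq> {1..m} - {n}" for ns
    using that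
  proof (induction ns)
    case Nil
    show ?case unfolding prd_def foldr_Nil id_def by (rule block_op_id[OF b, unfolded id_def])
  next
    case (Cons \<nu> ns)
    have "block_op (Pow_measure M N) E ?K (split_basis N a) (Y \<nu>)"
      unfolding Y_def using Cons.prems ij[of \<nu>] other[of \<nu>] by (intro pair_op_block X aN) auto
    then have "block_op (Pow_measure M N) E ?K (split_basis N a) (Y \<nu> \<circ> prd ns)"
      using Cons by (intro block_op_comp[OF b]) auto
    then show ?case by (simp add: prd_def comp_def)
  qed
  \<comment> \<open>The product is cut at the only factor touching slot \<open>a\<close>; the
    products on either side avoid that slot and are block operators.\<close>
  have list: "[1..<Suc m] = [1..<n] @ n # [Suc n..<Suc m]"
    using n upt_add_eq_append[of 1 n "Suc m - n"] upt_conv_Cons[of n "Suc m"] by simp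
  have split: "pair_op_product M N X m i j = prd [1..<n] \<circ> Y n \<circ> prd [Suc n..<Suc m]"
    unfolding pair_op_product_def Y_def[symmetric] prd_def list foldr_append foldr_Cons comp_def
    by (rule foldr_comp_id[unfolded comp_def])
  show ?thesis
    unfolding split
  proof (rule has_trace_block_zero[OF b blk blk _ tensor_power_op_bounded, where w = ev and v = "weight ({1..N} - {a})"])
    show "set [1..<n] \<subseteq> {1..m} - {n}" "set [Suc n..<Suc m] \<subseteq> {1..m} - {n}" using n by auto
    show "bounded_op (Pow_measure M N) (Y n)" unfolding Y_def using ij[OF n] by (intro pair_op_bounded X) auto
    show "ev summable_on E" by (rule has_sum_imp_summable[OF ev_sum])
    show "weight ({1..N} - {a}) summable_on ?K" by (rule weight_summable) auto
    show "0 \<le> weight ({1..N} - {a}) \<mu>" if "\<mu> \<in> ?K" for \<mu> by (rule weight_nonneg[OF that])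
    show "0 \<le> ev e" if "e \<in> E" for e by (rule ev_nonneg[OF that])
  next
    fix F e \<mu> assume F: "F \<in> L2 (Pow_measure M N)" and e: "e \<in> E" and \<mu>: "\<mu> \<in> ?K"
    have "weight {1..N} (\<mu>(a := e)) = ev e * weight ({1..N} - {a}) \<mu>"
      unfolding weight_def using aN by (subst prod.remove[of _ a]) (auto intro!: prod.cong)
    then show "l2_inner (Pow_measure M N) F (tensor_power_op M N \<gamma> (split_basis N a (e, \<mu>)))
        = of_real (ev e * weight ({1..N} - {a}) \<mu>) * l2_inner (Pow_measure M N) F (split_basis N a (e, \<mu>))"
      unfolding split_basis_def fst_conv snd_conv
      using tensor_power_op_diagonal[OF F upd_PiE[OF aN e \<mu>]] by simp
  next
    fix \<mu> \<nu> assume "\<mu> \<in> ?K" "\<nu> \<in> ?K"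
    then show "((\<lambda>e. of_real (ev e) * l2_inner (Pow_measure M N) (split_basis N a (e, \<mu>))
        (Y n (split_basis N a (e, \<nu>)))) has_sum 0) E"
      unfolding Y_def using ij[OF n] a by (intro pair_op_trace_factor X) auto
  qed
qed

end

section \<open>The one-body density\<close>

lemma norm_integral_le:
  fixes f :: "'a \<Rightarrow> 'b::{banach, second_countable_topology}"
  assumes g: "integrable M g" and le: "AE x in M. norm (f x) \<le> g x"
  shows "norm (\<integral>x. f x \<partial>M) \<le> (\<integral>x. g x \<partial>M)"
proof (rule order_trans[OF integral_norm_bound])
  have "AE x in M. 0 \<le> g x"
    using le by eventually_elim (rule order_trans[OF norm_ge_zero])
  then show "(\<integral>x. norm (f x) \<partial>M) \<le> (\<integral>x. g x \<partial>M)"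
    by (rule integral_mono_AE'[OF g le])
qed

context sigma_finite_measure
begin

text \<open>Licenses Fubini for the averages of the potential, where \<open>f\<close> is a product
  of two eigenfunctions in the first variable and \<open>g\<close> a density in the second.\<close>

lemma integrable_product_weight:
  fixes f :: "'a \<Rightarrow> complex" and g :: "'a \<Rightarrow> real" and W :: "'a \<times> 'a \<Rightarrow> real"
  assumes f: "integrable M f" and g: "integrable M g"
    and W [measurable]: "W \<in> borel_measurable (M \<Otimes>\<^sub>M M)" and c: "\<And>z. \<bar>W z\<bar> \<le> c"
  shows "integrable (M \<Otimes>\<^sub>M M) (\<lambda>z. f (fst z) * of_real (W z * g (snd z)))"
proof (rule integrableI_bounded)
  have [measurable]: "f \<in> borel_measurable M" "g \<in> borel_measurable M" using f g by auto
  show "(\<lambda>z. f (fst z) * of_real (W z * g (snd z))) \<in> borel_measurable (M \<Otimes>\<^sub>M M)" by measurable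
  have c0: "0 \<le> c" using c[of undefined] by linarith
  have "(\<integral>\<^sup>+z. ennreal (norm (f (fst z) * of_real (W z * g (snd z)))) \<partial>(M \<Otimes>\<^sub>M M))
      \<le> (\<integral>\<^sup>+z. ennreal (norm (f (fst z))) * (ennreal c * ennreal (norm (g (snd z)))) \<partial>(M \<Otimes>\<^sub>M M))"
  proof (rule nn_integral_mono)
    fix z :: "'a \<times> 'a"
    have "norm (f (fst z)) * (\<bar>W z\<bar> * \<bar>g (snd z)\<bar>) \<le> norm (f (fst z)) * (c * \<bar>g (snd z)\<bar>)"
      by (intro mult_left_mono mult_right_mono c) auto
    then have "ennreal (norm (f (fst z) * of_real (W z * g (snd z)))) \<le> ennreal (norm (f (fst z)) * (c * \<bar>g (snd z)\<bar>))"
      by (intro ennreal_leI) (simp add: norm_mult abs_mult)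
    also have "\<dots> = ennreal (norm (f (fst z))) * (ennreal c * ennreal (norm (g (snd z))))"
      using c0 by (simp add: ennreal_mult)
    finally show "ennreal (norm (f (fst z) * of_real (W z * g (snd z))))
      \<le> ennreal (norm (f (fst z))) * (ennreal c * ennreal (norm (g (snd z))))" .
  qed
  also have "\<dots> = (\<integral>\<^sup>+x. \<integral>\<^sup>+y. ennreal (norm (f x)) * (ennreal c * ennreal (norm (g y))) \<partial>M \<partial>M)"
    by (subst nn_integral_fst[symmetric]) simp_all
  also have "\<dots> = (\<integral>\<^sup>+x. ennreal (norm (f x)) \<partial>M) * (ennreal c * (\<integral>\<^sup>+y. ennreal (norm (g y)) \<partial>M))"
    by (simp add: nn_integral_cmult nn_integral_multc)
  also have "\<dots> < \<infinity>"
    using f g by (auto simp: integrable_iff_bounded ennreal_mult_less_top)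
  finally show "(\<integral>\<^sup>+z. ennreal (norm (f (fst z) * of_real (W z * g (snd z)))) \<partial>(M \<Otimes>\<^sub>M M)) < \<infinity>" .
qed

end

section \<open>Integrability of the one-body density\<close>

lemma abs_summable_on_real_iff:
  fixes f :: "'i \<Rightarrow> real"
  shows "Infinite_Set_Sum.abs_summable_on f I \<longleftrightarrow> f summable_on I"
  using abs_summable_equivalent[of f I] summable_on_iff_abs_summable_on_real[of f I] by simp

text \<open>Both sides are 0 by convention when the family is not summable. In this unconditional
  form it gives access to parametrized integrals, and thereby to the measurability of
  \<rho>.\<close>

lemma infsum_eq_integral_count_space:
  fixes f :: "'i \<Rightarrow> real"
  shows "infsum f I = (\<integral>i. f i \<partial>count_space I)"
proof (cases "f summable_on I")
  case True
  then have "Infinite_Set_Sum.abs_summable_on f I"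
    by (simp add: abs_summable_on_real_iff)
  from infsetsum_infsum[OF this] show ?thesis by (simp add: infsetsum_def)
next
  case False
  then have "\<not> Infinite_Set_Sum.abs_summable_on f I"
    by (simp add: abs_summable_on_real_iff)
  then show ?thesis
    using False by (simp add: infsum_not_exists abs_summable_on_def not_integrable_integral_eq)
qed

context faithful_density
begin

abbreviation "\<rho> \<equiv> one_body_density M \<gamma>"

lemma density_eq_infsum: "\<rho> y = (\<Sum>\<^sub>\<infinity>e\<in>E. ev e * (cmod (e y))\<^sup>2)"
proof -
  have "of_real (ev e) * e y * cnj (e y) = complex_of_real (ev e * (cmod (e y))\<^sup>2)" for e
    by (simp add: complex_norm_square[symmetric] mult.assoc flip: of_real_mult of_real_power)
  then have "\<rho> y = Re (\<Sum>\<^sub>\<infinity>e\<in>E. complex_of_real (ev e * (cmod (e y))\<^sup>2))"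
    unfolding one_body_density_def integral_kernel_def by (simp only:)
  also have "(\<Sum>\<^sub>\<infinity>e\<in>E. complex_of_real (ev e * (cmod (e y))\<^sup>2)) = of_real (\<Sum>\<^sub>\<infinity>e\<in>E. ev e * (cmod (e y))\<^sup>2)"
  proof (cases "(\<lambda>e. ev e * (cmod (e y))\<^sup>2) summable_on E")
    case True
    then show ?thesis by (intro infsumI has_sum_of_real has_sum_infsum)
  next
    case False
    then have "\<not> (\<lambda>e. complex_of_real (ev e * (cmod (e y))\<^sup>2)) summable_on E"
      using summable_on_Re[of "\<lambda>e. complex_of_real (ev e * (cmod (e y))\<^sup>2)" E] by auto
    with False show ?thesis by (simp add: infsum_not_exists)
  qed
  finally show ?thesis by simp
qed

lemma joint_measurable:
  "(\<lambda>(y, e). ev e * (cmod (e y))\<^sup>2) \<in> borel_measurable (M \<Otimes>\<^sub>M count_space E)"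
proof -
  have "(\<lambda>(e, y). ev e * (cmod (e y))\<^sup>2) \<in> borel_measurable (count_space E \<Otimes>\<^sub>M M)"
  proof (rule measurable_pair_measure_countable1[OF E_countable])
    fix e assume "e \<in> E"
    then have [measurable]: "e \<in> borel_measurable M" by (intro L2_measurable E_L2)
    show "(\<lambda>y. case (e, y) of (e, y) \<Rightarrow> ev e * (cmod (e y))\<^sup>2) \<in> borel_measurable M" by simp
  qed
  from measurable_pair_swap[OF this] show ?thesis by (simp add: case_prod_beta)
qed

lemma density_measurable [measurable]: "\<rho> \<in> borel_measurable M"
proof -
  interpret C: sigma_finite_measure "count_space E"
    by (rule sigma_finite_measure_count_space_countable[OF E_countable])
  have "(\<lambda>y. \<integral>e. ev e * (cmod (e y))\<^sup>2 \<partial>count_space E) \<in> borel_measurable M"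
    by (rule C.borel_measurable_lebesgue_integral[OF joint_measurable])
  then show ?thesis
    by (subst measurable_cong[where g = "\<lambda>y. \<integral>e. ev e * (cmod (e y))\<^sup>2 \<partial>count_space E"])
      (simp_all only: density_eq_infsum infsum_eq_integral_count_space)
qed

lemma one_body_density_nonneg: "0 \<le> \<rho> y"
  unfolding density_eq_infsum by (intro infsum_nonneg mult_nonneg_nonneg ev_nonneg) auto

text \<open>Tonelli over the countable basis, whose vectors are normalized, turns the total mass
  into the trace of \<gamma>. The sum is taken in the extended nonnegative reals because \<rho>
  itself drops to 0 where it diverges.\<close>

lemma density_nn_integral: "(\<integral>\<^sup>+y. (\<integral>\<^sup>+e. ennreal (ev e * (cmod (e y))\<^sup>2) \<partial>count_space E) \<partial>M) = 1"
proof -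
  have "(\<integral>\<^sup>+y. (\<integral>\<^sup>+e. ennreal (ev e * (cmod (e y))\<^sup>2) \<partial>count_space E) \<partial>M)
      = (\<integral>\<^sup>+e. (\<integral>\<^sup>+y. ennreal (ev e * (cmod (e y))\<^sup>2) \<partial>M) \<partial>count_space E)"
    by (rule nn_integral_count_space_nn_integral[OF E_countable])
      (auto dest!: E_L2 L2_measurable)
  also have "\<dots> = (\<integral>\<^sup>+e. ennreal (ev e) \<partial>count_space E)"
  proof (rule nn_integral_cong)
    fix e assume "e \<in> space (count_space E)"
    then have e: "e \<in> E" by simp
    have [measurable]: "e \<in> borel_measurable M" using e by (intro L2_measurable E_L2)
    show "(\<integral>\<^sup>+y. ennreal (ev e * (cmod (e y))\<^sup>2) \<partial>M) = ennreal (ev e)"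
      using ev_nonneg[OF e] ortho_family_norm[OF basis_family_ortho[OF E_basis] e]
      by (simp add: ennreal_mult nn_integral_cmult nn_integral_L2[OF E_L2[OF e]])
  qed
  also have "\<dots> = ennreal (\<integral>e. ev e \<partial>count_space E)"
  proof (rule nn_integral_eq_integral)
    have "ev summable_on E" by (rule has_sum_imp_summable[OF ev_sum])
    then have "Infinite_Set_Sum.abs_summable_on ev E"
      by (simp add: abs_summable_on_real_iff)
    then show "integrable (count_space E) ev" by (simp add: abs_summable_on_def)
    show "AE e in count_space E. 0 \<le> ev e" by (auto simp: AE_count_space ev_nonneg)
  qed
  also have "\<dots> = 1"
    using infsumI[OF ev_sum] infsum_eq_integral_count_space[of ev E] by simp
  finally show ?thesis .
qed

text \<open>A nonnegative function of finite integral is finite almost everywhere, so the default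
  value of \<rho> occurs only on a null set.\<close>

lemma density_AE_summable: "AE y in M. (\<lambda>e. ev e * (cmod (e y))\<^sup>2) summable_on E \<and>
  ennreal (\<rho> y) = (\<integral>\<^sup>+e. ennreal (ev e * (cmod (e y))\<^sup>2) \<partial>count_space E)"
proof -
  interpret C: sigma_finite_measure "count_space E"
    by (rule sigma_finite_measure_count_space_countable[OF E_countable])
  have [measurable]: "(\<lambda>(y, e). ennreal (ev e * (cmod (e y))\<^sup>2)) \<in> borel_measurable (M \<Otimes>\<^sub>M count_space E)"
    using measurable_compose[OF joint_measurable measurable_ennreal] by (simp add: case_prod_beta)
  have "(\<lambda>y. \<integral>\<^sup>+e. ennreal (ev e * (cmod (e y))\<^sup>2) \<partial>count_space E) \<in> borel_measurable M"
    by (rule C.borel_measurable_nn_integral) measurable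
  then have "AE y in M. (\<integral>\<^sup>+e. ennreal (ev e * (cmod (e y))\<^sup>2) \<partial>count_space E) \<noteq> \<infinity>"
    by (rule nn_integral_PInf_AE) (simp add: density_nn_integral)
  then show ?thesis
  proof (rule AE_mp, intro AE_I2 impI)
    fix y assume fin: "(\<integral>\<^sup>+e. ennreal (ev e * (cmod (e y))\<^sup>2) \<partial>count_space E) \<noteq> \<infinity>"
    have nn: "AE e in count_space E. 0 \<le> ev e * (cmod (e y))\<^sup>2"
      by (auto simp: AE_count_space ev_nonneg)
    have "(\<integral>\<^sup>+e. ennreal (ev e * (cmod (e y))\<^sup>2) \<partial>count_space E) < \<infinity>"
      using fin by (simp only: less_top infinity_ennreal_def)
    then have int: "integrable (count_space E) (\<lambda>e. ev e * (cmod (e y))\<^sup>2)"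
      by (rule integrableI_nonneg[OF _ nn, rotated]) simp
    then have "Infinite_Set_Sum.abs_summable_on (\<lambda>e. ev e * (cmod (e y))\<^sup>2) E"
      by (simp add: abs_summable_on_def)
    then have "(\<lambda>e. ev e * (cmod (e y))\<^sup>2) summable_on E"
      by (simp add: abs_summable_on_real_iff)
    then show "(\<lambda>e. ev e * (cmod (e y))\<^sup>2) summable_on E \<and>
      ennreal (\<rho> y) = (\<integral>\<^sup>+e. ennreal (ev e * (cmod (e y))\<^sup>2) \<partial>count_space E)"
      unfolding density_eq_infsum infsum_eq_integral_count_space nn_integral_eq_integral[OF int nn] by simp
  qed
qed

lemma density_integrable: "integrable M \<rho>" and density_integral: "(\<integral>y. \<rho> y \<partial>M) = 1"
proof -
  have nn: "(\<integral>\<^sup>+y. ennreal (\<rho> y) \<partial>M) = 1"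
    unfolding density_nn_integral[symmetric]
    by (rule nn_integral_cong_AE) (use density_AE_summable in eventually_elim, simp)
  then show "integrable M \<rho>"
    by (intro integrableI_nonneg) (auto simp: one_body_density_nonneg)
  show "(\<integral>y. \<rho> y \<partial>M) = 1"
    using integral_eq_nn_integral[of \<rho> M] nn by (simp add: one_body_density_nonneg)
qed

lemma density_partial_sum_le:
  assumes "finite T" "T \<subseteq> E"
  shows "AE y in M. (\<Sum>e\<in>T. ev e * (cmod (e y))\<^sup>2) \<le> \<rho> y"
  using density_AE_summable
proof eventually_elim
  case (elim y)
  then show ?case
    unfolding density_eq_infsum using assms by (intro finite_sum_le_infsum) (auto simp: ev_nonneg)
qed

text \<open>This is the cancellation behind case (2): the partial trace of \<open>(1 \<otimes> \<gamma>) V\<close> over the second factor is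
  multiplication by \<open>V * \<rho>\<close>, which is what is subtracted from \<open>V\<close>.\<close>

lemma fluctuation_average_zero:
  fixes V :: "'a \<times> 'a \<Rightarrow> real" and h :: "'a \<Rightarrow> complex"
  assumes V [measurable]: "V \<in> borel_measurable (M \<Otimes>\<^sub>M M)" and v: "\<And>z. \<bar>V z\<bar> \<le> v" and h: "integrable M h"
    and U: "\<And>x. U x = (\<integral>y. V (x, y) * \<rho> y \<partial>M)"
  shows "((\<lambda>e. of_real (ev e) * (\<integral>z. h (fst z) * of_real ((V z - U (fst z)) * (cmod (e (snd z)))\<^sup>2) \<partial>(M \<Otimes>\<^sub>M M)))
    has_sum 0) E"
proof -
  note ipw = integrable_product_weight
  interpret pair_sigma_finite M M
    by (intro pair_sigma_finite.intro sigma_finite_measure_axioms)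
  have [measurable]: "h \<in> borel_measurable M" using h by auto
  have v0: "0 \<le> v" using v[of undefined] by linarith
  have Vint: "integrable M (\<lambda>y. V (x, y) * \<rho> y)" if "x \<in> space M" for x
  proof (rule Bochner_Integration.integrable_bound[of M "\<lambda>y. v * \<rho> y"])
    show "integrable M (\<lambda>y. v * \<rho> y)" using density_integrable by simp
    show "(\<lambda>y. V (x, y) * \<rho> y) \<in> borel_measurable M" using that by measurable
    show "AE y in M. norm (V (x, y) * \<rho> y) \<le> norm (v * \<rho> y)"
      using v v0 one_body_density_nonneg by (auto simp: abs_mult intro!: mult_right_mono)
  qed
  have Uabs: "\<bar>U x\<bar> \<le> v" for x
  proof -
    have "\<bar>U x\<bar> \<le> (\<integral>y. v * \<rho> y \<partial>M)"
      unfolding U real_norm_def[symmetric]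
    proof (rule norm_integral_le)
      show "integrable M (\<lambda>y. v * \<rho> y)" using density_integrable by simp
      show "AE y in M. norm (V (x, y) * \<rho> y) \<le> v * \<rho> y"
        using v one_body_density_nonneg by (auto simp: abs_mult intro!: mult_right_mono)
    qed
    then show ?thesis using density_integral by simp
  qed
  have [measurable]: "U \<in> borel_measurable M" unfolding U[abs_def] by measurable
  define W where "W z = V z - U (fst z)" for z
  have Wm [measurable]: "W \<in> borel_measurable (M \<Otimes>\<^sub>M M)" unfolding W_def[abs_def] by measurable
  have W: "\<bar>W z\<bar> \<le> 2 * v" for z
    unfolding W_def using v[of z] Uabs[of "fst z"] by linarith
  \<comment> \<open>With the first variable integrated out, the functional \<open>J\<close> below is
    integration against the bounded function \<open>k\<close>; \<open>c\<close> bounds it because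
    \<bar>\<open>W\<close>\<bar> is at most \<open>2 * v\<close>.\<close>
  define k where "k y = (\<integral>x. h x * of_real (W (x, y)) \<partial>M)" for y
  have [measurable]: "k \<in> borel_measurable M" unfolding k_def[abs_def] by measurable
  define c where "c = 2 * v * (\<integral>x. norm (h x) \<partial>M)"
  have c0: "0 \<le> c" using v0 by (simp add: c_def integral_nonneg_AE)
  have k: "norm (k y) \<le> c" for y
  proof -
    have "norm (k y) \<le> (\<integral>x. norm (h x) * (2 * v) \<partial>M)"
      unfolding k_def
    proof (rule norm_integral_le)
      show "integrable M (\<lambda>x. norm (h x) * (2 * v))" using h by simp
      show "AE x in M. norm (h x * of_real (W (x, y))) \<le> norm (h x) * (2 * v)"
        using W by (auto simp: norm_mult intro!: mult_left_mono)
    qed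
    then show ?thesis by (simp add: c_def mult.commute)
  qed
  define J where "J g = (\<integral>z. h (fst z) * of_real (W z * g (snd z)) \<partial>(M \<Otimes>\<^sub>M M))" for g :: "'a \<Rightarrow> real"
  have J: "J g = (\<integral>y. k y * of_real (g y) \<partial>M)" if g: "integrable M g" for g
  proof -
    have "J g = (\<integral>x. \<integral>y. h x * of_real (W (x, y) * g y) \<partial>M \<partial>M)"
      unfolding J_def using integral_fst'[OF ipw[OF h g Wm W]] by simp
    also have "\<dots> = (\<integral>y. \<integral>x. h x * of_real (W (x, y) * g y) \<partial>M \<partial>M)"
    proof (rule Fubini_integral[symmetric])
      show "integrable (M \<Otimes>\<^sub>M M) (\<lambda>(x, y). h x * of_real (W (x, y) * g y))"
        using ipw[OF h g Wm W] unfolding case_prod_unfold by simp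
    qed
    also have "\<dots> = (\<integral>y. \<integral>x. (h x * of_real (W (x, y))) * of_real (g y) \<partial>M \<partial>M)"
      by (simp add: mult.assoc)
    finally show ?thesis unfolding k_def by simp
  qed
  have kint: "integrable M (\<lambda>y. k y * of_real (g y))" if g: "integrable M g" for g :: "'a \<Rightarrow> real"
  proof (rule Bochner_Integration.integrable_bound[of M "\<lambda>y. c * g y"])
    have [measurable]: "g \<in> borel_measurable M" using g by auto
    show "integrable M (\<lambda>y. c * g y)" using g by simp
    show "(\<lambda>y. k y * of_real (g y)) \<in> borel_measurable M" by measurable
    show "AE y in M. norm (k y * of_real (g y)) \<le> norm (c * g y)"
      using k c0 by (auto simp: norm_mult abs_mult intro!: mult_right_mono)
  qed
  \<comment> \<open>For fixed \<open>x\<close> the integral of \<open>W\<close> against \<rho> is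
    \<open>U x\<close> minus \<open>U x\<close> times the total mass, and the mass is 1.\<close>
  have J0: "J \<rho> = 0"
  proof -
    have "J \<rho> = (\<integral>x. \<integral>y. h x * of_real (W (x, y) * \<rho> y) \<partial>M \<partial>M)"
      unfolding J_def using integral_fst'[OF ipw[OF h density_integrable Wm W]] by simp
    also have "\<dots> = (\<integral>x. 0 \<partial>M)"
    proof (intro Bochner_Integration.integral_cong refl)
      fix x assume x: "x \<in> space M"
      have "(\<integral>y. W (x, y) * \<rho> y \<partial>M) = (\<integral>y. V (x, y) * \<rho> y - U x * \<rho> y \<partial>M)"
        by (simp add: W_def left_diff_distrib)
      also have "\<dots> = 0"
        using Vint[OF x] density_integrable density_integral by (simp add: U[of x])
      finally show "(\<integral>y. h x * of_real (W (x, y) * \<rho> y) \<partial>M) = 0"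
        by (simp del: of_real_mult)
    qed
    finally show ?thesis by simp
  qed
  have esq: "integrable M (\<lambda>y. (cmod (e y))\<^sup>2)" if "e \<in> E" for e
    by (rule L2_norm_integrable[OF E_L2[OF that]])
  \<comment> \<open>The partial sum is \<open>J\<close> of a truncated density \<open>g\<close>
    below \<rho>. Subtracting \<open>J \<rho> = 0\<close> leaves the missing part of \<rho>, whose
    mass \<open>1 - sum ev T\<close> tends to 0.\<close>
  have bound: "norm (\<Sum>e\<in>T. of_real (ev e) * J (\<lambda>y. (cmod (e y))\<^sup>2)) \<le> c * (1 - sum ev T)"
    if T: "finite T" "T \<subseteq> E" for T
  proof -
    define g where "g y = (\<Sum>e\<in>T. ev e * (cmod (e y))\<^sup>2)" for y
    have gi: "integrable M g" unfolding g_def[abs_def] using T esq by (intro Bochner_Integration.integrable_sum) auto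
    have gI: "(\<integral>y. g y \<partial>M) = sum ev T"
    proof -
      have "(\<integral>y. g y \<partial>M) = (\<Sum>e\<in>T. \<integral>y. ev e * (cmod (e y))\<^sup>2 \<partial>M)"
        unfolding g_def using T esq by (intro Bochner_Integration.integral_sum) auto
      also have "\<dots> = (\<Sum>e\<in>T. ev e * (l2_norm M e)\<^sup>2)" by (simp add: l2_norm_power2)
      also have "\<dots> = sum ev T"
        using T ortho_family_norm[OF basis_family_ortho[OF E_basis]] by (intro sum.cong) auto
      finally show ?thesis .
    qed
    have "(\<Sum>e\<in>T. of_real (ev e) * J (\<lambda>y. (cmod (e y))\<^sup>2))
        = (\<Sum>e\<in>T. \<integral>y. of_real (ev e) * (k y * of_real ((cmod (e y))\<^sup>2)) \<partial>M)"
      using T esq by (intro sum.cong refl) (auto simp: J)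
    also have "\<dots> = (\<integral>y. (\<Sum>e\<in>T. of_real (ev e) * (k y * of_real ((cmod (e y))\<^sup>2))) \<partial>M)"
      by (intro Bochner_Integration.integral_sum[symmetric] integrable_mult_right kint esq) (use T in auto)
    also have "\<dots> = (\<integral>y. k y * of_real (g y) \<partial>M)"
      by (intro Bochner_Integration.integral_cong refl) (simp add: g_def sum_distrib_left mult_ac)
    also have "\<dots> = (\<integral>y. k y * of_real (g y) \<partial>M) - (\<integral>y. k y * of_real (\<rho> y) \<partial>M)"
      using J0 J[OF density_integrable] by simp
    also have "\<dots> = (\<integral>y. k y * of_real (g y - \<rho> y) \<partial>M)"
      using kint[OF gi] kint[OF density_integrable] by (simp add: right_diff_distrib)
    also have "norm \<dots> \<le> (\<integral>y. c * (\<rho> y - g y) \<partial>M)"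
    proof (rule norm_integral_le)
      show "integrable M (\<lambda>y. c * (\<rho> y - g y))" using gi density_integrable by simp
      show "AE y in M. norm (k y * of_real (g y - \<rho> y)) \<le> c * (\<rho> y - g y)"
        using density_partial_sum_le[OF T]
      proof eventually_elim
        case (elim y)
        then have "norm (complex_of_real (g y - \<rho> y)) = \<rho> y - g y" unfolding norm_of_real g_def by simp
        then show ?case
          using k[of y] elim unfolding norm_mult g_def by (simp add: mult_right_mono)
      qed
    qed
    also have "\<dots> = c * (1 - sum ev T)"
      using gi density_integrable by (simp add: gI density_integral)
    finally show ?thesis .
  qed
  have "(sum ev \<longlongrightarrow> 1) (finite_subsets_at_top E)" using ev_sum by (simp add: has_sum_def)
  then have "((\<lambda>T. c * (1 - sum ev T)) \<longlongrightarrow> c * (1 - 1)) (finite_subsets_at_top E)"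
    by (intro tendsto_intros)
  then have "((\<lambda>T. c * (1 - sum ev T)) \<longlongrightarrow> 0) (finite_subsets_at_top E)" by simp
  then have "((\<lambda>T. \<Sum>e\<in>T. of_real (ev e) * J (\<lambda>y. (cmod (e y))\<^sup>2)) \<longlongrightarrow> 0) (finite_subsets_at_top E)"
    by (rule Lim_null_comparison[rotated]) (auto intro!: eventually_finite_subsets_at_top_weakI bound)
  then show ?thesis unfolding has_sum_def J_def W_def .
qed

section \<open>Matrix elements of the commutator\<close>

text \<open>An elementary tensor with an eigenvector as first factor needs no limit: the
  approximation in \<open>tensor_one\<close> is exact with one term.\<close>

lemma tens2_tensor_one:
  assumes e: "e \<in> E" and f: "f \<in> L2 M"
  shows "(tens2 e f, \<lambda>z. complex_of_real (ln (ev e)) * tens2 e f z) \<in> tensor_one M (log_op M \<gamma>)"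
proof -
  define c where "c = complex_of_real (ln (ev e))"
  have ec: "(e, \<lambda>x. c * e x) \<in> log_op M \<gamma>" unfolding c_def by (rule eigenvector_log[OF e])
  have z: "l2_norm (M \<Otimes>\<^sub>M M) (\<lambda>(x, y). tens2 e f (x, y) - (\<Sum>k<1::nat. e x * f y)) = 0"
      "l2_norm (M \<Otimes>\<^sub>M M) (\<lambda>(x, y). c * tens2 e f (x, y) - (\<Sum>k<1::nat. c * e x * f y)) = 0"
    by (simp_all add: tens2_def l2_norm_def case_prod_beta)
  have "\<forall>\<epsilon>>0. \<exists>(n::nat) F G h. (\<forall>k<n. (F k, G k) \<in> log_op M \<gamma> \<and> h k \<in> L2 M) \<and>
      l2_norm (M \<Otimes>\<^sub>M M) (\<lambda>(x, y). tens2 e f (x, y) - (\<Sum>k<n. F k x * h k y)) < \<epsilon> \<and>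
      l2_norm (M \<Otimes>\<^sub>M M) (\<lambda>(x, y). c * tens2 e f (x, y) - (\<Sum>k<n. G k x * h k y)) < \<epsilon>"
  proof (intro allI impI)
    fix \<epsilon> :: real assume \<epsilon>: "\<epsilon> > 0"
    show "\<exists>(n::nat) F G h. (\<forall>k<n. (F k, G k) \<in> log_op M \<gamma> \<and> h k \<in> L2 M) \<and>
      l2_norm (M \<Otimes>\<^sub>M M) (\<lambda>(x, y). tens2 e f (x, y) - (\<Sum>k<n. F k x * h k y)) < \<epsilon> \<and>
      l2_norm (M \<Otimes>\<^sub>M M) (\<lambda>(x, y). c * tens2 e f (x, y) - (\<Sum>k<n. G k x * h k y)) < \<epsilon>"
      by (rule exI[of _ 1], rule exI[of _ "\<lambda>_. e"], rule exI[of _ "\<lambda>_ x. c * e x"],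
          rule exI[of _ "\<lambda>_. f"]) (simp only: z ec f \<epsilon> simp_thms)
  qed
  then show ?thesis
    unfolding tensor_one_def c_def[symmetric] using tens2_L2[OF E_L2[OF e] f] L2_cmult[of "tens2 e f"] by simp
qed

text \<open>On these vectors the unbounded operator is multiplication by a real scalar, so each of
  the two terms of the commutator form is a scalar multiple of the same matrix element of
  \<open>A\<close>.\<close>

lemma commutator_matrix:
  assumes K: "bounded_commutator (M \<Otimes>\<^sub>M M) A (tensor_one M (log_op M \<gamma>)) K"
    and A: "\<And>c F. A (\<lambda>z. c * F z) = (\<lambda>z. c * A F z)"
    and "e \<in> E" "e' \<in> E" "f \<in> L2 M" "f' \<in> L2 M"
  shows "l2_inner (M \<Otimes>\<^sub>M M) (tens2 e f) (K (tens2 e' f'))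
    = of_real (ln (ev e') - ln (ev e)) * l2_inner (M \<Otimes>\<^sub>M M) (tens2 e f) (A (tens2 e' f'))"
proof -
  have "l2_inner (M \<Otimes>\<^sub>M M) (tens2 e f) (K (tens2 e' f'))
    = l2_inner (M \<Otimes>\<^sub>M M) (tens2 e f) (A (\<lambda>z. complex_of_real (ln (ev e')) * tens2 e' f' z))
      - l2_inner (M \<Otimes>\<^sub>M M) (\<lambda>z. complex_of_real (ln (ev e)) * tens2 e f z) (A (tens2 e' f'))"
    using K tens2_tensor_one[OF assms(3,5)] tens2_tensor_one[OF assms(4,6)]
    unfolding bounded_commutator_def by fast
  then show ?thesis
    by (simp add: A l2_inner_cmult_right l2_inner_cmult_left left_diff_distrib)
qed

end

lemma bounded_op_scale:
  assumes T: "bounded_op M T"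
  shows "bounded_op M (\<lambda>f z. c * T f z)"
proof -
  obtain C where C: "0 \<le> C" "\<And>f. f \<in> L2 M \<Longrightarrow> l2_norm M (T f) \<le> C * l2_norm M f"
    using bounded_op_bound[OF T] by blast
  have "l2_norm M (\<lambda>z. c * T f z) \<le> (cmod c * C) * l2_norm M f" if "f \<in> L2 M" for f
    using mult_left_mono[OF C(2)[OF that] norm_ge_zero[of c]] by (simp add: l2_norm_cmult mult.assoc)
  moreover have "vec_eq M (\<lambda>z. c * T (\<lambda>x. f x + g x) z) (\<lambda>x. c * T f x + c * T g x)"
    if "f \<in> L2 M" "g \<in> L2 M" for f g
    using bounded_op_add[OF T that] unfolding vec_eq_def by eventually_elim (simp add: distrib_left)
  moreover have "vec_eq M (\<lambda>z. c * T (\<lambda>x. a * f x) z) (\<lambda>x. a * (c * T f x))"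
    if "f \<in> L2 M" for f a
    using bounded_op_cmult[OF T that, of a] unfolding vec_eq_def by eventually_elim simp
  ultimately show ?thesis
    unfolding bounded_op_def using T by (auto intro!: L2_cmult)
qed

section \<open>The physical space\<close>

lemma cell_measurable: "{x :: real ^ 'd. \<forall>k. 0 \<le> x $ k \<and> x $ k < L} \<in> sets lborel"
proof -
  have [measurable]: "(\<lambda>x :: real ^ 'd. x $ k) \<in> borel_measurable borel" for k
    by (intro borel_measurable_continuous_onI continuous_intros)
  have "{x \<in> space borel. \<forall>k. 0 \<le> (x :: real ^ 'd) $ k \<and> x $ k < L} \<in> sets borel" by measurable
  then show ?thesis by simp
qed

lemma sigma_finite_space_measure: "sigma_finite_measure (space_measure \<Omega> :: (real ^ 'd) measure)"
  by (cases \<Omega>) (auto intro!: sigma_finite_measure_restrict_space cell_measurable lborel.sigma_finite_measure_axioms)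

lemma measurable_space_measure_ident: "(\<lambda>x. x) \<in> measurable (space_measure \<Omega> :: (real ^ 'd) measure) borel"
  by (cases \<Omega>) (auto intro!: measurable_restrict_space1)

theorem proposition3p2:
  fixes \<Omega> :: config_space
    and V :: "real ^ 'd \<Rightarrow> real"
    and \<gamma> :: "(real ^ 'd) operator"
    and X :: "((real ^ 'd) \<times> (real ^ 'd)) operator"
    and N m :: nat
    and i j :: "nat \<Rightarrow> nat"
  assumes "valid_space \<Omega>"
    and "density_op (space_measure \<Omega>) \<gamma>"
    and "faithful_op (space_measure \<Omega>) \<gamma>"
    and "finite_entropy (space_measure \<Omega>) \<gamma>"
    and "V \<in> borel_measurable borel" and "bounded (range V)"
    and "radially_symmetric \<Omega> V"
    and "bounded_two_body_op \<Omega> V \<gamma> X"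
    and "\<forall>\<nu>\<in>{1..m}. i \<nu> \<in> {1..N} \<and> j \<nu> \<in> {1..N} \<and> i \<nu> \<noteq> j \<nu>"
    and "(\<exists>\<nu>\<in>{1..m}. i \<nu> \<notin> i ` ({1..m} - {\<nu>}) \<union> j ` {1..m}) \<or>
         (\<exists>\<nu>\<in>{1..m}. j \<nu> \<notin> j ` ({1..m} - {\<nu>}) \<union> i ` {1..m})"
  shows "has_trace (Pow_measure (space_measure \<Omega>) N)
           (tensor_power_op (space_measure \<Omega>) N \<gamma> \<circ> pair_op_product (space_measure \<Omega>) N X m i j) 0"
proof -
  define M :: "(real ^ 'd) measure" where "M = space_measure \<Omega>"
  interpret sigma_finite_measure M unfolding M_def by (rule sigma_finite_space_measure)
  interpret faithful_density M \<gamma>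
    by unfold_locales (use assms in \<open>simp_all add: M_def\<close>)
  let ?A = "fluctuation_potential \<Omega> V \<gamma>"
  obtain K where K: "bounded_commutator (M \<Otimes>\<^sub>M M) ?A (tensor_one M (log_op M \<gamma>)) K"
    and XK: "\<And>F. X F = (\<lambda>z. - \<i> * K F z)"
    using assms(8) unfolding bounded_two_body_op_def M_def by blast
  have XX: "X = (\<lambda>F z. - \<i> * K F z)" using XK by blast
  have bX: "bounded_op (M \<Otimes>\<^sub>M M) X"
    using K unfolding XX bounded_commutator_def by (intro bounded_op_scale) blast
  have A: "?A (\<lambda>z. c * F z) = (\<lambda>z. c * ?A F z)" for c F
    by (auto simp: fluctuation_potential_def fun_eq_iff)
  have X: "l2_inner (M \<Otimes>\<^sub>M M) (tens2 e f) (X (tens2 e' f'))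
      = - \<i> * (of_real (ln (ev e') - ln (ev e)) * l2_inner (M \<Otimes>\<^sub>M M) (tens2 e f) (?A (tens2 e' f')))"
    if "e \<in> E" "e' \<in> E" "f \<in> L2 M" "f' \<in> L2 M" for e e' f f'
    unfolding XX l2_inner_cmult_right commutator_matrix[OF K A that] ..
  have first: "\<forall>e\<in>E. \<forall>f\<in>E. \<forall>g\<in>E. l2_inner (M \<Otimes>\<^sub>M M) (tens2 e f) (X (tens2 e g)) = 0"
    by (simp add: X E_L2)
  have second: "((\<lambda>e. of_real (ev e) * l2_inner (M \<Otimes>\<^sub>M M) (tens2 f e) (X (tens2 g e))) has_sum 0) E"
    if f: "f \<in> E" and g: "g \<in> E" for f g
  proof -
    note [measurable] = assms(5)
    obtain v where v: "\<And>x. \<bar>V x\<bar> \<le> v" using assms(6) unfolding bounded_iff by auto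
    have [measurable]: "(\<lambda>x. x) \<in> measurable M borel" unfolding M_def by (rule measurable_space_measure_ident)
    have "(\<lambda>z. fst z - snd z) \<in> borel_measurable (M \<Otimes>\<^sub>M M)"
      by (intro borel_measurable_diff measurable_compose[OF measurable_fst \<open>(\<lambda>x. x) \<in> measurable M borel\<close>]
          measurable_compose[OF measurable_snd \<open>(\<lambda>x. x) \<in> measurable M borel\<close>])
    from measurable_compose[OF this assms(5)]
    have Vm: "(\<lambda>z. V (fst z - snd z)) \<in> borel_measurable (M \<Otimes>\<^sub>M M)" .
    define U where "U = convolution \<Omega> V \<rho>"
    have U: "U x = (\<integral>y. V (fst (x, y) - snd (x, y)) * \<rho> y \<partial>M)" for x
      by (simp add: U_def convolution_def M_def)
    define h where "h x = cnj (f x) * g x" for x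
    have h: "integrable M h" unfolding h_def by (rule L2_inner_integrable[OF E_L2[OF f] E_L2[OF g]])
    \<comment> \<open>The same \<open>e\<close> stands on both sides, so the second variable carries
      the density of \<open>e\<close>, while the first variable carries \<open>h\<close>.\<close>
    have "l2_inner (M \<Otimes>\<^sub>M M) (tens2 f e) (?A (tens2 g e))
        = (\<integral>z. h (fst z) * of_real ((V (fst z - snd z) - U (fst z)) * (cmod (e (snd z)))\<^sup>2) \<partial>(M \<Otimes>\<^sub>M M))" for e
      unfolding l2_inner_def
      by (intro Bochner_Integration.integral_cong refl)
        (simp add: tens2_def fluctuation_potential_def case_prod_beta h_def U_def M_def complex_norm_square del: of_real_power)
    then have "((\<lambda>e. of_real (ev e) * l2_inner (M \<Otimes>\<^sub>M M) (tens2 f e) (?A (tens2 g e))) has_sum 0) E"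
      using fluctuation_average_zero[OF Vm v h U] by simp
    \<comment> \<open>The logarithms belong to the first factor and do not depend on the summation
      index \<open>e\<close>, so they come out as a constant.\<close>
    then have "((\<lambda>e. (- \<i> * of_real (ln (ev g) - ln (ev f))) * (of_real (ev e) * l2_inner (M \<Otimes>\<^sub>M M) (tens2 f e) (?A (tens2 g e))))
        has_sum (- \<i> * of_real (ln (ev g) - ln (ev f))) * 0) E"
      by (rule has_sum_cmult_right)
    then show ?thesis
      by (rule has_sum_eq_trans) (simp_all add: X f g E_L2 mult_ac)
  qed
  have ij: "i \<nu> \<in> {1..N} \<and> j \<nu> \<in> {1..N} \<and> i \<nu> \<noteq> j \<nu>" if "\<nu> \<in> {1..m}" for \<nu>
    using assms(9) that by blast
  from assms(10) show ?thesis
  proof (elim disjE bexE)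
    fix n assume n: "n \<in> {1..m}" "i n \<notin> i ` ({1..m} - {n}) \<union> j ` {1..m}"
    show ?thesis
      unfolding M_def[symmetric]
    proof (rule has_trace_pair_op_product[OF bX ij n(1), where a = "i n"])
      show "i n \<noteq> i \<nu> \<and> i n \<noteq> j \<nu>" if "\<nu> \<in> {1..m}" "\<nu> \<noteq> n" for \<nu> using n(2) that by blast
    qed (use first in blast)+
  next
    fix n assume n: "n \<in> {1..m}" "j n \<notin> j ` ({1..m} - {n}) \<union> i ` {1..m}"
    show ?thesis
      unfolding M_def[symmetric]
    proof (rule has_trace_pair_op_product[OF bX ij n(1), where a = "j n"])
      show "j n \<noteq> i \<nu> \<and> j n \<noteq> j \<nu>" if "\<nu> \<in> {1..m}" "\<nu> \<noteq> n" for \<nu> using n(2) that by blast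
    qed (use second in blast)+
  qed
qed

end
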